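(* Fix one of the ground state sequences (A) or (B). For each $m\in\mathbb Z$, the Fock space $\mathcal F_m$ carries the structure of an integrable $U_q(\mathfrak g)$-module, with $|m\rangle$ of weight $\lambda_m$ (i.e. $q^h|m\rangle=q^{\langle h,\lambda_m\rangle}|m\rangle$), in which the actions of $e_i,f_i$ on any vector $u\wedge|m+r\rangle$ ($u\in\bigwedge^rV_{\mathrm{aff}}$), obtained by applying the iterated coproduct $\Delta$ to the infinitely many wedge factors, converge in the $q$-adic topology, and such that for every $r\ge0$ the map $\bigwedge^rV_{\mathrm{aff}}\otimes\mathcal F_{m+r}\to\mathcal F_m$, $u\otimes w\mapsto u\wedge w$, is $U_q(\mathfrak g)$-linear (with $U_q(\mathfrak g)$ acting on the tensor product via $\Delta$).
   Context: Let $\mathfrak g=\widehat{\mathfrak{sl}}_2$, $I=\{0,1\}$, weight lattice $P=\mathbb Z\Lambda_0\oplus\mathbb Z\Lambda_1\oplus\mathbb Z\delta$, coroots $h_0,h_1$ with $\langle h_i,\Lambda_j\rangle=\delta_{ij}$, $\langle h_i,\delta\rangle=0$, central element $c=h_0+h_1$. $U_q(\mathfrak g)$ is the quantum affine algebra over $\mathbb Q(q)$ with generators $e_i,f_i$ ($i\in I$), $q^h$ ($h\in P^*$), $t_i=q^{h_i}$, and coproduct $\Delta(q^h)=q^h\otimes q^h$, $\Delta(e_i)=e_i\otimes1+t_i^{-1}\otimes e_i$, $\Delta(f_i)=f_i\otimes t_i+1\otimes f_i$. $[n]=(q^n-q^{-n})/(q-q^{-1})$; $A\subset\mathbb Q(q)$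 is the ring of rational functions regular at $q=0$. Let $J=\{0,1,2\}$. $V_{\mathrm{aff}}$ is the $\mathbb Q(q)$-space with basis $z^av_j$ ($a\in\mathbb Z$, $j\in J$), a $U_q(\mathfrak g)$-module via: $\mathrm{wt}(z^av_j)=2(1-j)(\Lambda_1-\Lambda_0)+a\delta$, $q^hz^av_j=q^{\langle h,\mathrm{wt}(z^av_j)\rangle}z^av_j$, $e_1z^av_j=[3-j]z^av_{j-1}$, $f_1z^av_j=[j+1]z^av_{j+1}$, $e_0z^av_j=[j+1]z^{a+1}v_{j+1}$, $f_0z^av_j=[3-j]z^{a-1}v_{j-1}$ (with $v_{-1}=v_3=0$). The operator $z^b$ sends $z^av_j\mapsto z^{a+b}v_j$. The crystal of $V_{\mathrm{aff}}$ is $B_{\mathrm{aff}}=\{z^ab_j\}$ with lower global base $G(z^ab_j)=z^av_j$. $N\subset V_{\mathrm{aff}}\otimes V_{\mathrm{aff}}$ is the smallest subspace containing $v_0\otimes v_0$ that is stable under the action of $U_q(\mathfrak g)$ (via $\Delta$) and under the operators $z\otimes z$, $z^{-1}\otimes z^{-1}$, $z\otimes1+1\otimes z$. For $n\ge2$, $N_n=\sum_{r=0}^{n-2}V_{\mathrm{aff}}^{\otimes r}\otimes N\otimes V_{\mathrm{aff}}^{\otimes(n-r-2)}$, $\bigwedge^nV_{\mathrm{aff}}:=V_{\mathrm{aff}}^{\otimes n}/N_n$, and $L(\bigwedge^nV_{\mathrm{aff}})$ is the image of the $A$-lattice spanned by all $G(c_1)\otimes\cdots\otimes G(c_n)$,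 $c_r\in B_{\mathrm{aff}}$. Ground state sequences with weights: (A) $b^\circ_m=zb_2$ for $m$ even, $b^\circ_m=b_0$ for $m$ odd, with $\lambda_{2n}=2\Lambda_0+(1-n)\delta$, $\lambda_{2n+1}=2\Lambda_1-n\delta$; (B) $b^\circ_m=b_1$, $\lambda_m=\Lambda_0+\Lambda_1$ for all $m$. (In both cases $\lambda_m=\mathrm{wt}(G(b^\circ_m))+\lambda_{m+1}$ and $\langle c,\lambda_m\rangle=2$.) Put $v^\circ_m=G(b^\circ_m)$. The pre-Fock space $\bar{\mathcal F}_m$ is the inductive limit of the spaces $\bigwedge^rV_{\mathrm{aff}}$ ($r\ge0$) along the maps $u\mapsto u\wedge v^\circ_{m+r}$; the image of $u\in\bigwedge^rV_{\mathrm{aff}}$ is written $u\wedge\overline{|m+r\rangle}$, and $\overline{|m\rangle}$ is the image of $1\in\bigwedge^0V_{\mathrm{aff}}$. $L(\bar{\mathcal F}_m)$ is the $A$-span of the images of the $L(\bigwedge^rV_{\mathrm{aff}})$. The Fock space is $\mathcal F_m=\bar{\mathcal F}_m/\bigcap_{n>0}q^nL(\bar{\mathcal F}_m)$, $|m\rangle$ is the image of $\overline{|m\rangle}$, $u\wedge|m+r\rangle$ the image of $u\wedge\overline{|m+r\rangle}$, $L(\mathcal F_m)$ is the image of $L(\bar{\mathcal F}_m)$, and $\mathcal F_m$ carries the $q$-adic topology with neighborhood basis of $0$ given by $\{q^nL(\mathcal F_m)\}_{n\ge0}$. An integrable module is one on which $q^h$ act diagonalizably with weights in $P$ and each $e_i,f_i$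 acts locally nilpotently. *)

theory Defs
  imports "HOL-Computational_Algebra.Polynomial" "HOL-Computational_Algebra.Fraction_Field"
begin

type_synonym K = "rat poly fract"

definition qq :: K where "qq = Fract [:0, 1:] 1"

definition qp :: "int \<Rightarrow> K" where "qp k = qq powi k"

definition qint :: "nat \<Rightarrow> K" where
  "qint n = (qp (int n) - qp (- int n)) / (qq - inverse qq)"

definition Areg :: "K set" where
  "Areg = {x. \<exists>a b. b \<noteq> 0 \<and> poly b 0 \<noteq> 0 \<and> x = Fract a b}"

(* a weight mu = c0*Lambda_0 + c1*Lambda_1 + d*delta is the triple (c0, c1, d);
   an element h of P^* is given by (<h,Lambda_0>, <h,Lambda_1>, <h,delta>) *)
type_synonym wt = "int \<times> int \<times> int"
type_synonym cowt = "int \<times> int \<times> int"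

definition pair :: "cowt \<Rightarrow> wt \<Rightarrow> int" where
  "pair h mu = fst h * fst mu + fst (snd h) * fst (snd mu) + snd (snd h) * snd (snd mu)"

definition cadd :: "cowt \<Rightarrow> cowt \<Rightarrow> cowt" where
  "cadd h h' = (fst h + fst h', fst (snd h) + fst (snd h'), snd (snd h) + snd (snd h'))"

definition cneg :: "cowt \<Rightarrow> cowt" where
  "cneg h = (- fst h, - fst (snd h), - snd (snd h))"

datatype I = i0 | i1

fun hcor :: "I \<Rightarrow> cowt" where
  "hcor i0 = (1, 0, 0)" | "hcor i1 = (0, 1, 0)"

fun alpha :: "I \<Rightarrow> wt" where
  "alpha i0 = (2, -2, 1)" | "alpha i1 = (-2, 2, 0)"

(* basis element z^a b_j is the pair (a, j), j \<in> {0,1,2} *)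
type_synonym bas = "int \<times> nat"
(* a vector of the tensor algebra: coefficient function on lists of basis elements;
   the list [c_1,...,c_n] stands for G(c_1) \<otimes> ... \<otimes> G(c_n) *)
type_synonym tens = "bas list \<Rightarrow> K"

definition wtb :: "bas \<Rightarrow> wt" where
  "wtb b = (let c = 2 * (1 - int (snd b)) in (- c, c, fst b))"

definition hw :: "cowt \<Rightarrow> bas list \<Rightarrow> int" where
  "hw h l = (\<Sum>b\<leftarrow>l. pair h (wtb b))"

definition Tn :: "nat \<Rightarrow> tens set" where
  "Tn n = {x. finite {l. x l \<noteq> 0} \<and>
              (\<forall>l. x l \<noteq> 0 \<longrightarrow> length l = n \<and> (\<forall>b\<in>set l. snd b \<le> 2))}"

(* action of e_i, f_i on V_aff, written as coefficient of the output basis vector *)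
fun eloc :: "I \<Rightarrow> (bas \<Rightarrow> K) \<Rightarrow> bas \<Rightarrow> K" where
  "eloc i1 y (a, k) = (if k \<le> 1 then qint (2 - k) * y (a, k + 1) else 0)"
| "eloc i0 y (a, k) = (if 1 \<le> k \<and> k \<le> 2 then qint k * y (a - 1, k - 1) else 0)"

fun floc :: "I \<Rightarrow> (bas \<Rightarrow> K) \<Rightarrow> bas \<Rightarrow> K" where
  "floc i1 y (a, k) = (if 1 \<le> k \<and> k \<le> 2 then qint k * y (a, k - 1) else 0)"
| "floc i0 y (a, k) = (if k \<le> 1 then qint (2 - k) * y (a + 1, k + 1) else 0)"

fun zloc :: "(bas \<Rightarrow> K) \<Rightarrow> bas \<Rightarrow> K" where
  "zloc y (a, k) = y (a - 1, k)"

definition atpos :: "nat \<Rightarrow> ((bas \<Rightarrow> K) \<Rightarrow> bas \<Rightarrow> K) \<Rightarrow> tens \<Rightarrow> tens" where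
  "atpos k g x l = (if k < length l then g (\<lambda>b. x (l[k := b])) (l ! k) else 0)"

(* iterated coproduct of e_i, f_i, q^h on tensor powers *)
definition Eop :: "I \<Rightarrow> tens \<Rightarrow> tens" where
  "Eop i x l = (\<Sum>k<length l. qp (- hw (hcor i) (take k l)) * atpos k (eloc i) x l)"

definition Fop :: "I \<Rightarrow> tens \<Rightarrow> tens" where
  "Fop i x l = (\<Sum>k<length l. atpos k (floc i) x l * qp (hw (hcor i) (drop (Suc k) l)))"

definition Kop :: "cowt \<Rightarrow> tens \<Rightarrow> tens" where
  "Kop h x l = qp (hw h l) * x l"

definition zz :: "tens \<Rightarrow> tens" where
  "zz x l = x (map (\<lambda>(a, j). (a - 1, j)) l)"

definition zzinv :: "tens \<Rightarrow> tens" where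
  "zzinv x l = x (map (\<lambda>(a, j). (a + 1, j)) l)"

definition zsum :: "tens \<Rightarrow> tens" where
  "zsum x l = atpos 0 zloc x l + atpos 1 zloc x l"

inductive_set Nsp :: "tens set" where
  gen: "(\<lambda>l. if l = [(0, 0), (0, 0)] then 1 else 0) \<in> Nsp"
| zero: "(\<lambda>l. 0) \<in> Nsp"
| add: "x \<in> Nsp \<Longrightarrow> y \<in> Nsp \<Longrightarrow> (\<lambda>l. x l + y l) \<in> Nsp"
| smult: "x \<in> Nsp \<Longrightarrow> (\<lambda>l. c * x l) \<in> Nsp"
| E: "x \<in> Nsp \<Longrightarrow> Eop i x \<in> Nsp"
| F: "x \<in> Nsp \<Longrightarrow> Fop i x \<in> Nsp"
| Kh: "x \<in> Nsp \<Longrightarrow> Kop h x \<in> Nsp"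
| z: "x \<in> Nsp \<Longrightarrow> zz x \<in> Nsp"
| zinv: "x \<in> Nsp \<Longrightarrow> zzinv x \<in> Nsp"
| zs: "x \<in> Nsp \<Longrightarrow> zsum x \<in> Nsp"

inductive_set Nn :: "nat \<Rightarrow> tens set" for n :: nat where
  gen: "y \<in> Nsp \<Longrightarrow> r + 2 \<le> n \<Longrightarrow> length a = r \<Longrightarrow> length b = n - r - 2 \<Longrightarrow>
        (\<forall>c\<in>set a \<union> set b. snd c \<le> 2) \<Longrightarrow>
        (\<lambda>l. if length l = n \<and> take r l = a \<and> drop (r + 2) l = b
              then y (take 2 (drop r l)) else 0) \<in> Nn n"
| zero: "(\<lambda>l. 0) \<in> Nn n"
| add: "x \<in> Nn n \<Longrightarrow> y \<in> Nn n \<Longrightarrow> (\<lambda>l. x l + y l) \<in> Nn n"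
| smult: "x \<in> Nn n \<Longrightarrow> (\<lambda>l. c * x l) \<in> Nn n"

definition Lat :: "nat \<Rightarrow> tens set" where
  "Lat n = {x \<in> Tn n. \<forall>l. x l \<in> Areg}"

datatype gsch = GS_A | GS_B

fun gs :: "gsch \<Rightarrow> int \<Rightarrow> bas" where
  "gs GS_A m = (if even m then (1, 2) else (0, 0))"
| "gs GS_B m = (0, 1)"

fun lam :: "gsch \<Rightarrow> int \<Rightarrow> wt" where
  "lam GS_A m = (if even m then (2, 0, 1 - m div 2) else (0, 2, - (m div 2)))"
| "lam GS_B m = (1, 1, 0)"

(* the map  u \<mapsto> u \<wedge> v\<degree>_{m+r} \<wedge> ... \<wedge> v\<degree>_{m+s-1}  from level r to level s (on representatives) *)
definition ext :: "gsch \<Rightarrow> int \<Rightarrow> nat \<Rightarrow> nat \<Rightarrow> tens \<Rightarrow> tens" where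
  "ext g m r s x l = (if length l = s \<and> r \<le> s \<and> drop r l = map (\<lambda>k. gs g (m + int k)) [r..<s]
                      then x (take r l) else 0)"

(* a representative (r, u) stands for u \<wedge> |m+r> *)
type_synonym rep = "nat \<times> tens"

definition validrep :: "rep \<Rightarrow> bool" where
  "validrep a = (snd a \<in> Tn (fst a))"

definition radd :: "gsch \<Rightarrow> int \<Rightarrow> rep \<Rightarrow> rep \<Rightarrow> rep" where
  "radd g m a b = (max (fst a) (fst b),
     \<lambda>l. ext g m (fst a) (max (fst a) (fst b)) (snd a) l + ext g m (fst b) (max (fst a) (fst b)) (snd b) l)"

definition rsmult :: "K \<Rightarrow> rep \<Rightarrow> rep" where
  "rsmult c a = (fst a, \<lambda>l. c * snd a l)"

fun lc :: "gsch \<Rightarrow> int \<Rightarrow> (K \<times> rep) list \<Rightarrow> rep" where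
  "lc g m [] = (0, \<lambda>l. 0)"
| "lc g m ((c, a) # xs) = radd g m (rsmult c a) (lc g m xs)"

(* image of a representative lies in q^n L(\<bar>F\<bar>_m) *)
definition inqL :: "gsch \<Rightarrow> int \<Rightarrow> nat \<Rightarrow> rep \<Rightarrow> bool" where
  "inqL g m n a = (\<exists>t\<ge>fst a. \<exists>z\<in>Lat t.
        (\<lambda>l. ext g m (fst a) t (snd a) l - qp (int n) * z l) \<in> Nn t)"

(* the image in F_m is zero: lies in \<Inter>_n q^n L(\<bar>F\<bar>_m) *)
definition fnull :: "gsch \<Rightarrow> int \<Rightarrow> rep \<Rightarrow> bool" where
  "fnull g m a = (\<forall>n. inqL g m n a)"

definition feq :: "gsch \<Rightarrow> int \<Rightarrow> rep \<Rightarrow> rep \<Rightarrow> bool" where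
  "feq g m a b = fnull g m (lc g m [(1, a), (-1, b)])"

definition vac :: rep where "vac = (0, \<lambda>l. if l = [] then 1 else 0)"

definition rwedge :: "nat \<Rightarrow> tens \<Rightarrow> rep \<Rightarrow> rep" where
  "rwedge r u w = (r + fst w, \<lambda>l. if r \<le> length l then u (take r l) * snd w (drop r l) else 0)"

type_synonym ops = "(int \<Rightarrow> I \<Rightarrow> rep \<Rightarrow> rep) \<times> (int \<Rightarrow> I \<Rightarrow> rep \<Rightarrow> rep) \<times> (int \<Rightarrow> cowt \<Rightarrow> rep \<Rightarrow> rep)"

definition well_defined_linear :: "gsch \<Rightarrow> int \<Rightarrow> (rep \<Rightarrow> rep) \<Rightarrow> bool" where
  "well_defined_linear g m T =
    ((\<forall>a. validrep a \<longrightarrow> validrep (T a)) \<and>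
     (\<forall>a b. validrep a \<longrightarrow> validrep b \<longrightarrow> feq g m a b \<longrightarrow> feq g m (T a) (T b)) \<and>
     (\<forall>a b. validrep a \<longrightarrow> validrep b \<longrightarrow> feq g m (T (radd g m a b)) (radd g m (T a) (T b))) \<and>
     (\<forall>a c. validrep a \<longrightarrow> feq g m (T (rsmult c a)) (rsmult c (T a))))"

(* defining relations of U_q(sl_2^) (Drinfeld-Jimbo presentation, with q^h, h \<in> P^* ) *)
definition Uq_module :: "gsch \<Rightarrow> int \<Rightarrow> (I \<Rightarrow> rep \<Rightarrow> rep) \<Rightarrow> (I \<Rightarrow> rep \<Rightarrow> rep) \<Rightarrow> (cowt \<Rightarrow> rep \<Rightarrow> rep) \<Rightarrow> bool" where
  "Uq_module g m E F Kh =
    ((\<forall>i. well_defined_linear g m (E i) \<and> well_defined_linear g m (F i)) \<and>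
     (\<forall>h. well_defined_linear g m (Kh h)) \<and>
     (\<forall>a. validrep a \<longrightarrow>
        feq g m (Kh (0, 0, 0) a) a \<and>
        (\<forall>h h'. feq g m (Kh h (Kh h' a)) (Kh (cadd h h') a)) \<and>
        (\<forall>h i. feq g m (Kh h (E i a)) (rsmult (qp (pair h (alpha i))) (E i (Kh h a)))) \<and>
        (\<forall>h i. feq g m (Kh h (F i a)) (rsmult (qp (- pair h (alpha i))) (F i (Kh h a)))) \<and>
        (\<forall>i j. feq g m (lc g m [(1, E i (F j a)), (-1, F j (E i a))])
             (if i = j then lc g m [(inverse (qq - inverse qq), Kh (hcor i) a),
                                    (- inverse (qq - inverse qq), Kh (cneg (hcor i)) a)]
              else (0, \<lambda>l. 0))) \<and>
        (\<forall>i j. i \<noteq> j \<longrightarrow>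
           fnull g m (lc g m [(1, E i (E i (E i (E j a)))), (- qint 3, E i (E i (E j (E i a)))),
                              (qint 3, E i (E j (E i (E i a)))), (-1, E j (E i (E i (E i a))))]) \<and>
           fnull g m (lc g m [(1, F i (F i (F i (F j a)))), (- qint 3, F i (F i (F j (F i a)))),
                              (qint 3, F i (F j (F i (F i a)))), (-1, F j (F i (F i (F i a))))]))))"

definition integrable :: "gsch \<Rightarrow> int \<Rightarrow> (I \<Rightarrow> rep \<Rightarrow> rep) \<Rightarrow> (I \<Rightarrow> rep \<Rightarrow> rep) \<Rightarrow> (cowt \<Rightarrow> rep \<Rightarrow> rep) \<Rightarrow> bool" where
  "integrable g m E F Kh =
    (\<forall>a. validrep a \<longrightarrow>
       (\<exists>xs :: (wt \<times> rep) list.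
          feq g m a (lc g m (map (\<lambda>p. (1, snd p)) xs)) \<and>
          (\<forall>p\<in>set xs. validrep (snd p) \<and>
               (\<forall>h. feq g m (Kh h (snd p)) (rsmult (qp (pair h (fst p))) (snd p))))) \<and>
       (\<forall>i. \<exists>n. fnull g m ((E i ^^ n) a)) \<and>
       (\<forall>i. \<exists>n. fnull g m ((F i ^^ n) a)))"

(* the actions of e_i, f_i on u \<wedge> |m+r> are the q-adic limits of the iterated coproduct
   applied to u \<wedge> v\<degree>_{m+r} \<wedge> ... \<wedge> v\<degree>_{m+s-1}  (tensored with the tail |m+s>, on which
   1 resp. t_i acts, t_i by the scalar q^<h_i, lambda_{m+s}>) *)
definition coproduct_limit :: "gsch \<Rightarrow> int \<Rightarrow> (I \<Rightarrow> rep \<Rightarrow> rep) \<Rightarrow> (I \<Rightarrow> rep \<Rightarrow> rep) \<Rightarrow> bool" where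
  "coproduct_limit g m E F =
    (\<forall>r u i. u \<in> Tn r \<longrightarrow>
       (\<forall>n. \<exists>S\<ge>r. \<forall>s\<ge>S.
          inqL g m n (lc g m [(1, E i (r, u)), (-1, (s, Eop i (ext g m r s u)))])) \<and>
       (\<forall>n. \<exists>S\<ge>r. \<forall>s\<ge>S.
          inqL g m n (lc g m [(1, F i (r, u)),
             (-1, (s, \<lambda>l. qp (pair (hcor i) (lam g (m + int s))) * Fop i (ext g m r s u) l))])))"

definition wedge_linear :: "gsch \<Rightarrow> ops \<Rightarrow> bool" where
  "wedge_linear g ops =
    (case ops of (E, F, Kh) \<Rightarrow>
     \<forall>m r u w. u \<in> Tn r \<longrightarrow> validrep w \<longrightarrow>
       (\<forall>u'. u' \<in> Tn r \<longrightarrow> (\<lambda>l. u l - u' l) \<in> Nn r \<longrightarrow>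
            feq g m (rwedge r u w) (rwedge r u' w)) \<and>
       (\<forall>w'. validrep w' \<longrightarrow> feq g (m + int r) w w' \<longrightarrow>
            feq g m (rwedge r u w) (rwedge r u w')) \<and>
       (\<forall>i. feq g m (E m i (rwedge r u w))
              (radd g m (rwedge r (Eop i u) w) (rwedge r (Kop (cneg (hcor i)) u) (E (m + int r) i w)))) \<and>
       (\<forall>i. feq g m (F m i (rwedge r u w))
              (radd g m (rwedge r (Fop i u) (Kh (m + int r) (hcor i) w)) (rwedge r u (F (m + int r) i w)))) \<and>
       (\<forall>h. feq g m (Kh m h (rwedge r u w)) (rwedge r (Kop h u) (Kh (m + int r) h w))))"

end

theory Submission
  imports Defs "HOL-Library.Function_Algebras" "HOL-Library.Product_Plus"
begin

text \<open>Semi-infinite wedges are modelled by functions on infinite sequences of basis elements that are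
  eventually equal to the ground state sequence.  The relations of \<open>N\<close> straighten a product \<open>c \<and> d\<close>
  of two basis elements, with coefficients in \<open>A\<close>, into products whose first factor has smaller
  rank, where the rank is a linear function normalised to vanish at the ground state.  Hence,
  modulo the span \<open>Z\<close> of the wedges containing \<open>c \<and> |m + 1\<rangle>\<close> with \<open>c\<close> of positive rank, every weight
  space of the lattice is a finitely generated \<open>A\<close>-module, and therefore \<open>\<Inter>\<^sub>n q\<^sup>n L \<subseteq> Z\<close>.  Conversely
  the same relations move \<open>c\<close> through the ground state while gaining powers of \<open>q\<close>, so that
  \<open>Z \<subseteq> \<Inter>\<^sub>n q\<^sup>n L\<close>.  With this algebraic description of the vectors that vanish in the Fock space, the
  operators \<open>e\<^sub>i\<close> and \<open>f\<^sub>i\<close> are well defined because they preserve \<open>Z\<close>; here \<open>e\<^sub>i |m\<rangle> = 0\<close>, and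
  \<open>f\<^sub>i |m\<rangle>\<close> is a geometric series with an explicit sum.  Commutators and local nilpotency follow by
  induction on the number of factors, and the Serre relations then hold because the
  module is integrable for each of the two copies of quantum \<open>sl\<^sub>2\<close>.\<close>

text \<open>The obstacle is that the kernel of the map to the Fock space is defined by a limit, and
  \<open>f_i\<close> of the vacuum by an infinite sum, while the relations of N only ever touch two
  neighbouring factors. The algebraic space Z removes the limit: every claim about the action
  becomes an equation modulo Z that involves finitely many factors. Only generation by normal forms
  is shown, not their independence. This suffices, because in a vector space over Q(q) a finitely
  generated A-submodule contains no nonzero vector that is divisible by all powers of q. The Serre
  relations are not computed on wedges. The Serre element S of \<open>e_i\<close> and
  \<open>e_j\<close> commutes with \<open>f_i\<close> and raises the weight for \<open>h_i\<close>
  by 4, and where \<open>e_i\<close> and \<open>f_i\<close> are locally nilpotent such an S must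
  vanish: a power of \<open>f_i\<close> that kills S x is still injective on the weight of S x. The
  relations for \<open>f_i\<close> follow by exchanging the two generators.\<close>

section \<open>Quantum integers in Q(q)\<close>

lemma qq_nz [simp]: "qq \<noteq> 0"
  by (simp add: qq_def Zero_fract_def eq_fract)

lemma qq_power: "qq ^ n = Fract ([:0, 1:] ^ n) 1"
  by (induction n) (simp_all add: qq_def One_fract_def)

lemma qq_power_neq_1:
  assumes "n > 0"
  shows "qq ^ n \<noteq> 1"
proof
  assume "qq ^ n = 1"
  then have "([:0, 1:] :: rat poly) ^ n = 1"
    by (simp add: qq_power One_fract_def eq_fract)
  then have "poly (([:0, 1:] :: rat poly) ^ n) 0 = poly 1 0"
    by simp
  with assms show False
    by (simp add: poly_power zero_power)
qed

lemma qq_powi_neq_1: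
  assumes "k \<noteq> 0"
  shows "qq powi k \<noteq> 1"
proof (cases "k > 0")
  case True
  then show ?thesis
    using qq_power_neq_1[of "nat k"] by (simp add: power_int_def)
next
  case False
  with assms show ?thesis
    using qq_power_neq_1[of "nat (- k)"] by (simp add: power_int_def field_simps)
qed

lemma qp_nz [simp]: "qp k \<noteq> 0"
  by (simp add: qp_def)

lemma qp_add: "qp (j + k) = qp j * qp k"
  by (simp add: qp_def power_int_add)

lemma qp_0 [simp]: "qp 0 = 1"
  by (simp add: qp_def)

lemma qp_minus: "qp (- k) = inverse (qp k)"
  by (simp add: qp_def power_int_minus)

lemma qp_diff: "qp (j - k) = qp j / qp k"
  by (simp add: qp_def power_int_diff)

lemma qp_nat: "qp (int n) = qq ^ n"
  by (simp add: qp_def)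

lemma qp_numeral [simp]: "qp (numeral n) = qq ^ numeral n"
  by (simp add: qp_def)

lemma qp_1 [simp]: "qp 1 = qq"
  by (simp add: qp_def)

lemma qp_neg_numeral [simp]: "qp (- numeral n) = inverse (qq ^ numeral n)"
  by (simp add: qp_minus)

lemma qp_neg_1 [simp]: "qp (- 1) = inverse qq"
  by (simp add: qp_minus)

lemma qp_neq_1: "k \<noteq> 0 \<Longrightarrow> qp k \<noteq> 1"
  by (simp add: qp_def qq_powi_neq_1)

text \<open>Integer arguments are needed because the weights that occur in the commutator of
  \<open>e_i\<close> and \<open>f_i\<close> may be negative, while \<open>qint\<close> takes
  naturals.\<close>

definition qi :: "int \<Rightarrow> K" where
  "qi k = (qp k - qp (- k)) / (qq - inverse qq)"

lemma qint_qi: "qint n = qi (int n)"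
  by (simp add: qint_def qi_def)

lemma qq_sq_neq_1: "qq * qq \<noteq> 1"
  using qq_power_neq_1[of 2] by (simp add: power2_eq_square)

lemma qq_neq_inverse [simp]: "qq \<noteq> inverse qq"
  by (metis qq_nz qq_sq_neq_1 right_inverse)

lemma qi_nz:
  assumes "k \<noteq> 0"
  shows "qi k \<noteq> 0"
proof
  assume "qi k = 0"
  then have "qp k = qp (- k)"
    by (simp add: qi_def)
  then have "qp (k + k) = 1"
    by (metis qp_add add.right_inverse qp_0)
  with assms qp_neq_1[of "k + k"] show False
    by simp
qed

lemma qi_0 [simp]: "qi 0 = 0"
  by (simp add: qi_def)

lemma qi_1 [simp]: "qi 1 = 1"
  by (simp add: qi_def)

lemma qi_minus: "qi (- k) = - qi k"
  by (simp add: qi_def diff_divide_distrib)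

lemma qi_2: "qi 2 = qq + inverse qq"
proof -
  have "(qq + inverse qq) * (qq - inverse qq) = qp 2 - qp (- 2)"
    by (simp add: algebra_simps power2_eq_square)
  then show ?thesis
    unfolding qi_def by (metis nonzero_mult_div_cancel_right right_minus_eq qq_neq_inverse)
qed

lemma qi_3: "qi 3 = qq ^ 2 + 1 + inverse (qq ^ 2)"
proof -
  have "(qq ^ 2 + 1 + inverse (qq ^ 2)) * (qq - inverse qq) = qp 3 - qp (- 3)"
    by (simp add: field_simps power2_eq_square power3_eq_cube)
  then show ?thesis
    unfolding qi_def by (metis nonzero_mult_div_cancel_right right_minus_eq qq_neq_inverse)
qed

lemma qint_simps [simp]:
  "qint 0 = 0" "qint (Suc 0) = 1" "qint 1 = 1" "qint 2 = qq + inverse qq"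
  "qint 3 = qq ^ 2 + 1 + inverse (qq ^ 2)"
  by (simp_all add: qint_qi qi_2 qi_3)

lemma qint_2_nz [simp]: "qq + inverse qq \<noteq> 0"
  using qi_nz[of 2] by (simp add: qi_2)

lemma qint_3_nz [simp]: "qq ^ 2 + 1 + inverse (qq ^ 2) \<noteq> 0"
  using qi_nz[of 3] by (simp add: qi_3)

text \<open>This number is [4] / [2]; it has to be divided out when \<open>f_1\<close> is applied
  for the fourth time, in \<open>rel_22\<close>.\<close>

lemma qq_2_plus_nz [simp]: "qq ^ 2 + inverse (qq ^ 2) \<noteq> 0"
proof
  assume "qq ^ 2 + inverse (qq ^ 2) = 0"
  then have "qq ^ 2 * qq ^ 2 + 1 = 0"
    by (metis (no_types) distrib_left mult_zero_right power_not_zero qq_nz right_inverse)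
  then have "qq ^ 8 = 1"
    by algebra
  then show False
    using qq_power_neq_1[of 8] by simp
qed

section \<open>The local ring A\<close>

lemma Areg_1 [simp]: "1 \<in> Areg"
  unfolding Areg_def One_fract_def by (intro CollectI exI[of _ 1]) simp

lemma Areg_0 [simp]: "0 \<in> Areg"
  unfolding Areg_def Zero_fract_def by (intro CollectI exI[of _ 0] exI[of _ 1]) simp

lemma Areg_qq [simp]: "qq \<in> Areg"
  unfolding Areg_def qq_def by (intro CollectI exI[of _ "[:0, 1:]"] exI[of _ 1]) simp

lemma Areg_add [simp]: "x \<in> Areg \<Longrightarrow> y \<in> Areg \<Longrightarrow> x + y \<in> Areg"
  unfolding Areg_def
  by safe (metis (no_types, lifting) add_fract mult_eq_0_iff poly_mult)

lemma Areg_mult [simp]: "x \<in> Areg \<Longrightarrow> y \<in> Areg \<Longrightarrow> x * y \<in> Areg"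
  unfolding Areg_def
  by safe (metis (no_types, lifting) mult_fract mult_eq_0_iff poly_mult)

lemma Areg_uminus [simp]: "x \<in> Areg \<Longrightarrow> - x \<in> Areg"
  unfolding Areg_def by safe (metis minus_fract)

lemma Areg_power [simp]: "x \<in> Areg \<Longrightarrow> x ^ n \<in> Areg"
  by (induction n) simp_all

text \<open>q is not a unit of A. The separation of finitely generated A-modules rests on
  this.\<close>

lemma qq_inverse_not_regular: "a \<in> Areg \<Longrightarrow> qq * a \<noteq> 1"
proof
  assume "a \<in> Areg" and *: "qq * a = 1"
  then obtain b c where bc: "poly c 0 \<noteq> 0" "a = Fract b c" "c \<noteq> 0"
    unfolding Areg_def by blast
  with * have "[:0, 1:] * b = c"
    by (simp add: qq_def One_fract_def eq_fract)
  with bc show False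
    by (metis mult_zero_left poly_mult poly_pCons add_0)
qed

text \<open>Splitting off the order of vanishing of the denominator at 0 leaves a denominator that
  is nonzero there.\<close>

lemma Areg_denominator:
  fixes x :: K
  obtains N where "qq ^ N * x \<in> Areg"
proof -
  obtain a b where ab: "x = Fract a b" "b \<noteq> 0"
    by (cases x) 
  obtain c where c: "b = [:0, 1:] ^ order 0 b * c" "\<not> [:0, 1:] dvd c"
    using order_decomp[OF ab(2), of 0] by auto
  have c0: "poly c 0 \<noteq> 0"
    using c(2) by (simp add: poly_eq_0_iff_dvd)
  then have "c \<noteq> 0"
    by auto
  have "qq ^ order 0 b * x = Fract ([:0, 1:] ^ order 0 b * a) b"
    by (simp add: ab qq_power)
  also have "\<dots> = Fract a c"
    using \<open>c \<noteq> 0\<close> ab(2) by (subst eq_fract(1)) (use c(1) in \<open>simp_all add: algebra_simps\<close>)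
  finally show ?thesis
    using that c0 \<open>c \<noteq> 0\<close> unfolding Areg_def by blast
qed

lemma Areg_common_denominator:
  fixes f :: "'a \<Rightarrow> K"
  assumes "finite S"
  obtains N where "\<And>s. s \<in> S \<Longrightarrow> qq ^ N * f s \<in> Areg"
proof -
  have "\<exists>N. \<forall>s\<in>S. qq ^ N * f s \<in> Areg"
    using assms
  proof induction
    case (insert s S)
    then obtain N where N: "\<forall>s\<in>S. qq ^ N * f s \<in> Areg"
      by blast
    obtain M where M: "qq ^ M * f s \<in> Areg"
      by (rule Areg_denominator)
    have "qq ^ (N + M) * f t \<in> Areg" if "t \<in> insert s S" for t
    proof (cases "t = s")
      case True
      have "qq ^ (N + M) * f t = qq ^ N * (qq ^ M * f s)"
        by (simp add: True power_add mult.assoc)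
      then show ?thesis
        using M by simp
    next
      case False
      have "qq ^ (N + M) * f t = qq ^ M * (qq ^ N * f t)"
        by (simp add: power_add mult_ac)
      moreover have "qq ^ N * f t \<in> Areg"
        using N False that by simp
      ultimately show ?thesis
        by (metis Areg_mult Areg_power Areg_qq)
    qed
    then show ?case
      by blast
  qed simp
  then show ?thesis
    using that by blast
qed

section \<open>Function spaces over Q(q) and A-spans\<close>

definition sc :: "K \<Rightarrow> ('a \<Rightarrow> K) \<Rightarrow> 'a \<Rightarrow> K" where
  "sc c f = (\<lambda>x. c * f x)"

lemma sc_apply [simp]: "sc c f x = c * f x"
  by (simp add: sc_def)

interpretation vs: vector_space sc
  by standard (simp_all add: fun_eq_iff algebra_simps)

abbreviation lin :: "(('a \<Rightarrow> K) \<Rightarrow> 'b \<Rightarrow> K) \<Rightarrow> bool" where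
  "lin \<equiv> Vector_Spaces.linear sc sc"

interpretation vsp: vector_space_pair sc sc ..

lemmas lin_simps = vsp.linear_add vsp.linear_scale vsp.linear_0 vsp.linear_diff

text \<open>A is a subset of \<open>K\<close> and not a type, so an A-module is represented by the
  A-combinations of \<open>S\<close> inside a \<open>K\<close>-space.\<close>

inductive_set Asp :: "('a \<Rightarrow> K) set \<Rightarrow> ('a \<Rightarrow> K) set" for S where
  zero: "0 \<in> Asp S"
| step: "k \<in> Areg \<Longrightarrow> x \<in> S \<Longrightarrow> y \<in> Asp S \<Longrightarrow> sc k x + y \<in> Asp S"

lemma Asp_induct [consumes 1, case_names zero step]:
  assumes "x \<in> Asp S" "P 0"
    "\<And>k x y. k \<in> Areg \<Longrightarrow> x \<in> S \<Longrightarrow> y \<in> Asp S \<Longrightarrow> P y \<Longrightarrow> P (sc k x + y)"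
  shows "P x"
  using assms(1)
proof (induction rule: Asp.induct)
  case zero
  then show ?case
    using assms(2) by (simp add: zero_fun_def)
next
  case (step k x y)
  then show ?case
    using assms(3)[of k x y] by (simp add: plus_fun_def sc_def)
qed

lemma Asp_base: "x \<in> S \<Longrightarrow> x \<in> Asp S"
  using Asp.step[OF Areg_1 _ Asp.zero, of x S] by simp

lemma Asp_add: "x \<in> Asp S \<Longrightarrow> y \<in> Asp S \<Longrightarrow> x + y \<in> Asp S"
  by (induction rule: Asp_induct) (simp_all add: add.assoc Asp.step)

lemma Asp_scale: "x \<in> Asp S \<Longrightarrow> k \<in> Areg \<Longrightarrow> sc k x \<in> Asp S"
  by (induction rule: Asp_induct) (simp_all add: vs.scale_right_distrib Asp.zero Asp.step)

lemma Asp_sum: "(\<And>a. a \<in> A \<Longrightarrow> f a \<in> Asp S) \<Longrightarrow> sum f A \<in> Asp S"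
  by (induction A rule: infinite_finite_induct) (simp_all add: Asp.zero Asp_add)

lemma Asp_linear_image:
  assumes "x \<in> Asp S" "lin f" "\<And>s. s \<in> S \<Longrightarrow> f s \<in> Asp T"
  shows "f x \<in> Asp T"
proof (rule Asp_induct[OF assms(1)])
  show "f 0 \<in> Asp T"
    by (simp add: Asp.zero vsp.linear_0[OF assms(2)])
next
  fix k x y
  assume "k \<in> Areg" "x \<in> S" "f y \<in> Asp T"
  then show "f (sc k x + y) \<in> Asp T"
    using assms(3) by (simp add: vsp.linear_add[OF assms(2)] vsp.linear_scale[OF assms(2)] Asp_add Asp_scale)
qed

text \<open>A linear form that is \<open>1\<close> at a nonzero \<open>y\<close> has bounded denominators on the finite set
  \<open>X\<close>, so \<open>y\<close> cannot be divisible by arbitrarily high powers of \<open>q\<close>.\<close>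

lemma finitely_generated_q_separated:
  assumes "finite X" and y: "\<And>n. \<exists>x\<in>Asp X. y = sc (qq ^ n) x"
  shows "y = 0"
proof (rule ccontr)
  interpret vkp: vector_space_pair sc "(*) :: K \<Rightarrow> K \<Rightarrow> K"
    by unfold_locales (simp_all add: distrib_left distrib_right)
  assume "y \<noteq> 0"
  then have "vs.independent {y}"
    by simp
  then obtain \<phi> where lin: "Vector_Spaces.linear sc (*) \<phi>" and y1: "\<phi> y = 1"
    using vkp.linear_independent_extend[of "{y}" "\<lambda>_. 1"] by auto
  obtain N where N: "\<And>x. x \<in> X \<Longrightarrow> qq ^ N * \<phi> x \<in> Areg"
    using Areg_common_denominator[OF assms(1)] by metis
  have *: "qq ^ N * \<phi> x \<in> Areg" if "x \<in> Asp X" for x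
  proof (rule Asp_induct[OF that])
    show "qq ^ N * \<phi> 0 \<in> Areg"
      by (simp add: vkp.linear_0[OF lin])
  next
    fix k x y
    assume step: "k \<in> Areg" "x \<in> X" "qq ^ N * \<phi> y \<in> Areg"
    have "qq ^ N * \<phi> (sc k x + y) = k * (qq ^ N * \<phi> x) + qq ^ N * \<phi> y"
      by (simp add: vkp.linear_add[OF lin] vkp.linear_scale[OF lin] distrib_left mult.left_commute)
    then show "qq ^ N * \<phi> (sc k x + y) \<in> Areg"
      by (metis step N Areg_add Areg_mult)
  qed
  \<comment> \<open>One power of q beyond the common denominator, so that q would divide
    \<open>\<phi> y = 1\<close> in A.\<close>
  obtain x where x: "x \<in> Asp X" "y = sc (qq ^ Suc N) x"
    using y by blast
  have "qq * (qq ^ N * \<phi> x) = \<phi> y"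
    by (simp add: x(2) vkp.linear_scale[OF lin])
  then show False
    using qq_inverse_not_regular[OF *[OF x(1)]] y1 by simp
qed

section \<open>Tensor powers of V_aff and the coproduct\<close>

text \<open>For a list \<open>l\<close> of basis elements this is the pure tensor of their global
  base vectors.\<close>

definition dl :: "'a \<Rightarrow> 'a \<Rightarrow> K" where
  "dl l = (\<lambda>l'. if l' = l then 1 else 0)"

abbreviation okb :: "bas \<Rightarrow> bool" where
  "okb c \<equiv> snd c \<le> 2"

abbreviation okl :: "bas list \<Rightarrow> bool" where
  "okl l \<equiv> \<forall>b\<in>set l. okb b"

text \<open>The tensor product of \<open>u\<close> and \<open>w\<close>. A coefficient function does
  not carry its degree, so the place \<open>r\<close> of the cut is an argument.\<close>

definition tp :: "nat \<Rightarrow> tens \<Rightarrow> tens \<Rightarrow> tens" where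
  "tp r u w l = (if r \<le> length l then u (take r l) * w (drop r l) else 0)"

text \<open>On a basis vector \<open>c\<close>, \<open>e\<^sub>i c = eco i c \<cdot> ece i c\<close> and \<open>f\<^sub>i c = fco i c \<cdot> fce i c\<close>; where the
  coefficient vanishes, the vector is a junk value.\<close>

fun eco :: "I \<Rightarrow> bas \<Rightarrow> K" where
  "eco i1 (a, j) = (if 1 \<le> j \<and> j \<le> 2 then qint (3 - j) else 0)"
| "eco i0 (a, j) = (if j \<le> 1 then qint (j + 1) else 0)"

fun ece :: "I \<Rightarrow> bas \<Rightarrow> bas" where
  "ece i1 (a, j) = (a, j - 1)"
| "ece i0 (a, j) = (a + 1, j + 1)"

fun fco :: "I \<Rightarrow> bas \<Rightarrow> K" where
  "fco i1 (a, j) = (if j \<le> 1 then qint (j + 1) else 0)"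
| "fco i0 (a, j) = (if 1 \<le> j \<and> j \<le> 2 then qint (3 - j) else 0)"

fun fce :: "I \<Rightarrow> bas \<Rightarrow> bas" where
  "fce i1 (a, j) = (a, j + 1)"
| "fce i0 (a, j) = (a - 1, j - 1)"

lemma linI: "(\<And>x y. f (x + y) = f x + f y) \<Longrightarrow> (\<And>c x. f (sc c x) = sc c (f x)) \<Longrightarrow> lin f"
  by (simp add: Vector_Spaces.linear_iff vs.vector_space_axioms)

lemma eloc_zero [simp]: "eloc i (\<lambda>b. 0) c = 0"
  by (cases i; cases c) auto

lemma floc_zero [simp]: "floc i (\<lambda>b. 0) c = 0"
  by (cases i; cases c) auto

lemma eloc_add: "eloc i (\<lambda>b. x b + y b) c = eloc i x c + eloc i y c"
  by (cases i; cases c) (auto simp: algebra_simps)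

lemma floc_add: "floc i (\<lambda>b. x b + y b) c = floc i x c + floc i y c"
  by (cases i; cases c) (auto simp: algebra_simps)

lemma eloc_mult: "eloc i (\<lambda>b. k * x b) c = k * eloc i x c"
  by (cases i; cases c) auto

lemma floc_mult: "floc i (\<lambda>b. k * x b) c = k * floc i x c"
  by (cases i; cases c) auto

lemma eloc_mult_right: "eloc i (\<lambda>b. x b * k) c = eloc i x c * k"
  by (cases i; cases c) auto

lemma floc_mult_right: "floc i (\<lambda>b. x b * k) c = floc i x c * k"
  by (cases i; cases c) auto

lemma zloc_add: "zloc (\<lambda>b. x b + y b) c = zloc x c + zloc y c"
  by (cases c) auto

lemma zloc_mult: "zloc (\<lambda>b. k * x b) c = k * zloc x c"
  by (cases c) auto

lemma lin_Eop: "lin (Eop i)"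
  by (rule linI)
    (auto simp: fun_eq_iff Eop_def atpos_def eloc_add eloc_mult distrib_left sum.distrib
      sum_distrib_left mult.left_commute intro!: sum.cong)

lemma lin_Fop: "lin (Fop i)"
  by (rule linI)
    (auto simp: fun_eq_iff Fop_def atpos_def floc_add floc_mult distrib_right sum.distrib
      sum_distrib_left mult.assoc intro!: sum.cong)

lemma lin_Kop: "lin (Kop h)"
  by (rule linI) (auto simp: fun_eq_iff Kop_def algebra_simps)

lemma lin_zz: "lin zz"
  by (rule linI) (auto simp: fun_eq_iff zz_def)

lemma lin_zzinv: "lin zzinv"
  by (rule linI) (auto simp: fun_eq_iff zzinv_def)

lemma lin_zsum: "lin zsum"
  by (rule linI)
    (auto simp: fun_eq_iff zsum_def atpos_def zloc_add zloc_mult algebra_simps)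

lemmas Eop_lin = lin_simps[OF lin_Eop]
lemmas Fop_lin = lin_simps[OF lin_Fop]

lemma lin_tp_right: "lin (tp r u)"
  by (rule linI) (auto simp: fun_eq_iff tp_def algebra_simps)

lemma lin_tp_left: "lin (\<lambda>u. tp r u w)"
  by (rule linI) (auto simp: fun_eq_iff tp_def algebra_simps)

lemmas tp_lin = lin_simps[OF lin_tp_right]
  lin_simps[OF lin_tp_left]

lemma tp_assoc: "tp r u (tp s v w) = tp (r + s) (tp r u v) w"
  by (auto simp: fun_eq_iff tp_def min_def drop_take add.commute)

lemma tp_dl: "length a = r \<Longrightarrow> tp r (dl a) (dl b) = dl (a @ b)"
  by (auto simp: fun_eq_iff tp_def dl_def append_eq_conv_conj) (metis append_take_drop_id)

lemma tp_0: "tp 0 (dl []) w = w"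
  by (simp add: fun_eq_iff tp_def dl_def)

lemma dl_Cons: "dl (c # l) = tp 1 (dl [c]) (dl l)"
  by (simp add: tp_dl)

lemma sum_lessThan_add: "(\<Sum>k<r + s. f k) = (\<Sum>k<r. f k) + (\<Sum>k<s. f (r + k))"
  for f :: "nat \<Rightarrow> 'a::comm_monoid_add"
  by (induction s) (simp_all add: add.assoc)

lemma hw_append: "hw h (l @ l') = hw h l + hw h l'"
  by (simp add: hw_def)

lemma hw_Nil [simp]: "hw h [] = 0"
  by (simp add: hw_def)

lemma hw_Cons: "hw h (c # l) = pair h (wtb c) + hw h l"
  by (simp add: hw_def)

lemma pair_cneg: "pair (cneg h) x = - pair h x"
  by (simp add: pair_def cneg_def)

lemma pair_cadd: "pair (cadd h h') x = pair h x + pair h' x"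
  by (simp add: pair_def cadd_def algebra_simps)

lemma hw_cneg: "hw (cneg h) l = - hw h l"
  by (induction l) (simp_all add: hw_Cons pair_cneg)

lemma hw_cadd: "hw (cadd h h') l = hw h l + hw h' l"
  by (induction l) (simp_all add: hw_Cons pair_cadd)

lemma tp_update:
  assumes "r \<le> length l"
  shows "k < r \<Longrightarrow> tp r u w (l[k := b]) = u ((take r l)[k := b]) * w (drop r l)"
    and "k < length l - r \<Longrightarrow> tp r u w (l[r + k := b]) = u (take r l) * w ((drop r l)[k := b])"
  using assms by (simp_all add: tp_def take_update_swap drop_update_swap list_update_beyond)

text \<open>Coassociativity, by cutting the sum over positions at \<open>r\<close>. A position
  inside \<open>u\<close> does not see \<open>w\<close>, while a position inside \<open>w\<close>
  collects t_i^-1 from all of \<open>u\<close>, hence \<open>cneg\<close>. In \<open>Fop_tp\<close>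
  the factor t_i comes from the right instead.\<close>

lemma Eop_tp:
  "Eop i (tp r u w) = tp r (Eop i u) w + tp r (Kop (cneg (hcor i)) u) (Eop i w)"
proof (rule ext)
  fix l :: "bas list"
  show "Eop i (tp r u w) l = (tp r (Eop i u) w + tp r (Kop (cneg (hcor i)) u) (Eop i w)) l"
  proof (cases "r \<le> length l")
    case False
    then show ?thesis
      by (simp add: Eop_def tp_def atpos_def)
  next
    case True
    define s where "s = length l - r"
    have len: "length l = r + s"
      using True by (simp add: s_def)
    have 1: "qp (- hw (hcor i) (take k l)) * atpos k (eloc i) (tp r u w) l =
        (qp (- hw (hcor i) (take k (take r l))) * atpos k (eloc i) u (take r l)) * w (drop r l)"
      if "k < r" for k
      using that True by (simp add: atpos_def tp_update eloc_mult_right)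
    have 2: "qp (- hw (hcor i) (take (r + k) l)) * atpos (r + k) (eloc i) (tp r u w) l =
        (qp (- hw (hcor i) (take r l)) * u (take r l)) *
        (qp (- hw (hcor i) (take k (drop r l))) * atpos k (eloc i) w (drop r l))"
      if "k < s" for k
      using that len
      by (simp add: atpos_def tp_update eloc_mult take_add hw_append qp_diff qp_minus divide_inverse)
    show ?thesis
      using True
      by (simp add: Eop_def len sum_lessThan_add 1 2 sum_distrib_left sum_distrib_right tp_def
          Kop_def hw_cneg flip: s_def)
  qed
qed

lemma Fop_tp:
  "Fop i (tp r u w) = tp r (Fop i u) (Kop (hcor i) w) + tp r u (Fop i w)"
proof (rule ext)
  fix l :: "bas list"
  show "Fop i (tp r u w) l = (tp r (Fop i u) (Kop (hcor i) w) + tp r u (Fop i w)) l"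
  proof (cases "r \<le> length l")
    case False
    then show ?thesis
      by (simp add: Fop_def tp_def atpos_def)
  next
    case True
    define s where "s = length l - r"
    have len: "length l = r + s"
      using True by (simp add: s_def)
    have "drop (Suc k) l = drop (Suc k) (take r l) @ drop r l" if "k < r" for k
      using that True by (metis Suc_leI append_take_drop_id drop_append length_take min.absorb2
          diff_is_0_eq drop0)
    then have 1: "atpos k (floc i) (tp r u w) l * qp (hw (hcor i) (drop (Suc k) l)) =
        (atpos k (floc i) u (take r l) * qp (hw (hcor i) (drop (Suc k) (take r l)))) *
        (qp (hw (hcor i) (drop r l)) * w (drop r l))"
      if "k < r" for k
      using that True by (simp add: atpos_def tp_update floc_mult_right hw_append qp_add)
    have drop_eq: "drop (Suc (r + k)) l = drop (Suc k) (drop r l)" for k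
      by (simp add: add.commute)
    have 2: "atpos (r + k) (floc i) (tp r u w) l * qp (hw (hcor i) (drop (Suc (r + k)) l)) =
        u (take r l) *
        (atpos k (floc i) w (drop r l) * qp (hw (hcor i) (drop (Suc k) (drop r l))))"
      if "k < s" for k
      using that len
      by (simp add: atpos_def tp_update floc_mult drop_eq del: drop_drop)
    show ?thesis
      using True
      by (simp add: Fop_def len sum_lessThan_add 1 2 sum_distrib_left sum_distrib_right tp_def
          Kop_def flip: s_def)
  qed
qed

lemma Kop_tp: "Kop h (tp r u w) = tp r (Kop h u) (Kop h w)"
proof (rule ext)
  fix l
  have "qp (hw h l) = qp (hw h (take r l)) * qp (hw h (drop r l))"
    by (metis hw_append qp_add append_take_drop_id)
  then have "qp (hw h l) * (u (take r l) * w (drop r l)) =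
      (qp (hw h (take r l)) * u (take r l)) * (qp (hw h (drop r l)) * w (drop r l))"
    by (simp only: mult_ac)
  then show "Kop h (tp r u w) l = tp r (Kop h u) (Kop h w) l"
    by (cases "r \<le> length l") (simp_all only: Kop_def tp_def if_True if_False mult_zero_right)
qed

lemma Kop_dl: "Kop h (dl l) = sc (qp (hw h l)) (dl l)"
  by (auto simp: fun_eq_iff Kop_def dl_def)

lemma dl_singleton_update:
  assumes "length l \<noteq> 1"
  shows "dl [c] (l[k := b]) = 0"
proof -
  have "length (l[k := b]) \<noteq> length [c]"
    using assms by simp
  then have "l[k := b] \<noteq> [c]"
    by (metis (no_types))
  then show ?thesis
    by (simp add: dl_def)
qed

lemma Eop_dl1: "okb c \<Longrightarrow> Eop i (dl [c]) = sc (eco i c) (dl [ece i c])"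
proof (rule ext)
  fix l
  assume c: "okb c"
  show "Eop i (dl [c]) l = sc (eco i c) (dl [ece i c]) l"
  proof (cases "length l = 1")
    case True
    then obtain b where b: "l = [b]"
      by (cases l) auto
    show ?thesis
      using c by (cases i; cases b; cases c)
        (auto simp: b Eop_def atpos_def dl_def numeral_2_eq_2 numeral_3_eq_3 le_Suc_eq)
  next
    case False
    then have "dl [ece i c] l = 0"
      by (auto simp: dl_def)
    then show ?thesis
      by (simp add: Eop_def atpos_def dl_singleton_update[OF False])
  qed
qed

lemma Fop_dl1: "okb c \<Longrightarrow> Fop i (dl [c]) = sc (fco i c) (dl [fce i c])"
proof (rule ext)
  fix l
  assume c: "okb c"
  show "Fop i (dl [c]) l = sc (fco i c) (dl [fce i c]) l"
  proof (cases "length l = 1")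
    case True
    then obtain b where b: "l = [b]"
      by (cases l) auto
    show ?thesis
      using c by (cases i; cases b; cases c)
        (auto simp: b Fop_def atpos_def dl_def numeral_2_eq_2 numeral_3_eq_3 le_Suc_eq)
  next
    case False
    then have "dl [fce i c] l = 0"
      by (auto simp: dl_def)
    then show ?thesis
      by (simp add: Fop_def atpos_def dl_singleton_update[OF False])
  qed
qed

lemma ece_ok: "okb c \<Longrightarrow> eco i c \<noteq> 0 \<Longrightarrow> okb (ece i c)"
  by (cases i; cases c) (auto split: if_splits)

lemma fce_ok: "okb c \<Longrightarrow> fco i c \<noteq> 0 \<Longrightarrow> okb (fce i c)"
  by (cases i; cases c) (auto split: if_splits)

lemma Tn_subspace: "vs.subspace (Tn n)"
proof (rule vs.subspaceI)
  show "0 \<in> Tn n"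
    by (simp add: Tn_def)
next
  fix x y
  assume xy: "x \<in> Tn n" "y \<in> Tn n"
  have *: "{l. (x + y) l \<noteq> 0} \<subseteq> {l. x l \<noteq> 0} \<union> {l. y l \<noteq> 0}"
    by auto
  then have "finite {l. (x + y) l \<noteq> 0}"
    by (rule finite_subset) (use xy in \<open>simp add: Tn_def\<close>)
  with * xy show "x + y \<in> Tn n"
    unfolding Tn_def by blast
next
  fix c x
  assume "x \<in> Tn n"
  moreover have "{l. sc c x l \<noteq> 0} \<subseteq> {l. x l \<noteq> 0}"
    by auto
  ultimately show "sc c x \<in> Tn n"
    unfolding Tn_def by (auto intro: finite_subset)
qed

lemmas Tn_0 = vs.subspace_0[OF Tn_subspace]
  and Tn_add = vs.subspace_add[OF Tn_subspace]
  and Tn_scale = vs.subspace_scale[OF Tn_subspace]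

lemma dl_Tn: "length l = n \<Longrightarrow> okl l \<Longrightarrow> dl l \<in> Tn n"
  by (auto simp: Tn_def dl_def)

lemma finite_support_expand:
  assumes "finite {l. u l \<noteq> 0}"
  shows "u = (\<Sum>l | u l \<noteq> 0. sc (u l) (dl l))"
proof
  fix l
  have "(\<Sum>l | u l \<noteq> 0. sc (u l) (dl l)) l = (\<Sum>l' | u l' \<noteq> 0. if l' = l then u l' else 0)"
    using assms by (induction rule: finite_induct) (simp_all add: dl_def)
  also have "\<dots> = u l"
    using assms by (simp add: sum.delta)
  finally show "u l = (\<Sum>l | u l \<noteq> 0. sc (u l) (dl l)) l"
    by simp
qed

lemma Tn_expand: "u \<in> Tn n \<Longrightarrow> u = (\<Sum>l | u l \<noteq> 0. sc (u l) (dl l))"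
  by (rule finite_support_expand) (simp add: Tn_def)

lemma Tn_lin_expand:
  assumes "u \<in> Tn n" "lin f"
  shows "f u = (\<Sum>l | u l \<noteq> 0. sc (u l) (f (dl l)))"
proof -
  have "f u = f (\<Sum>l | u l \<noteq> 0. sc (u l) (dl l))"
    using Tn_expand[OF assms(1)] by simp
  then show ?thesis
    by (simp add: vsp.linear_sum[OF assms(2)] vsp.linear_scale[OF assms(2)])
qed

lemma Tn_support: "u \<in> Tn n \<Longrightarrow> u l \<noteq> 0 \<Longrightarrow> length l = n \<and> okl l"
  by (auto simp: Tn_def)

lemma Tn_lin_into:
  assumes "u \<in> Tn n" "lin f" "vs.subspace S"
    and "\<And>l. length l = n \<Longrightarrow> okl l \<Longrightarrow> f (dl l) \<in> S"
  shows "f u \<in> S"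
  unfolding Tn_lin_expand[OF assms(1,2)]
  using assms by (intro vs.subspace_sum vs.subspace_scale) (auto dest: Tn_support)

lemma tp_Tn:
  assumes "u \<in> Tn r" "w \<in> Tn s"
  shows "tp r u w \<in> Tn (r + s)"
  using assms(1) lin_tp_left Tn_subspace
proof (rule Tn_lin_into)
  fix a :: "bas list"
  assume a: "length a = r" "okl a"
  show "tp r (dl a) w \<in> Tn (r + s)"
    using assms(2) lin_tp_right Tn_subspace
    by (rule Tn_lin_into) (use a in \<open>simp add: tp_dl dl_Tn ball_Un\<close>)
qed

lemma Eop_dl_Tn: "okl l \<Longrightarrow> Eop i (dl l) \<in> Tn (length l)"
proof (induction l)
  case Nil
  have *: "Eop i (dl []) = 0"
    by (auto simp: fun_eq_iff Eop_def atpos_def dl_def intro!: sum.neutral)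
  show ?case
    unfolding * by (rule Tn_0)
next
  case (Cons c l)
  have t: "u \<in> Tn 1 \<Longrightarrow> w \<in> Tn (length l) \<Longrightarrow> tp 1 u w \<in> Tn (length (c # l))" for u w
    using tp_Tn[of u 1 w "length l"] by simp
  have *: "Eop i (dl (c # l)) =
      tp 1 (sc (eco i c) (dl [ece i c])) (dl l) + tp 1 (Kop (cneg (hcor i)) (dl [c])) (Eop i (dl l))"
    using Cons by (subst dl_Cons) (simp add: Eop_tp Eop_dl1)
  moreover have "sc (eco i c) (dl [ece i c]) \<in> Tn 1"
    using Cons ece_ok[of c i] Tn_0
    by (cases "eco i c = 0") (auto intro!: Tn_scale dl_Tn)
  moreover have "Kop (cneg (hcor i)) (dl [c]) \<in> Tn 1"
    unfolding Kop_dl using Cons by (auto intro!: Tn_scale dl_Tn)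
  moreover have "dl l \<in> Tn (length l)" "Eop i (dl l) \<in> Tn (length l)"
    using Cons by (auto intro!: dl_Tn)
  ultimately show ?case
    unfolding * by (intro Tn_add t)
qed

lemma Fop_dl_Tn: "okl l \<Longrightarrow> Fop i (dl l) \<in> Tn (length l)"
proof (induction l)
  case Nil
  have *: "Fop i (dl []) = 0"
    by (auto simp: fun_eq_iff Fop_def atpos_def dl_def intro!: sum.neutral)
  show ?case
    unfolding * by (rule Tn_0)
next
  case (Cons c l)
  have t: "u \<in> Tn 1 \<Longrightarrow> w \<in> Tn (length l) \<Longrightarrow> tp 1 u w \<in> Tn (length (c # l))" for u w
    using tp_Tn[of u 1 w "length l"] by simp
  have *: "Fop i (dl (c # l)) =
      tp 1 (sc (fco i c) (dl [fce i c])) (Kop (hcor i) (dl l)) + tp 1 (dl [c]) (Fop i (dl l))"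
    using Cons by (subst dl_Cons) (simp add: Fop_tp Fop_dl1)
  moreover have "sc (fco i c) (dl [fce i c]) \<in> Tn 1"
    using Cons fce_ok[of c i] Tn_0
    by (cases "fco i c = 0") (auto intro!: Tn_scale dl_Tn)
  moreover have "Kop (hcor i) (dl l) \<in> Tn (length l)"
    unfolding Kop_dl using Cons by (auto intro!: Tn_scale dl_Tn)
  moreover have "dl [c] \<in> Tn 1" "Fop i (dl l) \<in> Tn (length l)"
    using Cons by (auto intro!: dl_Tn)
  ultimately show ?case
    unfolding * by (intro Tn_add t)
qed

lemma Eop_Tn: "u \<in> Tn r \<Longrightarrow> Eop i u \<in> Tn r"
  using Eop_dl_Tn lin_Eop Tn_subspace by (rule_tac Tn_lin_into) auto

lemma Fop_Tn: "u \<in> Tn r \<Longrightarrow> Fop i u \<in> Tn r"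
  using Fop_dl_Tn lin_Fop Tn_subspace by (rule_tac Tn_lin_into) auto

lemma Kop_Tn: "u \<in> Tn r \<Longrightarrow> Kop h u \<in> Tn r"
  by (rule Tn_lin_into[OF _ lin_Kop Tn_subspace])
    (auto simp: Kop_dl intro!: Tn_scale dl_Tn)

section \<open>The relation spaces N and N_n\<close>

lemma zz_dl: "zz (dl l) = dl (map (\<lambda>(a, j). (a + 1, j)) l)"
proof
  fix l'
  have "map (\<lambda>(a, j). (a - 1, j)) l' = l \<longleftrightarrow> l' = map (\<lambda>(a::int, j::nat). (a + 1, j)) l"
    by (auto simp: o_def case_prod_unfold)
  then show "zz (dl l) l' = dl (map (\<lambda>(a, j). (a + 1, j)) l) l'"
    by (simp add: zz_def dl_def)
qed

lemma zzinv_dl: "zzinv (dl l) = dl (map (\<lambda>(a, j). (a - 1, j)) l)"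
proof
  fix l'
  have "map (\<lambda>(a, j). (a + 1, j)) l' = l \<longleftrightarrow> l' = map (\<lambda>(a::int, j::nat). (a - 1, j)) l"
    by (auto simp: o_def case_prod_unfold)
  then show "zzinv (dl l) l' = dl (map (\<lambda>(a, j). (a - 1, j)) l) l'"
    by (simp add: zzinv_def dl_def)
qed

lemma zsum_dl:
  "zsum (dl [(a, i), (b, j)]) = dl [(a + 1, i), (b, j)] + dl [(a, i), (b + 1, j)]"
proof
  fix l
  show "zsum (dl [(a, i), (b, j)]) l = (dl [(a + 1, i), (b, j)] + dl [(a, i), (b + 1, j)]) l"
  proof (cases "length l = 2")
    case True
    then obtain c d where "l = [c, d]"
      by (auto simp: numeral_2_eq_2 length_Suc_conv)
    then show ?thesis
      by (cases c; cases d) (auto simp: zsum_def atpos_def dl_def)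
  next
    case False
    then have *: "l[k := c] \<noteq> [(a, i), (b, j)]" for k c
      by (metis length_list_update length_Cons list.size(3) numeral_2_eq_2)
    have "zloc (\<lambda>_. 0) c = 0" for c
      by (cases c) auto
    then show ?thesis
      using False by (auto simp: zsum_def atpos_def dl_def *)
  qed
qed

lemma Nsp_subspace: "vs.subspace Nsp"
  by (rule vs.subspaceI)
    (auto simp: zero_fun_def plus_fun_def sc_def intro: Nsp.zero Nsp.add Nsp.smult)

lemmas Nsp_0 = vs.subspace_0[OF Nsp_subspace]
  and Nsp_add = vs.subspace_add[OF Nsp_subspace]
  and Nsp_scale = vs.subspace_scale[OF Nsp_subspace]
  and Nsp_diff = vs.subspace_diff[OF Nsp_subspace]

lemma Nsp_Tn: "x \<in> Nsp \<Longrightarrow> x \<in> Tn 2"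
proof (induction rule: Nsp.induct)
  case gen
  show ?case
    using dl_Tn[of "[(0, 0), (0, 0)]" 2] by (simp add: dl_def)
next
  case zero
  then show ?case
    by (simp add: Tn_def)
next
  case (add x y)
  then show ?case
    using Tn_add[ of x 2 y] unfolding plus_fun_def by blast
next
  case (smult x c)
  then show ?case
    using Tn_scale[ of x 2 c] unfolding sc_def by blast
next
  case (z x)
  then show ?case
    by (rule_tac Tn_lin_into[OF _ lin_zz Tn_subspace]) (auto simp: zz_dl case_prod_unfold intro!: dl_Tn)
next
  case (zinv x)
  then show ?case
    by (rule_tac Tn_lin_into[OF _ lin_zzinv Tn_subspace]) (auto simp: zzinv_dl case_prod_unfold intro!: dl_Tn)
next
  case (zs x)
  show ?case
  proof (rule Tn_lin_into[OF zs.IH lin_zsum Tn_subspace])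
    fix l :: "bas list"
    assume l: "length l = 2" "okl l"
    then obtain a i b j where "l = [(a, i), (b, j)]"
      by (auto simp: numeral_2_eq_2 length_Suc_conv)
    with l show "zsum (dl l) \<in> Tn 2"
      by (auto simp: zsum_dl intro!: Tn_add dl_Tn)
  qed
qed (auto intro: Eop_Tn Fop_Tn Kop_Tn)

lemma Nn_subspace: "vs.subspace (Nn n)"
  by (rule vs.subspaceI)
    (auto simp: zero_fun_def plus_fun_def sc_def intro: Nn.zero Nn.add Nn.smult)

lemmas Nn_0 = vs.subspace_0[OF Nn_subspace]
  and Nn_add = vs.subspace_add[OF Nn_subspace]
  and Nn_scale = vs.subspace_scale[OF Nn_subspace]

lemma tp3_dl:
  assumes "y \<in> Tn 2" "length a = r" "length b = s"
  shows "tp r (dl a) (tp 2 y (dl b)) =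
    (\<lambda>l. if length l = r + 2 + s \<and> take r l = a \<and> drop (r + 2) l = b
      then y (take 2 (drop r l)) else 0)"
  using assms by (auto simp: fun_eq_iff tp_def dl_def add.commute)

text \<open>The generators of \<open>Nn\<close> carry pure tensors on both sides of a relation.
  Linearity in \<open>u\<close> and in \<open>w\<close> admits arbitrary tensors, which is what the
  coproduct produces.\<close>

lemma Nn_gen_tp:
  assumes "y \<in> Nsp" "u \<in> Tn r" "w \<in> Tn s"
  shows "tp r u (tp 2 y w) \<in> Nn (r + 2 + s)"
  using assms(2) lin_tp_left Nn_subspace
proof (rule Tn_lin_into)
  fix a :: "bas list"
  assume a: "length a = r" "okl a"
  have "lin (\<lambda>w. tp r (dl a) (tp 2 y w))"
    by (rule linI) (simp_all add: tp_lin)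
  from assms(3) this Nn_subspace show "tp r (dl a) (tp 2 y w) \<in> Nn (r + 2 + s)"
  proof (rule Tn_lin_into)
    fix b :: "bas list"
    assume b: "length b = s" "okl b"
    show "tp r (dl a) (tp 2 y (dl b)) \<in> Nn (r + 2 + s)"
      unfolding tp3_dl[OF Nsp_Tn[OF assms(1)] a(1) b(1)]
      by (rule Nn.gen) (use assms(1) a b in auto)
  qed
qed

text \<open>Elimination rule for \<open>Nn\<close> with the generators written by \<open>tp\<close>,
  the form to which \<open>Eop_tp\<close>, \<open>Fop_tp\<close> and \<open>Kop_tp\<close>
  apply.\<close>

lemma Nn_into:
  assumes "x \<in> Nn n" "lin f" "vs.subspace S"
    and "\<And>y r s a b. y \<in> Nsp \<Longrightarrow> n = r + 2 + s \<Longrightarrow> length a = r \<Longrightarrow> length b = s \<Longrightarrow> okl a \<Longrightarrow> okl b \<Longrightarrow>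
      f (tp r (dl a) (tp 2 y (dl b))) \<in> S"
  shows "f x \<in> S"
  using assms(1)
proof (induction rule: Nn.induct)
  case (gen y r a b)
  define s where "s = n - r - 2"
  have n: "n = r + 2 + s"
    using gen by (simp add: s_def)
  show ?case
    using assms(4)[of y r s a b] tp3_dl[OF Nsp_Tn[OF gen(1)], of a r b s] gen n by auto
next
  case zero
  show ?case
    using vsp.linear_0[OF assms(2)] vs.subspace_0[OF assms(3)] by (simp add: zero_fun_def)
next
  case (add x y)
  then show ?case
    using vsp.linear_add[OF assms(2), of x y] vs.subspace_add[OF assms(3)]
    by (simp add: plus_fun_def)
next
  case (smult x c)
  then show ?case
    using vsp.linear_scale[OF assms(2), of c x] vs.subspace_scale[OF assms(3)]
    by (simp add: sc_def)
qed

lemma Nn_Tn: "x \<in> Nn n \<Longrightarrow> x \<in> Tn n"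
proof (rule Nn_into[of x n "\<lambda>x. x" "Tn n"])
  fix y r s and a b :: "bas list"
  assume "y \<in> Nsp" "n = r + 2 + s" "length a = r" "length b = s" "okl a" "okl b"
  then show "tp r (dl a) (tp 2 y (dl b)) \<in> Tn n"
    using tp_Tn[of "dl a" r "tp 2 y (dl b)" "2 + s"] tp_Tn[of y 2 "dl b" s] 
    by (auto simp: dl_Tn Nsp_Tn add.assoc)
qed (auto simp: Tn_subspace intro: linI)

lemma Nsp_Nn: "y \<in> Nsp \<Longrightarrow> y \<in> Nn 2"
proof -
  assume "y \<in> Nsp"
  moreover have "tp 2 y (dl []) = y"
    using Nsp_Tn[OF \<open>y \<in> Nsp\<close>] by (auto simp: fun_eq_iff tp_def dl_def Tn_def)
  ultimately show ?thesis
    using Nn_gen_tp[of y "dl []" 0 "dl []" 0] dl_Tn[of "[]" 0]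
    by (simp add: tp_0 numeral_2_eq_2)
qed

lemma Nn_tp_left:
  assumes "u \<in> Tn r" "y \<in> Nn s"
  shows "tp r u y \<in> Nn (r + s)"
  using assms(2) lin_tp_right Nn_subspace
proof (rule Nn_into)
  fix y p t and a b :: "bas list"
  assume *: "y \<in> Nsp" "s = p + 2 + t" "length a = p" "length b = t" "okl a" "okl b"
  have "tp (r + p) (tp r u (dl a)) (tp 2 y (dl b)) \<in> Nn (r + p + 2 + t)"
    using * assms(1) by (intro Nn_gen_tp tp_Tn dl_Tn) auto
  then show "tp r u (tp p (dl a) (tp 2 y (dl b))) \<in> Nn (r + s)"
    using * by (simp add: tp_assoc add_ac)
qed

lemma Nn_tp_right:
  assumes "w \<in> Tn r" "y \<in> Nn s"
  shows "tp s y w \<in> Nn (s + r)"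
  using assms(2) lin_tp_left Nn_subspace
proof (rule Nn_into)
  fix y p t and a b :: "bas list"
  assume *: "y \<in> Nsp" "s = p + 2 + t" "length a = p" "length b = t" "okl a" "okl b"
  have "tp p (dl a) (tp 2 y (tp t (dl b) w)) \<in> Nn (p + 2 + (t + r))"
    using * assms(1) by (intro Nn_gen_tp tp_Tn dl_Tn) auto
  then show "tp s (tp p (dl a) (tp 2 y (dl b))) w \<in> Nn (s + r)"
    using * by (simp add: tp_assoc add_ac)
qed

lemma Eop_Nn:
  assumes "x \<in> Nn n"
  shows "Eop i x \<in> Nn n"
  using assms lin_Eop Nn_subspace
proof (rule Nn_into)
  fix y r s and a b :: "bas list"
  assume *: "y \<in> Nsp" "n = r + 2 + s" "length a = r" "length b = s" "okl a" "okl b"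
  have "dl a \<in> Tn r" "dl b \<in> Tn s"
    using * by (auto intro: dl_Tn)
  then show "Eop i (tp r (dl a) (tp 2 y (dl b))) \<in> Nn n"
    unfolding Eop_tp tp_lin *(2)
    by (intro Nn_add Nn_gen_tp Eop_Tn Kop_Tn Nsp.E Nsp.Kh *(1))
qed

lemma Fop_Nn:
  assumes "x \<in> Nn n"
  shows "Fop i x \<in> Nn n"
  using assms lin_Fop Nn_subspace
proof (rule Nn_into)
  fix y r s and a b :: "bas list"
  assume *: "y \<in> Nsp" "n = r + 2 + s" "length a = r" "length b = s" "okl a" "okl b"
  have "dl a \<in> Tn r" "dl b \<in> Tn s"
    using * by (auto intro: dl_Tn)
  then show "Fop i (tp r (dl a) (tp 2 y (dl b))) \<in> Nn n"
    unfolding Fop_tp Kop_tp tp_lin *(2)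
    by (intro Nn_add Nn_gen_tp Fop_Tn Kop_Tn Nsp.F Nsp.Kh *(1))
qed

lemma Kop_Nn:
  assumes "x \<in> Nn n"
  shows "Kop h x \<in> Nn n"
  using assms lin_Kop Nn_subspace
proof (rule Nn_into)
  fix y r s and a b :: "bas list"
  assume *: "y \<in> Nsp" "n = r + 2 + s" "length a = r" "length b = s" "okl a" "okl b"
  have "dl a \<in> Tn r" "dl b \<in> Tn s"
    using * by (auto intro: dl_Tn)
  then show "Kop h (tp r (dl a) (tp 2 y (dl b))) \<in> Nn n"
    unfolding Kop_tp *(2)
    by (intro Nn_gen_tp Kop_Tn Nsp.Kh *(1))
qed

section \<open>The weight grading\<close>

text \<open>Among tensors of a fixed length, the total \<open>z\<close>-degree and the total index determine the weight.\<close>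

definition wts :: "bas list \<Rightarrow> int \<times> int" where
  "wts l = (sum_list (map fst l), sum_list (map (\<lambda>b. int (snd b)) l))"

definition prj :: "int \<times> int \<Rightarrow> tens \<Rightarrow> tens" where
  "prj \<mu> x l = (if wts l = \<mu> then x l else 0)"

lemma wts_append: "wts (l @ l') = wts l + wts l'"
  by (simp add: wts_def)

lemma wts_Nil [simp]: "wts [] = 0"
  by (simp add: wts_def zero_prod_def)

lemma wts_Cons: "wts (c # l) = (fst c, int (snd c)) + wts l"
  by (simp add: wts_def)

lemma lin_prj: "lin (prj \<mu>)"
  by (rule linI) (auto simp: fun_eq_iff prj_def)

lemma prj_dl: "prj \<mu> (dl l) = (if wts l = \<mu> then dl l else 0)"
  by (auto simp: fun_eq_iff prj_def dl_def)

lemma wts_update: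
  assumes "k < length l"
  shows "wts (l[k := b]) = wts l - wts [l ! k] + wts [b]"
  using assms
proof (induction l arbitrary: k)
  case (Cons c l)
  then show ?case
    by (cases k) (auto simp: wts_Cons prod_eq_iff)
qed simp

text \<open>The change of \<^const>\<open>wts\<close> under \<open>e\<^sub>i\<close>.\<close>

definition ewt :: "I \<Rightarrow> int \<times> int" where
  "ewt i = (case i of i1 \<Rightarrow> (0, -1) | i0 \<Rightarrow> (1, 1))"

text \<open>The output coefficient at \<open>c\<close> reads only vectors of one weight; this makes
  \<open>e_i\<close> homogeneous in \<open>prj_Eop\<close>.\<close>

lemma eloc_cong: "(\<And>b. wts [b] = wts [c] - ewt i \<Longrightarrow> x b = y b) \<Longrightarrow> eloc i x c = eloc i y c"
  by (cases i; cases c) (auto simp: wts_def ewt_def of_nat_diff)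

lemma floc_cong: "(\<And>b. wts [b] = wts [c] + ewt i \<Longrightarrow> x b = y b) \<Longrightarrow> floc i x c = floc i y c"
  by (cases i; cases c) (auto simp: wts_def ewt_def of_nat_diff)

lemma prj_Eop: "prj \<mu> (Eop i x) = Eop i (prj (\<mu> - ewt i) x)"
proof
  fix l
  have "atpos k (eloc i) (prj (\<mu> - ewt i) x) l = (if wts l = \<mu> then atpos k (eloc i) x l else 0)" for k
  proof (cases "k < length l")
    case True
    have "eloc i (\<lambda>b. prj (\<mu> - ewt i) x (l[k := b])) (l ! k) =
        eloc i (\<lambda>b. if wts l = \<mu> then x (l[k := b]) else 0) (l ! k)"
      by (rule eloc_cong) (simp add: prj_def wts_update[OF True])
    then show ?thesis
      by (simp add: atpos_def)
  qed (simp add: atpos_def)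
  then show "prj \<mu> (Eop i x) l = Eop i (prj (\<mu> - ewt i) x) l"
    by (auto simp: Eop_def prj_def)
qed

lemma prj_Fop: "prj \<mu> (Fop i x) = Fop i (prj (\<mu> + ewt i) x)"
proof
  fix l
  have "atpos k (floc i) (prj (\<mu> + ewt i) x) l = (if wts l = \<mu> then atpos k (floc i) x l else 0)" for k
  proof (cases "k < length l")
    case True
    have "floc i (\<lambda>b. prj (\<mu> + ewt i) x (l[k := b])) (l ! k) =
        floc i (\<lambda>b. if wts l = \<mu> then x (l[k := b]) else 0) (l ! k)"
      by (rule floc_cong) (simp add: prj_def wts_update[OF True])
    then show ?thesis
      by (simp add: atpos_def)
  qed (simp add: atpos_def)
  then show "prj \<mu> (Fop i x) l = Fop i (prj (\<mu> + ewt i) x) l"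
    by (auto simp: Fop_def prj_def)
qed

lemma prj_Kop: "prj \<mu> (Kop h x) = Kop h (prj \<mu> x)"
  by (auto simp: fun_eq_iff prj_def Kop_def)

lemma wts_map: "wts (map (\<lambda>(a, j). (a + k, j)) l) = wts l + (k * int (length l), 0)"
  by (induction l) (auto simp: wts_Cons algebra_simps zero_prod_def)

lemma wts_map_minus: "wts (map (\<lambda>(a, j). (a - k, j)) l) = wts l - (k * int (length l), 0)"
  using wts_map[of "- k" l] by simp

lemma Tn_eqI:
  assumes "u \<in> Tn n" "lin f" "lin g" "\<And>l. length l = n \<Longrightarrow> okl l \<Longrightarrow> f (dl l) = g (dl l)"
  shows "f u = g u"
proof -
  have "{l. u l \<noteq> 0} \<subseteq> {l. length l = n \<and> okl l}"
    using assms(1) by (auto simp: Tn_def)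
  then show ?thesis
    unfolding Tn_lin_expand[OF assms(1,2)] Tn_lin_expand[OF assms(1,3)]
    using assms(4) by (intro sum.cong) auto
qed

lemma lin_comp: "lin f \<Longrightarrow> lin g \<Longrightarrow> lin (\<lambda>x. f (g x))"
  by (rule linI) (simp_all only: vsp.linear_add vsp.linear_scale)

lemma Nsp_dl: "dl [(0, 0), (0, 0)] \<in> Nsp"
  using Nsp.gen by (simp only: dl_def)

text \<open>N is graded, since its generator is homogeneous and each closure operation shifts
  weights by a constant. The grading allows the kernel of the map to the Fock space to be found one
  weight at a time.\<close>

lemma prj_Nsp: "x \<in> Nsp \<Longrightarrow> prj \<mu> x \<in> Nsp"
proof (induction arbitrary: \<mu> rule: Nsp.induct)
  case gen
  have "prj \<mu> (dl [(0, 0), (0, 0)]) \<in> Nsp"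
    using Nsp_dl Nsp_0 by (simp only: prj_dl split: if_split) simp
  then show ?case
    by (simp only: dl_def)
next
  case zero
  then show ?case
    using Nsp.zero by (simp add: prj_def[abs_def])
next
  case (add x y)
  then have "prj \<mu> (x + y) \<in> Nsp"
    unfolding vsp.linear_add[OF lin_prj] by (intro Nsp_add)
  then show ?case
    unfolding plus_fun_def .
next
  case (smult x c)
  then have "prj \<mu> (sc c x) \<in> Nsp"
    unfolding vsp.linear_scale[OF lin_prj] by (intro Nsp_scale)
  then show ?case
    unfolding sc_def .
next
  case (z x)
  have "prj \<mu> (zz x) = zz (prj (\<mu> - (2, 0)) x)"
    using Nsp_Tn[OF z(1)]
    by (rule Tn_eqI[OF _ lin_comp[OF lin_prj lin_zz] lin_comp[OF lin_zz lin_prj]])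
      (auto simp: zz_dl prj_dl wts_map vsp.linear_0[OF lin_zz])
  then show ?case
    by (simp only:) (intro Nsp.z z.IH)
next
  case (zinv x)
  have "prj \<mu> (zzinv x) = zzinv (prj (\<mu> + (2, 0)) x)"
    using Nsp_Tn[OF zinv(1)]
    by (rule Tn_eqI[OF _ lin_comp[OF lin_prj lin_zzinv] lin_comp[OF lin_zzinv lin_prj]])
      (auto simp: zzinv_dl prj_dl wts_map_minus vsp.linear_0[OF lin_zzinv])
  then show ?case
    by (simp only:) (intro Nsp.zinv zinv.IH)
next
  case (zs x)
  have "prj \<mu> (zsum x) = zsum (prj (\<mu> - (1, 0)) x)"
  proof (rule Tn_eqI[OF Nsp_Tn[OF zs(1)] lin_comp[OF lin_prj lin_zsum] lin_comp[OF lin_zsum lin_prj]])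
    fix l :: "bas list"
    assume "length l = 2"
    then obtain a i b j where "l = [(a, i), (b, j)]"
      by (auto simp: numeral_2_eq_2 length_Suc_conv)
    then show "prj \<mu> (zsum (dl l)) = zsum (prj (\<mu> - (1, 0)) (dl l))"
      by (cases \<mu>) (auto simp: zsum_dl prj_dl vsp.linear_add[OF lin_prj] wts_Cons vsp.linear_0[OF lin_zsum])
  qed
  then show ?case
    by (simp only:) (intro Nsp.zs zs.IH)
qed (simp_all only: prj_Eop prj_Fop prj_Kop, (intro Nsp.E Nsp.F Nsp.Kh; assumption)+)

lemma prj_tp_dl_left:
  assumes "length a = r"
  shows "prj \<mu> (tp r (dl a) x) = tp r (dl a) (prj (\<mu> - wts a) x)"
proof
  fix l
  show "prj \<mu> (tp r (dl a) x) l = tp r (dl a) (prj (\<mu> - wts a) x) l"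
  proof (cases "r \<le> length l \<and> take r l = a")
    case True
    then have "wts l = wts a + wts (drop r l)"
      by (metis wts_append append_take_drop_id)
    then have "wts l = \<mu> \<longleftrightarrow> wts (drop r l) = \<mu> - wts a"
      by (simp add: eq_diff_eq add.commute)
    with True show ?thesis
      by (simp add: prj_def tp_def)
  qed (auto simp: prj_def tp_def dl_def)
qed

lemma prj_tp_dl_right: "prj \<mu> (tp r x (dl b)) = tp r (prj (\<mu> - wts b) x) (dl b)"
proof
  fix l
  show "prj \<mu> (tp r x (dl b)) l = tp r (prj (\<mu> - wts b) x) (dl b) l"
  proof (cases "r \<le> length l \<and> drop r l = b")
    case True
    then have "wts l = wts (take r l) + wts b"
      by (metis wts_append append_take_drop_id)
    then have "wts l = \<mu> \<longleftrightarrow> wts (take r l) = \<mu> - wts b"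
      by (simp add: eq_diff_eq)
    with True show ?thesis
      by (simp add: prj_def tp_def)
  qed (auto simp: prj_def tp_def dl_def)
qed

lemma prj_Nn:
  assumes "x \<in> Nn n"
  shows "prj \<mu> x \<in> Nn n"
  using assms lin_prj Nn_subspace
proof (rule Nn_into)
  fix y r s and a b :: "bas list"
  assume *: "y \<in> Nsp" "n = r + 2 + s" "length a = r" "length b = s" "okl a" "okl b"
  then show "prj \<mu> (tp r (dl a) (tp 2 y (dl b))) \<in> Nn n"
    by (auto simp: prj_tp_dl_left prj_tp_dl_right simp del: add_2_eq_Suc' intro!: Nn_gen_tp prj_Nsp dl_Tn)
qed

lemma prj_Tn: "u \<in> Tn n \<Longrightarrow> prj \<mu> u \<in> Tn n"
  by (rule Tn_lin_into[OF _ lin_prj Tn_subspace])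
    (auto simp: prj_dl Tn_0 intro: dl_Tn)

lemma prj_Lat: "u \<in> Lat n \<Longrightarrow> prj \<mu> u \<in> Lat n"
  unfolding Lat_def by (auto simp: prj_Tn) (simp add: prj_def)

section \<open>Straightening two factors\<close>

lemma Eop_dl2:
  assumes "okb c" "okb d"
  shows "Eop i (dl [c, d]) = sc (eco i c) (dl [ece i c, d]) +
    sc (qp (- pair (hcor i) (wtb c)) * eco i d) (dl [c, ece i d])"
proof -
  have "Eop i (dl [c, d]) = Eop i (tp 1 (dl [c]) (dl [d]))"
    by (simp add: tp_dl)
  then show ?thesis
    using assms by (simp only: Eop_tp Eop_dl1 Kop_dl tp_lin hw_Cons hw_Nil pair_cneg)
      (simp add: tp_dl fun_eq_iff mult.assoc)
qed

lemma Fop_dl2: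
  assumes "okb c" "okb d"
  shows "Fop i (dl [c, d]) = sc (fco i c * qp (pair (hcor i) (wtb d))) (dl [fce i c, d]) +
    sc (fco i d) (dl [c, fce i d])"
proof -
  have "Fop i (dl [c, d]) = Fop i (tp 1 (dl [c]) (dl [d]))"
    by (simp add: tp_dl)
  then show ?thesis
    using assms by (simp only: Fop_tp Fop_dl1 Kop_dl tp_lin hw_Cons hw_Nil)
      (simp add: tp_dl fun_eq_iff mult_ac)
qed

lemma Nsp_unscale: "sc k x \<in> Nsp \<Longrightarrow> k \<noteq> 0 \<Longrightarrow> x \<in> Nsp"
  using Nsp_scale[ of "sc k x" "inverse k"] by (simp add: vs.scale_scale)

text \<open>There is one relation for each pair of indices i, j. Up to powers of z its leading term
  is v_i \<otimes> v_j with coefficient 1, and all other coefficients lie in qA. The first five are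
  the divided powers of \<open>f_1\<close> on v_0 \<otimes> v_0; the other four start from
  \<open>e_0\<close>.\<close>

lemma rel_00: "dl [(0, 0), (0, 0)] \<in> Nsp"
  by (rule Nsp_dl)

lemma rel_01: "dl [(0, 0), (0, 1)] + sc (qq\<^sup>2) (dl [(0, 1), (0, 0)]) \<in> Nsp"
proof -
  have "Fop i1 (dl [(0, 0), (0, 0)]) = dl [(0, 0), (0, 1)] + sc (qq\<^sup>2) (dl [(0, 1), (0, 0)])"
    by (simp add: Fop_dl2 pair_def wtb_def fun_eq_iff)
  then show ?thesis
    using Nsp.F[OF rel_00, of i1] by (simp only:)
qed

lemma rel_02: "dl [(0, 0), (0, 2)] + sc qq (dl [(0, 1), (0, 1)]) + sc (qq ^ 4) (dl [(0, 2), (0, 0)]) \<in> Nsp"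
    (is "?R \<in> _")
proof -
  have "Fop i1 (dl [(0, 0), (0, 1)] + sc (qq\<^sup>2) (dl [(0, 1), (0, 0)])) = sc (qint 2) ?R"
    by (simp add: Fop_lin Fop_dl2 pair_def wtb_def fun_eq_iff numeral_2_eq_2[symmetric])
      (simp add: field_simps power2_eq_square power4_eq_xxxx)
  then show ?thesis
    using Nsp.F[OF rel_01, of i1] Nsp_unscale[of "qint 2" ?R] by (simp only: qint_simps) simp
qed

lemma rel_12: "dl [(0, 1), (0, 2)] + sc (qq\<^sup>2) (dl [(0, 2), (0, 1)]) \<in> Nsp"
    (is "?R \<in> _")
proof -
  have "Fop i1 (dl [(0, 0), (0, 2)] + sc qq (dl [(0, 1), (0, 1)]) + sc (qq ^ 4) (dl [(0, 2), (0, 0)])) =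
      sc (qint 3) ?R"
    by (simp add: Fop_lin Fop_dl2 pair_def wtb_def fun_eq_iff numeral_2_eq_2[symmetric])
      (simp add: field_simps power2_eq_square power4_eq_xxxx)
  then show ?thesis
    using Nsp.F[OF rel_02, of i1] Nsp_unscale[of "qint 3" ?R] by (simp only: qint_simps) simp
qed

lemma rel_22: "dl [(0, 2), (0, 2)] \<in> Nsp" (is "?R \<in> _")
proof -
  have "Fop i1 (dl [(0, 1), (0, 2)] + sc (qq\<^sup>2) (dl [(0, 2), (0, 1)])) =
      sc (qint 2 * (qq\<^sup>2 + inverse (qq\<^sup>2))) ?R"
    by (simp add: Fop_lin Fop_dl2 pair_def wtb_def fun_eq_iff numeral_2_eq_2[symmetric])
      (simp add: field_simps power2_eq_square power4_eq_xxxx)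
  then show ?thesis
    using Nsp.F[OF rel_12, of i1] Nsp_unscale[of "qint 2 * (qq\<^sup>2 + inverse (qq\<^sup>2))" ?R]
    by (simp only: qint_simps) simp
qed

lemma rel_10: "dl [(1, 1), (0, 0)] + sc (qq\<^sup>2) (dl [(0, 0), (1, 1)]) \<in> Nsp"
    (is "?R \<in> _")
proof -
  have "Eop i0 (dl [(0, 0), (0, 0)]) = ?R"
    by (simp add: Eop_dl2 pair_def wtb_def fun_eq_iff)
  then show ?thesis
    using Nsp.E[OF rel_00, of i0] by (simp only:)
qed

lemma rel_11: "dl [(1, 1), (0, 1)] + sc (qq\<^sup>2) (dl [(0, 1), (1, 1)]) +
      sc (qq + qq ^ 3) (dl [(0, 0), (1, 2)] + dl [(1, 2), (0, 0)]) \<in> Nsp"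
    (is "?R \<in> _")
proof -
  have "Fop i1 (dl [(1, 1), (0, 0)] + sc (qq\<^sup>2) (dl [(0, 0), (1, 1)])) = ?R"
    by (simp add: Fop_lin Fop_dl2 pair_def wtb_def fun_eq_iff numeral_2_eq_2[symmetric])
      (simp add: field_simps power2_eq_square power3_eq_cube)
  then show ?thesis
    using Nsp.F[OF rel_10, of i1] by (simp only:)
qed

lemma rel_20: "dl [(2, 2), (0, 0)] + sc qq (dl [(1, 1), (1, 1)]) + sc (qq ^ 4) (dl [(0, 0), (2, 2)]) \<in> Nsp"
    (is "?R \<in> _")
proof -
  have "Eop i0 (dl [(1, 1), (0, 0)] + sc (qq\<^sup>2) (dl [(0, 0), (1, 1)])) = sc (qint 2) ?R"
    by (simp add: Eop_lin Eop_dl2 pair_def wtb_def fun_eq_iff numeral_2_eq_2[symmetric])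
      (simp add: field_simps power2_eq_square power4_eq_xxxx)
  then show ?thesis
    using Nsp.E[OF rel_10, of i0] Nsp_unscale[of "qint 2" ?R] by (simp only: qint_simps) simp
qed

text \<open>Applying \<open>f_1\<close> to \<open>rel_11\<close> gives [2] times this relation plus
  the image of \<open>rel_12\<close> under z \<otimes> 1 + 1 \<otimes> z. The image lies in N and is
  subtracted.\<close>

lemma rel_21: "dl [(1, 2), (0, 1)] + sc (qq\<^sup>2) (dl [(0, 1), (1, 2)]) \<in> Nsp"
    (is "?R \<in> _")
proof -
  have "Fop i1 (dl [(1, 1), (0, 1)] + sc (qq\<^sup>2) (dl [(0, 1), (1, 1)]) +
      sc (qq + qq ^ 3) (dl [(0, 0), (1, 2)] + dl [(1, 2), (0, 0)])) =
    sc (qint 2) (?R + zsum (dl [(0, 1), (0, 2)] + sc (qq\<^sup>2) (dl [(0, 2), (0, 1)])))"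
    by (simp add: Fop_lin Fop_dl2 pair_def wtb_def fun_eq_iff vsp.linear_add[OF lin_zsum]
        vsp.linear_scale[OF lin_zsum] zsum_dl numeral_2_eq_2[symmetric])
      (simp add: field_simps power2_eq_square power3_eq_cube)
  then have "?R + zsum (dl [(0, 1), (0, 2)] + sc (qq\<^sup>2) (dl [(0, 2), (0, 1)])) \<in> Nsp"
    using Nsp.F[OF rel_11, of i1] Nsp_unscale[of "qint 2"] by (simp only: qint_simps) simp
  from Nsp_diff[OF this Nsp.zs[OF rel_12]] show ?thesis
    by (simp only: add_diff_cancel_right')
qed

text \<open>Multiplication by z^a \<otimes> z^b on two-fold tensors. Below, N is shown to be stable
  under its diagonal and symmetrised forms.\<close>

definition sh :: "int \<Rightarrow> int \<Rightarrow> tens \<Rightarrow> tens" where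
  "sh a b y l = (case l of [c, d] \<Rightarrow> y [(fst c - a, snd c), (fst d - b, snd d)] | _ \<Rightarrow> y l)"

lemma lin_sh: "lin (sh a b)"
  by (rule linI) (auto simp: fun_eq_iff sh_def split: list.splits)

lemmas sh_lin = vsp.linear_add[OF lin_sh] vsp.linear_scale[OF lin_sh]

lemma sh_dl: "sh a b (dl [(x, i), (y, j)]) = dl [(x + a, i), (y + b, j)]"
  by (auto simp: fun_eq_iff sh_def dl_def split: list.splits)

lemma sh_sh: "sh a b (sh c d y) = sh (a + c) (b + d) y"
  by (auto simp: fun_eq_iff sh_def algebra_simps split: list.splits)

lemma length_2E:
  assumes "length l = 2"
  obtains a i b j where "l = [(a, i), (b, j)]"
  using assms by (auto simp: numeral_2_eq_2 length_Suc_conv)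

lemma zz_sh: "y \<in> Tn 2 \<Longrightarrow> zz y = sh 1 1 y"
  by (erule Tn_eqI[OF _ lin_zz lin_sh]) (auto elim!: length_2E simp: zz_dl sh_dl)

lemma zzinv_sh: "y \<in> Tn 2 \<Longrightarrow> zzinv y = sh (-1) (-1) y"
  by (erule Tn_eqI[OF _ lin_zzinv lin_sh]) (auto elim!: length_2E simp: zzinv_dl sh_dl)

lemma lin_plus: "lin f \<Longrightarrow> lin g \<Longrightarrow> lin (\<lambda>x. f x + g x)"
  by (rule linI) (simp_all only: vsp.linear_add vsp.linear_scale vs.scale_right_distrib add_ac)

lemma zsum_sh: "y \<in> Tn 2 \<Longrightarrow> zsum y = sh 1 0 y + sh 0 1 y"
  by (erule Tn_eqI[OF _ lin_zsum lin_plus[OF lin_sh lin_sh]])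
    (auto elim!: length_2E simp: zsum_dl sh_dl)

lemma sh_0: "sh 0 0 y = y"
  by (auto simp: fun_eq_iff sh_def split: list.splits)

lemma sh_diag_Nsp: "y \<in> Nsp \<Longrightarrow> sh a a y \<in> Nsp"
proof (induction a rule: int_induct[where k = 0])
  case base
  then show ?case
    by (simp add: sh_0)
next
  case (step1 a)
  then have "zz (sh a a y) \<in> Nsp"
    by (intro Nsp.z)
  then show ?case
    using step1 by (simp add: zz_sh Nsp_Tn sh_sh add.commute)
next
  case (step2 a)
  then have "zzinv (sh a a y) \<in> Nsp"
    by (intro Nsp.zinv)
  then show ?case
    using step2 by (simp add: zzinv_sh Nsp_Tn sh_sh)
qed

text \<open>The power sums \<open>z\<^sub>1\<^sup>n + z\<^sub>2\<^sup>n\<close> via Newton's recursion.\<close>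

lemma sh_power_sum_Nsp:
  assumes "y \<in> Nsp"
  shows "sh (int n) 0 y + sh 0 (int n) y \<in> Nsp"
proof (induction n rule: induct_nat_012)
  case 0
  show ?case
    using assms Nsp_add by (simp only: of_nat_0 sh_0)
next
  case 1
  show ?case
    using Nsp.zs[OF assms] zsum_sh[OF Nsp_Tn[OF assms]] by (simp only: of_nat_1 One_nat_def[symmetric])
next
  case (ge2 n)
  let ?p = "sh (int n) 0 y + sh 0 (int n) y" and ?p' = "sh (int (Suc n)) 0 y + sh 0 (int (Suc n)) y"
  have "zsum ?p' - zz ?p = sh (int (Suc (Suc n))) 0 y + sh 0 (int (Suc (Suc n))) y"
    unfolding zsum_sh[OF Nsp_Tn[OF ge2(2)]] zz_sh[OF Nsp_Tn[OF ge2(1)]]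
    by (simp add: sh_lin sh_sh add_ac)
  moreover have "zsum ?p' - zz ?p \<in> Nsp"
    by (intro Nsp_diff Nsp.zs Nsp.z ge2)
  ultimately show ?case
    by (simp only:)
qed

text \<open>For b \<le> a the symmetrised monomial is (z_1 z_2)^b times the power sum of degree a -
  b.\<close>

lemma sh_sym_Nsp:
  assumes "y \<in> Nsp"
  shows "sh a b y + sh b a y \<in> Nsp"
proof -
  have *: "sh a b y + sh b a y \<in> Nsp" if "b \<le> a" for a b
  proof -
    have "sh b b (sh (int (nat (a - b))) 0 y + sh 0 (int (nat (a - b))) y) \<in> Nsp"
      by (intro sh_diag_Nsp sh_power_sum_Nsp assms)
    then show ?thesis
      using that by (simp add: sh_lin sh_sh)
  qed
  show ?thesis
    using *[of a b] *[of b a] by (cases "b \<le> a") (simp_all add: add.commute)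
qed

text \<open>The threshold for a - b is the difference of the z-exponents in the leading term of the
  relation for i, j: 2 for \<open>rel_20\<close>, 1 for \<open>rel_10\<close>, \<open>rel_11\<close>
  and \<open>rel_21\<close>, and 0 for the rest.\<close>

fun nonnormal :: "bas \<Rightarrow> bas \<Rightarrow> bool" where
  "nonnormal (a, i) (b, j) \<longleftrightarrow>
    (if i = 2 \<and> j = 0 then b + 2 \<le> a else if j < i \<or> i = 1 \<and> j = 1 then b < a else b \<le> a)"

text \<open>A rewriting modulo \<open>N\<close> of \<open>z\<^sup>a v\<^sub>i \<otimes> z\<^sup>b v\<^sub>j\<close> not in normal form; \<open>(k, x, y)\<close> stands for the
  term \<open>k \<cdot> x \<otimes> y\<close>.  The shorter lists occur when the symmetrised relation is twice a relation.\<close>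

fun str :: "bas \<Rightarrow> bas \<Rightarrow> (K \<times> bas \<times> bas) list" where
  "str (a, i) (b, j) =
    (if i = j \<and> i \<noteq> 1 then (if a = b then [] else [(- 1, (b, i), (a, i))])
     else if j = i + 1 then
       (if a = b then [(- (qq\<^sup>2), (a, j), (a, i))]
        else [(- 1, (b, i), (a, j)), (- (qq\<^sup>2), (a, j), (b, i)), (- (qq\<^sup>2), (b, j), (a, i))])
     else if i = j + 1 then
       (if a = b + 1 then [(- (qq\<^sup>2), (b, j), (a, i))]
        else [(- 1, (b + 1, i), (a - 1, j)), (- (qq\<^sup>2), (a - 1, j), (b + 1, i)),
              (- (qq\<^sup>2), (b, j), (a, i))])
     else if i = 0 then
       (if a = b then [(- qq, (a, 1), (a, 1)), (- (qq ^ 4), (a, 2), (a, 0))]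
        else [(- 1, (b, 0), (a, 2)), (- qq, (a, 1), (b, 1)), (- qq, (b, 1), (a, 1)),
              (- (qq ^ 4), (a, 2), (b, 0)), (- (qq ^ 4), (b, 2), (a, 0))])
     else if i = 1 then
       (if a = b + 1 then [(- (qq\<^sup>2), (b, 1), (a, 1)), (- (qq + qq ^ 3), (b, 0), (a, 2)),
              (- (qq + qq ^ 3), (a, 2), (b, 0))]
        else [(- 1, (b + 1, 1), (a - 1, 1)), (- (qq\<^sup>2), (a - 1, 1), (b + 1, 1)),
              (- (qq\<^sup>2), (b, 1), (a, 1)), (- (qq + qq ^ 3), (a - 1, 0), (b + 1, 2)),
              (- (qq + qq ^ 3), (b, 0), (a, 2)), (- (qq + qq ^ 3), (a, 2), (b, 0)),
              (- (qq + qq ^ 3), (b + 1, 2), (a - 1, 0))])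
     else
       (if a = b + 2 then [(- qq, (b + 1, 1), (b + 1, 1)), (- (qq ^ 4), (b, 0), (a, 2))]
        else [(- 1, (b + 2, 2), (a - 2, 0)), (- qq, (a - 1, 1), (b + 1, 1)),
              (- qq, (b + 1, 1), (a - 1, 1)), (- (qq ^ 4), (a - 2, 0), (b + 2, 2)),
              (- (qq ^ 4), (b, 0), (a, 2))]))"

definition cmb :: "(K \<times> bas \<times> bas) list \<Rightarrow> tens" where
  "cmb xs = (\<Sum>(k, x, y)\<leftarrow>xs. sc k (dl [x, y]))"

lemma cmb_simps [simp]:
  "cmb [] = 0" "cmb ((k, x, y) # xs) = sc k (dl [x, y]) + cmb xs"
  by (simp_all add: cmb_def)

lemma str_Nsp:
  assumes "okb c" "okb d"
  shows "dl [c, d] - cmb (str c d) \<in> Nsp"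
proof -
  obtain a i b j where cd: "c = (a, i)" "d = (b, j)"
    by (cases c; cases d) auto
  have trivial: "x \<in> Nsp \<Longrightarrow> y = x \<Longrightarrow> y \<in> Nsp" for x y
    by simp
  note [simp] = sh_lin sh_dl fun_eq_iff
  consider "i = 0" "j = 0" | "i = 2" "j = 2" | "i = 0" "j = 1" | "i = 1" "j = 2"
    | "i = 1" "j = 0" | "i = 2" "j = 1" | "i = 0" "j = 2" | "i = 1" "j = 1" | "i = 2" "j = 0"
    using assms by (auto simp: cd numeral_2_eq_2 le_Suc_eq)
  then show ?thesis
  proof cases
    case 1
    show ?thesis
      using sh_diag_Nsp[OF rel_00, of a] sh_sym_Nsp[OF rel_00, of a b]
      by (cases "a = b") (elim trivial; simp add: cd 1)+
  next
    case 2
    show ?thesis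
      using sh_diag_Nsp[OF rel_22, of a] sh_sym_Nsp[OF rel_22, of a b]
      by (cases "a = b") (elim trivial; simp add: cd 2)+
  next
    case 3
    show ?thesis
      using sh_diag_Nsp[OF rel_01, of a] sh_sym_Nsp[OF rel_01, of a b]
      by (cases "a = b") (elim trivial; simp add: cd 3)+
  next
    case 4
    show ?thesis
      using sh_diag_Nsp[OF rel_12, of a] sh_sym_Nsp[OF rel_12, of a b]
      by (cases "a = b") (elim trivial; simp add: cd 4)+
  next
    case 5
    \<comment> \<open>The leading term of \<open>rel_10\<close> already carries one z in its first
      factor, so the shift there is a - 1. The same holds for \<open>rel_21\<close> and
      \<open>rel_11\<close>; for \<open>rel_20\<close> it is a - 2.\<close>
    show ?thesis
      using sh_diag_Nsp[OF rel_10, of b] sh_sym_Nsp[OF rel_10, of "a - 1" b]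
      by (cases "a = b + 1") (elim trivial; simp add: cd 5 add.commute)+
  next
    case 6
    show ?thesis
      using sh_diag_Nsp[OF rel_21, of b] sh_sym_Nsp[OF rel_21, of "a - 1" b]
      by (cases "a = b + 1") (elim trivial; simp add: cd 6 add.commute)+
  next
    case 7
    show ?thesis
      using sh_diag_Nsp[OF rel_02, of a] sh_sym_Nsp[OF rel_02, of a b]
      by (cases "a = b") (elim trivial; simp add: cd 7 algebra_simps)+
  next
    case 8
    show ?thesis
      using sh_diag_Nsp[OF rel_11, of b] sh_sym_Nsp[OF rel_11, of "a - 1" b]
      by (cases "a = b + 1") (elim trivial; simp add: cd 8 algebra_simps)+
  next
    case 9
    show ?thesis
      using sh_diag_Nsp[OF rel_20, of b] sh_sym_Nsp[OF rel_20, of "a - 2" b]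
      by (cases "a = b + 2") (elim trivial; simp add: cd 9 algebra_simps)+
  qed
qed

lemma Areg_diff [simp]: "x \<in> Areg \<Longrightarrow> y \<in> Areg \<Longrightarrow> x - y \<in> Areg"
  using Areg_add[of x "- y"] by simp

lemma str_props:
  assumes "okb c" "okb d" "(k, x, y) \<in> set (str c d)"
  shows "k \<in> Areg" "okb x" "okb y" "wts [x, y] = wts [c, d]"
proof -
  have "k \<in> Areg \<and> okb x \<and> okb y \<and> wts [x, y] = wts [c, d]"
    using assms by (cases c; cases d) (auto split: if_splits simp: wts_def)
  then show "k \<in> Areg" "okb x" "okb y" "wts [x, y] = wts [c, d]"
    by auto
qed

section \<open>The rank relative to a ground state sequence\<close>

text \<open>The ground state \<open>b\<^sup>\<circ>\<^sub>m\<close> has rank \<open>0\<close>; the \<open>c\<close> of positive rank are those for which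
  \<open>G(c) \<and> |m + 1\<rangle>\<close> vanishes in the Fock space.\<close>

fun rho :: "gsch \<Rightarrow> int \<Rightarrow> bas \<Rightarrow> int" where
  "rho GS_B m (a, j) = 3 * a + 1 - int j"
| "rho GS_A m (a, j) = (if even m then 3 * a + 1 - 2 * int j else 3 * a - int j)"

lemma rho_gs [simp]: "rho g m (gs g m) = 0"
  by (cases g) auto

lemma okb_gs [simp]: "okb (gs g m)"
  by (cases g) auto

lemma okb_cases:
  assumes "okb c"
  obtains a where "c = (a, 0)" | a where "c = (a, 1)" | a where "c = (a, 2)"
  using assms by (cases c) (auto simp: le_Suc_eq numeral_2_eq_2)

text \<open>\<open>rho\<close> is injective on the vectors with j \<le> 2: its slope in a is 3, and
  the three values of j, or of 2j, are distinct modulo 3.\<close>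

lemma rho_0_iff: "okb c \<Longrightarrow> rho g m c = 0 \<longleftrightarrow> c = gs g m"
  by (cases g; erule okb_cases) (auto; presburger)+

text \<open>This makes \<open>str_rho_less\<close> applicable wherever a vector of nonnegative rank
  stands before one of negative rank.\<close>

lemma nonnormal_rho:
  assumes "okb c" "okb d" "rho g m c \<ge> 0" "rho g (m + 1) d < 0"
  shows "nonnormal c d"
  using assms by (cases g; elim okb_cases) (auto split: if_splits)

lemma str_rho_less:
  assumes "okb c" "okb d" "nonnormal c d" "(k, x, y) \<in> set (str c d)"
  shows "rho g m x < rho g m c"
  using assms by (cases g; elim okb_cases) (auto split: if_splits)

text \<open>The vector that moves to the second place has positive rank again, so the rewriting can
  be repeated with the next ground state vector. The alternative for \<open>k\<close> is what makes
  this repetition gain powers of q.\<close>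

lemma str_gs:
  assumes "okb c" "rho g m c > 0" "(k, x, y) \<in> set (str c (gs g (m + 1)))"
  shows "0 < rho g (m + 1) y" "k = - 1 \<and> rho g (m + 1) y < rho g m c \<or> (\<exists>k'\<in>Areg. k = qq * k')"
proof -
  have q2: "\<exists>k'\<in>Areg. - (qq\<^sup>2) = qq * k'"
    by (rule bexI[of _ "- qq"]) (simp_all add: power2_eq_square)
  have q1: "\<exists>k'\<in>Areg. - qq = qq * k'"
    by (rule bexI[of _ "- 1"]) simp_all
  have q4: "\<exists>k'\<in>Areg. - (qq ^ 4) = qq * k'"
    by (rule bexI[of _ "- (qq ^ 3)"]) (simp_all add: power3_eq_cube power4_eq_xxxx)
  have q3: "\<exists>k'\<in>Areg. - (qq + qq ^ 3) = qq * k'"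
    by (rule bexI[of _ "- (1 + qq\<^sup>2)"]) (simp_all add: power3_eq_cube power2_eq_square algebra_simps)
  show "0 < rho g (m + 1) y"
    using assms by (cases g; elim okb_cases) (auto split: if_splits)
  show "k = - 1 \<and> rho g (m + 1) y < rho g m c \<or> (\<exists>k'\<in>Areg. k = qq * k')"
    using assms q1 q2 q3 q4
    by (cases g; elim okb_cases) (auto split: if_splits simp del: bex_simps)
qed

section \<open>Semi-infinite tensors\<close>

type_synonym seqf = "(nat \<Rightarrow> bas) \<Rightarrow> K"

text \<open>The representative \<open>(r, u)\<close> as a function on infinite sequences of basis elements, supported
  on the sequences that agree with the ground state sequence from position \<open>r\<close> on.\<close>

definition emb :: "gsch \<Rightarrow> int \<Rightarrow> nat \<Rightarrow> tens \<Rightarrow> seqf" where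
  "emb g m r u s = (if \<forall>k\<ge>r. s k = gs g (m + int k) then u (map s [0..<r]) else 0)"

definition grd :: "gsch \<Rightarrow> int \<Rightarrow> nat \<Rightarrow> bas list" where
  "grd g m p = map (\<lambda>k. gs g (m + int k)) [0..<p]"

text \<open>Left multiplication by an \<open>r\<close>-fold tensor; \<open>X\<close> is a
  semi-infinite tensor whose first factor belongs to position \<open>r\<close>.\<close>

definition Lm :: "nat \<Rightarrow> tens \<Rightarrow> seqf \<Rightarrow> seqf" where
  "Lm r u X s = u (map s [0..<r]) * X (\<lambda>k. s (r + k))"

lemma lin_emb: "lin (emb g m r)"
  by (rule linI) (auto simp: fun_eq_iff emb_def)

lemmas emb_lin = lin_simps[OF lin_emb] vsp.linear_neg[OF lin_emb]

lemma lin_Lm: "lin (Lm r u)"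
  by (rule linI) (auto simp: fun_eq_iff Lm_def algebra_simps)

lemmas Lm_lin = vsp.linear_add[OF lin_Lm] vsp.linear_scale[OF lin_Lm] vsp.linear_diff[OF lin_Lm]

lemma lin_Lm_left: "lin (\<lambda>u. Lm r u X)"
  by (rule linI) (auto simp: fun_eq_iff Lm_def algebra_simps)

lemma length_grd [simp]: "length (grd g m p) = p"
  by (simp add: grd_def)

lemma okl_grd [simp]: "okl (grd g m p)"
  by (simp add: grd_def)

lemma grd_Suc: "grd g m (Suc p) = gs g m # grd g (m + 1) p"
  unfolding grd_def by (simp add: map_upt_Suc add_ac del: upt_Suc)

lemma grd_0 [simp]: "grd g m 0 = []"
  by (simp add: grd_def)

lemma grd_Suc_0 [simp]: "grd g m (Suc 0) = [gs g m]"
  by (simp add: grd_Suc)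

lemma grd_add: "grd g m (p + p') = grd g m p @ grd g (m + int p) p'"
  by (induction p arbitrary: m) (simp_all add: grd_Suc add_ac)

lemma grd_shift: "map (\<lambda>k. gs g (m + int k)) [r..<s] = grd g (m + int r) (s - r)"
proof -
  have "[r..<s] = map (\<lambda>k. r + k) [0..<s - r]"
    by (rule nth_equalityI) auto
  then show ?thesis
    by (simp add: grd_def add.assoc)
qed

lemma ext_tp: "r \<le> s \<Longrightarrow> Defs.ext g m r s u = tp r u (dl (grd g (m + int r) (s - r)))"
proof
  fix l
  assume "r \<le> s"
  then have "length l = s" if "drop r l = grd g (m + int r) (s - r)" "r \<le> length l"
    using arg_cong[OF that(1), of length] that(2) by simp
  with \<open>r \<le> s\<close> show "Defs.ext g m r s u l = tp r u (dl (grd g (m + int r) (s - r))) l"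
    by (auto simp: ext_def tp_def dl_def grd_shift)
qed

text \<open>The transition maps of the inductive limit become identities on sequences, so
  representatives of different levels can be compared and added directly.\<close>

lemma emb_ext:
  assumes "r \<le> t"
  shows "emb g m t (Defs.ext g m r t u) = emb g m r u"
proof
  fix s
  have "drop r (map s [0..<t]) = map (\<lambda>k. gs g (m + int k)) [r..<t] \<longleftrightarrow>
      (\<forall>k. r \<le> k \<and> k < t \<longrightarrow> s k = gs g (m + int k))"
    by (auto simp: drop_map)
  moreover have "(\<forall>k\<ge>r. s k = gs g (m + int k)) \<longleftrightarrow> (\<forall>k\<ge>t. s k = gs g (m + int k)) \<and>
      (\<forall>k. r \<le> k \<and> k < t \<longrightarrow> s k = gs g (m + int k))"
    using assms by (meson le_trans not_le)
  moreover have "take r (map s [0..<t]) = map s [0..<r]"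
    using assms by (simp add: take_map)
  ultimately show "emb g m t (Defs.ext g m r t u) s = emb g m r u s"
    using assms by (simp add: emb_def ext_def) blast
qed

lemma emb_tp_grd: "emb g m (r + p) (tp r u (dl (grd g (m + int r) p))) = emb g m r u"
  using emb_ext[of r "r + p" g m u] ext_tp[of r "r + p" g m u] by simp

lemma emb_Suc: "emb g m (Suc r) (tp r u (dl [gs g (m + int r)])) = emb g m r u"
  using emb_tp_grd[of g m r 1 u] by (simp add: grd_Suc)

lemma emb_tp: "emb g m (r + p) (tp r u w) = Lm r u (emb g (m + int r) p w)"
proof
  fix s
  have "(\<forall>k\<ge>r + p. s k = gs g (m + int k)) \<longleftrightarrow> (\<forall>k\<ge>p. s (r + k) = gs g (m + int r + int k))"
  proof (intro iffI allI impI)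
    fix k
    assume "\<forall>k\<ge>r + p. s k = gs g (m + int k)" "k \<ge> p"
    then show "s (r + k) = gs g (m + int r + int k)"
      by (simp add: add.assoc)
  next
    fix k
    assume *: "\<forall>k\<ge>p. s (r + k) = gs g (m + int r + int k)" and "k \<ge> r + p"
    then obtain k' where "k = r + k'" "k' \<ge> p"
      by (metis add.assoc le_Suc_ex le_add1)
    then show "s k = gs g (m + int k)"
      using * by (simp add: add.assoc)
  qed
  moreover have "map s [0..<r + p] = map s [0..<r] @ map (\<lambda>k. s (r + k)) [0..<p]"
    by (rule nth_equalityI) (auto simp: nth_append)
  ultimately show "emb g m (r + p) (tp r u w) s = Lm r u (emb g (m + int r) p w) s"
    by (simp add: emb_def Lm_def tp_def) blast
qed

lemma emb_Cons: "emb g m (Suc r) (dl (c # l)) = Lm 1 (dl [c]) (emb g (m + 1) r (dl l))"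
  using emb_tp[of g m 1 r "dl [c]" "dl l"] by (simp add: tp_dl)

text \<open>Every list of length \<open>r\<close> is continued by the ground state to exactly one
  sequence, so no coefficient is lost.\<close>

lemma emb_eq_0:
  assumes "u \<in> Tn r" "emb g m r u = 0"
  shows "u = 0"
proof
  fix l
  show "u l = 0 l"
  proof (cases "length l = r")
    case True
    define s where "s k = (if k < r then l ! k else gs g (m + int k))" for k
    have "map s [0..<r] = l"
      by (rule nth_equalityI) (simp_all add: True s_def)
    then have "emb g m r u s = u l"
      by (simp add: emb_def s_def)
    then show ?thesis
      using assms(2) by simp
  qed (use Tn_support[OF assms(1), of l] in auto)
qed

lemma ext_Nn: "y \<in> Nn r \<Longrightarrow> r \<le> s \<Longrightarrow> Defs.ext g m r s y \<in> Nn s"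
  using Nn_tp_right[of "dl (grd g (m + int r) (s - r))" "s - r" y r]
  by (simp add: ext_tp dl_Tn)

lemma ext_Tn: "y \<in> Tn r \<Longrightarrow> r \<le> s \<Longrightarrow> Defs.ext g m r s y \<in> Tn s"
  using tp_Tn[of y r "dl (grd g (m + int r) (s - r))" "s - r"]
  by (simp add: ext_tp dl_Tn)

lemma Lat_add: "x \<in> Lat n \<Longrightarrow> y \<in> Lat n \<Longrightarrow> x + y \<in> Lat n"
  by (simp add: Lat_def Tn_add)

lemma Lat_scale: "x \<in> Lat n \<Longrightarrow> k \<in> Areg \<Longrightarrow> sc k x \<in> Lat n"
  by (simp add: Lat_def Tn_scale)

lemma Lat_0: "0 \<in> Lat n"
  by (simp add: Lat_def Tn_0)

lemma Lat_dl: "length l = n \<Longrightarrow> okl l \<Longrightarrow> dl l \<in> Lat n"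
  by (simp add: Lat_def dl_Tn) (simp add: dl_def)

lemma Lat_tp: "u \<in> Lat r \<Longrightarrow> w \<in> Lat s \<Longrightarrow> tp r u w \<in> Lat (r + s)"
  by (simp add: Lat_def tp_Tn) (simp add: tp_def)

lemma ext_Lat: "z \<in> Lat r \<Longrightarrow> r \<le> s \<Longrightarrow> Defs.ext g m r s z \<in> Lat s"
  using Lat_tp[of z r "dl (grd g (m + int r) (s - r))" "s - r"]
  by (simp add: ext_tp Lat_dl)

section \<open>The space Z and the q-adic filtration\<close>

definition Zgen :: "gsch \<Rightarrow> int \<Rightarrow> seqf set" where
  "Zgen g m = {emb g m t y | t y. y \<in> Nn t} \<union>
    {emb g m (Suc r) (dl (a @ [c])) | r a c. length a = r \<and> okl a \<and> okb c \<and> 0 < rho g (m + int r) c}"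

text \<open>This space will turn out to be the set of vectors whose image in the Fock space is zero.\<close>

definition Zb :: "gsch \<Rightarrow> int \<Rightarrow> seqf set" where
  "Zb g m = vs.span (Zgen g m)"

lemma Zb_subspace: "vs.subspace (Zb g m)"
  by (simp add: Zb_def)

lemmas Zb_0 = vs.subspace_0[OF Zb_subspace]
  and Zb_add = vs.subspace_add[OF Zb_subspace]
  and Zb_scale = vs.subspace_scale[OF Zb_subspace]

lemma Zb_Nn: "y \<in> Nn t \<Longrightarrow> emb g m t y \<in> Zb g m"
  unfolding Zb_def Zgen_def by (rule vs.span_base) blast

lemma Zb_bad:
  "length a = r \<Longrightarrow> okl a \<Longrightarrow> okb c \<Longrightarrow> 0 < rho g (m + int r) c \<Longrightarrow>
    emb g m (Suc r) (dl (a @ [c])) \<in> Zb g m"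
  unfolding Zb_def Zgen_def by (rule vs.span_base) blast

lemma Zb_bad1: "okb c \<Longrightarrow> 0 < rho g m c \<Longrightarrow> emb g m 1 (dl [c]) \<in> Zb g m"
  using Zb_bad[of "[]" 0 c g m] by simp

lemma Zb_bad2: "okb c \<Longrightarrow> okb x \<Longrightarrow> 0 < rho g (m + 1) c \<Longrightarrow> emb g m 2 (dl [x, c]) \<in> Zb g m"
  using Zb_bad[of "[x]" 1 c g m] by (simp add: numeral_2_eq_2)

lemma Zb_induct:
  assumes "X \<in> Zb g m" "lin f" "vs.subspace S"
    and "\<And>t y. y \<in> Nn t \<Longrightarrow> f (emb g m t y) \<in> S"
    and "\<And>r a c. length a = r \<Longrightarrow> okl a \<Longrightarrow> okb c \<Longrightarrow> 0 < rho g (m + int r) c \<Longrightarrow>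
      f (emb g m (Suc r) (dl (a @ [c]))) \<in> S"
  shows "f X \<in> S"
proof -
  have "Zb g m \<subseteq> {X. f X \<in> S}"
    unfolding Zb_def
    using vsp.linear_subspace_linear_preimage[OF assms(2,3)] assms(4,5)
    by (intro vs.span_minimal) (auto simp: Zgen_def)
  with assms(1) show ?thesis
    by blast
qed

lemma Zb_Lm_dl:
  assumes "X \<in> Zb g (m + int r)" "length a = r" "okl a"
  shows "Lm r (dl a) X \<in> Zb g m"
  using assms(1) lin_Lm Zb_subspace
proof (rule Zb_induct)
  fix t y
  assume "y \<in> Nn t"
  then show "Lm r (dl a) (emb g (m + int r) t y) \<in> Zb g m"
    using Zb_Nn[OF Nn_tp_left[OF dl_Tn, of a r y t]] assms by (simp add: emb_tp)
next
  fix p and b :: "bas list" and c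
  assume bad: "length b = p" "okl b" "okb c" "0 < rho g (m + int r + int p) c"
  have "Lm r (dl a) (emb g (m + int r) (Suc p) (dl (b @ [c]))) =
      emb g m (Suc (r + p)) (dl ((a @ b) @ [c]))"
    using emb_tp[of g m r "Suc p" "dl a" "dl (b @ [c])"] assms(2) by (simp add: tp_dl)
  moreover have "emb g m (Suc (r + p)) (dl ((a @ b) @ [c])) \<in> Zb g m"
    using bad assms by (intro Zb_bad) (auto simp: add.assoc)
  ultimately show "Lm r (dl a) (emb g (m + int r) (Suc p) (dl (b @ [c]))) \<in> Zb g m"
    by (simp only:)
qed

lemma Zb_Lm:
  assumes "X \<in> Zb g (m + int r)" "u \<in> Tn r"
  shows "Lm r u X \<in> Zb g m"
  using assms(2) lin_Lm_left Zb_subspace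
  by (rule Tn_lin_into) (use assms(1) Zb_Lm_dl in auto)

text \<open>\<open>q\<^sup>n L(F)\<close> of the pre-Fock space, as a set of semi-infinite tensors.\<close>

definition LN :: "gsch \<Rightarrow> int \<Rightarrow> nat \<Rightarrow> seqf set" where
  "LN g m n = {sc (qq ^ n) (emb g m t z) + emb g m t y | t z y. z \<in> Lat t \<and> y \<in> Nn t}"

lemma LN_I: "z \<in> Lat t \<Longrightarrow> y \<in> Nn t \<Longrightarrow> sc (qq ^ n) (emb g m t z) + emb g m t y \<in> LN g m n"
  unfolding LN_def by blast

lemma LN_E:
  assumes "X \<in> LN g m n"
  obtains t z y where "z \<in> Lat t" "y \<in> Nn t" "X = sc (qq ^ n) (emb g m t z) + emb g m t y"
  using assms unfolding LN_def by blast

lemma LN_level: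
  assumes "X \<in> LN g m n"
  obtains t where "\<And>t'. t \<le> t' \<Longrightarrow>
    \<exists>z y. z \<in> Lat t' \<and> y \<in> Nn t' \<and> X = sc (qq ^ n) (emb g m t' z) + emb g m t' y"
proof -
  obtain t z y where *: "z \<in> Lat t" "y \<in> Nn t" "X = sc (qq ^ n) (emb g m t z) + emb g m t y"
    using assms by (rule LN_E)
  have "\<exists>z y. z \<in> Lat t' \<and> y \<in> Nn t' \<and> X = sc (qq ^ n) (emb g m t' z) + emb g m t' y"
    if "t \<le> t'" for t'
    using that * ext_Lat[of z t t' g m] ext_Nn[of y t t' g m]
    by (intro exI[of _ "Defs.ext g m t t' z"] exI[of _ "Defs.ext g m t t' y"]) (simp add: emb_ext)
  then show ?thesis
    using that by blast
qed

lemma LN_0: "0 \<in> LN g m n"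
  using LN_I[OF Lat_0 Nn_0, of n g m 0] by (simp add: emb_lin)

lemma LN_add:
  assumes "X \<in> LN g m n" "Y \<in> LN g m n"
  shows "X + Y \<in> LN g m n"
proof -
  obtain t where t: "\<And>t'. t \<le> t' \<Longrightarrow>
      \<exists>z y. z \<in> Lat t' \<and> y \<in> Nn t' \<and> X = sc (qq ^ n) (emb g m t' z) + emb g m t' y"
    using LN_level[OF assms(1)] by metis
  obtain s where s: "\<And>t'. s \<le> t' \<Longrightarrow>
      \<exists>z y. z \<in> Lat t' \<and> y \<in> Nn t' \<and> Y = sc (qq ^ n) (emb g m t' z) + emb g m t' y"
    using LN_level[OF assms(2)] by metis
  obtain z y z' y' where *: "z \<in> Lat (max s t)" "y \<in> Nn (max s t)" "z' \<in> Lat (max s t)"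
      "y' \<in> Nn (max s t)" "X = sc (qq ^ n) (emb g m (max s t) z) + emb g m (max s t) y"
      "Y = sc (qq ^ n) (emb g m (max s t) z') + emb g m (max s t) y'"
    using t[of "max s t"] s[of "max s t"] by auto
  have "X + Y = sc (qq ^ n) (emb g m (max s t) (z + z')) + emb g m (max s t) (y + y')"
    unfolding *(5,6) emb_lin vs.scale_right_distrib by (simp only: add_ac)
  then show ?thesis
    using LN_I[OF Lat_add[OF *(1,3)] Nn_add[OF *(2,4)]] by (simp only:)
qed

lemma LN_scale:
  assumes "X \<in> LN g m (n + N)" "qq ^ N * k \<in> Areg"
  shows "sc k X \<in> LN g m n"
proof -
  obtain t z y where *: "z \<in> Lat t" "y \<in> Nn t" "X = sc (qq ^ (n + N)) (emb g m t z) + emb g m t y"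
    using assms(1) by (rule LN_E)
  have "sc k X = sc (qq ^ n) (emb g m t (sc (qq ^ N * k) z)) + emb g m t (sc k y)"
    unfolding * emb_lin by (simp add: fun_eq_iff power_add algebra_simps)
  then show ?thesis
    using LN_I[OF Lat_scale[OF *(1) assms(2)] Nn_scale[OF *(2)]] by (simp only:)
qed

lemma LN_Ascale: "X \<in> LN g m n \<Longrightarrow> k \<in> Areg \<Longrightarrow> sc k X \<in> LN g m n"
  using LN_scale[of X g m n 0 k] by simp

lemma LN_qscale:
  assumes "X \<in> LN g m n"
  shows "sc qq X \<in> LN g m (Suc n)"
proof -
  obtain t z y where *: "z \<in> Lat t" "y \<in> Nn t" "X = sc (qq ^ n) (emb g m t z) + emb g m t y"
    using assms by (rule LN_E)
  have "sc qq X = sc (qq ^ Suc n) (emb g m t z) + emb g m t (sc qq y)"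
    unfolding * emb_lin by (simp add: fun_eq_iff algebra_simps)
  then show ?thesis
    using LN_I[OF *(1) Nn_scale[OF *(2)]] by (simp only:)
qed

lemma LN_qscale_power: "X \<in> LN g m n \<Longrightarrow> sc (qq ^ p) X \<in> LN g m (n + p)"
proof (induction p)
  case (Suc p)
  then have "sc qq (sc (qq ^ p) X) \<in> LN g m (Suc (n + p))"
    by (intro LN_qscale)
  then have "sc (qq ^ Suc p) X \<in> LN g m (n + Suc p)"
    by (simp add: vs.scale_scale)
  then show ?case .
qed simp

lemma LN_Nn: "y \<in> Nn t \<Longrightarrow> emb g m t y \<in> LN g m n"
  using LN_I[OF Lat_0, of y t n g m] by (simp add: emb_lin)

lemma LN_Lat: "z \<in> Lat t \<Longrightarrow> emb g m t z \<in> LN g m 0"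
  using LN_I[OF _ Nn_0, of z t 0 g m] by (simp add: emb_lin)

lemma LN_Lm:
  assumes "X \<in> LN g (m + int r) n" "length a = r" "okl a"
  shows "Lm r (dl a) X \<in> LN g m n"
proof -
  obtain t z y where *: "z \<in> Lat t" "y \<in> Nn t"
      "X = sc (qq ^ n) (emb g (m + int r) t z) + emb g (m + int r) t y"
    using assms(1) by (rule LN_E)
  have "Lm r (dl a) X = sc (qq ^ n) (emb g m (r + t) (tp r (dl a) z)) + emb g m (r + t) (tp r (dl a) y)"
    unfolding * emb_tp by (simp only: Lm_lin)
  then show ?thesis
    using LN_I[OF Lat_tp[OF Lat_dl[OF assms(2,3)] *(1)] Nn_tp_left[OF dl_Tn[OF assms(2,3)] *(2)]]
    by (simp only:)
qed

text \<open>\<open>S\<close> is asked to be closed under addition only, because it will be an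
  A-module and not a subspace. Each term is therefore checked together with its coefficient.\<close>

lemma emb_cmb_induct:
  assumes "0 \<in> S" "\<And>X Y. X \<in> S \<Longrightarrow> Y \<in> S \<Longrightarrow> X + Y \<in> S" "lin f"
    and "\<And>k x y. (k, x, y) \<in> set xs \<Longrightarrow> sc k (f (dl [x, y])) \<in> S"
  shows "f (cmb xs) \<in> S"
  using assms(4)
proof (induction xs)
  case Nil
  have "f (cmb []) \<in> S"
    by (simp add: vsp.linear_0[OF assms(3)] assms(1))
  then show ?case .
next
  case (Cons p xs)
  obtain k x y where p: "p = (k, x, y)"
    by (cases p) auto
  have *: "f (cmb (p # xs)) = sc k (f (dl [x, y])) + f (cmb xs)"
    by (simp only: p cmb_simps vsp.linear_add[OF assms(3)] vsp.linear_scale[OF assms(3)])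
  have "sc k (f (dl [x, y])) \<in> S"
    by (rule Cons.prems) (simp add: p)
  moreover have "f (cmb xs) \<in> S"
    by (rule Cons.IH) (rule Cons.prems, simp)
  ultimately show ?case
    unfolding * by (rule assms(2))
qed

text \<open>Every step of rewriting \<open>c \<and> b\<^sup>\<circ>\<^sub>m\<^sub>+\<^sub>1\<close> for \<open>c\<close> of positive rank either gains a factor \<open>q\<close> or
  lowers the rank of the vector that stands in front of \<open>|m + 2\<rangle>\<close>.\<close>

lemma bad_in_LN: "okb c \<Longrightarrow> 0 < rho g m c \<Longrightarrow> emb g m 1 (dl [c]) \<in> LN g m n"
proof (induction n arbitrary: m c)
  case 0
  then show ?case
    by (intro LN_Lat Lat_dl) auto
next
  case (Suc n)
  note IH = Suc.IH
  show ?case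
    using Suc.prems
  \<comment> \<open>Terms with coefficient -1 are covered by the inner induction on the rank, terms
    divisible by q by the outer one on \<open>n\<close>. Either way the position advances, so
    \<open>m\<close> has to be arbitrary.\<close>
  proof (induction "nat (rho g m c)" arbitrary: m c rule: less_induct)
    case less
    let ?d = "gs g (m + 1)"
    have "emb g m 1 (dl [c]) = emb g m 2 (dl [c, ?d])"
      using emb_Suc[of g m 1 "dl [c]"] by (simp add: tp_dl numeral_2_eq_2)
    also have "\<dots> = emb g m 2 (dl [c, ?d] - cmb (str c ?d)) + emb g m 2 (cmb (str c ?d))"
      by (simp only: emb_lin diff_add_cancel)
    also have "\<dots> \<in> LN g m (Suc n)"
    proof (rule LN_add)
      show "emb g m 2 (dl [c, ?d] - cmb (str c ?d)) \<in> LN g m (Suc n)"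
        using less.prems by (intro LN_Nn Nsp_Nn str_Nsp) auto
      show "emb g m 2 (cmb (str c ?d)) \<in> LN g m (Suc n)"
      proof (rule emb_cmb_induct[OF LN_0 LN_add lin_emb])
        fix k x y
        assume kxy: "(k, x, y) \<in> set (str c ?d)"
        have ok: "okb x" "okb y"
          using str_props(2,3)[OF less.prems(1) okb_gs kxy] by auto
        have y: "0 < rho g (m + 1) y"
          using str_gs(1)[OF less.prems kxy] .
        have *: "emb g m 2 (dl [x, y]) = Lm 1 (dl [x]) (emb g (m + int 1) 1 (dl [y]))"
          using emb_Cons[of g m 1 x "[y]"] by (simp add: numeral_2_eq_2)
        consider "k = - 1" "rho g (m + 1) y < rho g m c" | k' where "k' \<in> Areg" "k = qq * k'"
          using str_gs(2)[OF less.prems kxy] by blast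
        then show "sc k (emb g m 2 (dl [x, y])) \<in> LN g m (Suc n)"
        proof cases
          case 1
          have "emb g (m + 1) 1 (dl [y]) \<in> LN g (m + 1) (Suc n)"
            using less.hyps[of "m + 1" y] 1 y ok by simp
          then show ?thesis
            unfolding * using ok 1 by (intro LN_Ascale LN_Lm) simp_all
        next
          case 2
          have "sc qq (Lm 1 (dl [x]) (emb g (m + int 1) 1 (dl [y]))) \<in> LN g m (Suc n)"
            using IH[OF ok(2), of "m + 1"] y ok by (intro LN_qscale LN_Lm) auto
          from LN_Ascale[OF this 2(1)] show ?thesis
            unfolding * 2(2) by (simp add: vs.scale_scale mult.commute)
        qed
      qed auto
    qed
    finally show ?case .
  qed
qed

lemma Zb_LN: "X \<in> Zb g m \<Longrightarrow> X \<in> LN g m n"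
proof -
  assume X: "X \<in> Zb g m"
  \<comment> \<open>Each \<open>LN g m n\<close> is only an A-module, but their intersection is a
    \<open>K\<close>-space: a pole of order N of the scalar is paid for by membership at n +
    N.\<close>
  have "vs.subspace {X. \<forall>n. X \<in> LN g m n}"
  proof (rule vs.subspaceI)
    fix c x
    assume x: "x \<in> {X. \<forall>n. X \<in> LN g m n}"
    obtain N where "qq ^ N * c \<in> Areg"
      by (rule Areg_denominator)
    then show "sc c x \<in> {X. \<forall>n. X \<in> LN g m n}"
      using x LN_scale by blast
  qed (auto simp: LN_0 LN_add)
  with X linI[of "\<lambda>X. X"] have "X \<in> {X. \<forall>n. X \<in> LN g m n}"
  proof (rule_tac Zb_induct[of X g m "\<lambda>X. X"])
    fix r and a :: "bas list" and c
    assume *: "length a = r" "okl a" "okb c" "0 < rho g (m + int r) c"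
    have "emb g m (Suc r) (dl (a @ [c])) = Lm r (dl a) (emb g (m + int r) 1 (dl [c]))"
      using emb_tp[of g m r 1 "dl a" "dl [c]"] *(1) by (simp add: tp_dl)
    then show "emb g m (Suc r) (dl (a @ [c])) \<in> {X. \<forall>n. X \<in> LN g m n}"
      using LN_Lm[OF bad_in_LN[OF *(3,4)] *(1,2)] by simp
  qed (auto intro: LN_Nn)
  then show ?thesis
    by simp
qed

section \<open>Normal forms\<close>

fun good :: "gsch \<Rightarrow> int \<Rightarrow> bas list \<Rightarrow> bool" where
  "good g m [] \<longleftrightarrow> True"
| "good g m (c # l) \<longleftrightarrow> rho g m c < 0 \<and> good g (m + 1) l \<or> c # l = grd g m (Suc (length l))"

text \<open>Z is included so that lying in the A-span of the normal forms is a statement modulo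
  Z.\<close>

definition NF :: "gsch \<Rightarrow> int \<Rightarrow> nat \<Rightarrow> int \<times> int \<Rightarrow> seqf set" where
  "NF g m r \<mu> = {emb g m r (dl l) | l. length l = r \<and> okl l \<and> good g m l \<and> wts l = \<mu>} \<union> Zb g m"

lemma NF_Zb: "X \<in> Zb g m \<Longrightarrow> X \<in> NF g m r \<mu>"
  by (simp add: NF_def)

lemma NF_good:
  "length l = r \<Longrightarrow> okl l \<Longrightarrow> good g m l \<Longrightarrow> wts l = \<mu> \<Longrightarrow> emb g m r (dl l) \<in> NF g m r \<mu>"
  unfolding NF_def by blast

lemma NF_Lm:
  assumes "X \<in> Asp (NF g (m + 1) r \<mu>)" "okb c"
    and "\<And>l. length l = r \<Longrightarrow> okl l \<Longrightarrow> good g (m + 1) l \<Longrightarrow>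
      emb g m (Suc r) (dl (c # l)) \<in> Asp (NF g m (Suc r) (wts (c # l)))"
  shows "Lm 1 (dl [c]) X \<in> Asp (NF g m (Suc r) (wts [c] + \<mu>))"
proof (rule Asp_linear_image[OF assms(1) lin_Lm])
  fix Y
  assume "Y \<in> NF g (m + 1) r \<mu>"
  then consider "Y \<in> Zb g (m + 1)" |
      l where "Y = emb g (m + 1) r (dl l)" "length l = r" "okl l" "good g (m + 1) l" "wts l = \<mu>"
    unfolding NF_def by blast
  then show "Lm 1 (dl [c]) Y \<in> Asp (NF g m (Suc r) (wts [c] + \<mu>))"
  proof cases
    case 1
    then show ?thesis
      using assms(2) Zb_Lm_dl[of Y g m 1 "[c]"] by (auto intro!: Asp_base NF_Zb)
  next
    case 2
    then show ?thesis
      using assms(3)[of l] wts_append[of "[c]" l] unfolding 2(1) emb_Cons[symmetric] by simp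
  qed
qed

text \<open>If \<open>c\<close> has nonnegative rank and the tail starts with negative rank,
  straightening the first two factors replaces \<open>c\<close> by vectors of smaller rank. The
  altered tail still has length \<open>r\<close> and is normalised by \<open>IH\<close>, after which
  the induction on the rank applies. If the tail is the ground state, then \<open>c\<close> is of
  negative rank, continues the ground state, or puts the vector into Z.\<close>

lemma normal_form_Cons:
  assumes IH: "\<And>m l. length l = r \<Longrightarrow> okl l \<Longrightarrow> emb g m r (dl l) \<in> Asp (NF g m r (wts l))"
  shows "okb c \<Longrightarrow> length l = r \<Longrightarrow> okl l \<Longrightarrow> good g (m + 1) l \<Longrightarrow>
    emb g m (Suc r) (dl (c # l)) \<in> Asp (NF g m (Suc r) (wts (c # l)))"
\<comment> \<open>All negative ranks have measure 0; there the list is good without any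
  rewriting.\<close>
proof (induction "nat (rho g m c + 1)" arbitrary: c l rule: less_induct)
  case less
  have step: "emb g m (Suc r) (dl (x # l')) \<in> Asp (NF g m (Suc r) (wts (x # l')))"
    if "rho g m x < rho g m c" "0 \<le> rho g m c" "okb x" "length l' = r" "okl l'" for x l'
  proof -
    have "Lm 1 (dl [x]) (emb g (m + 1) r (dl l')) \<in> Asp (NF g m (Suc r) (wts [x] + wts l'))"
      using that by (intro NF_Lm[OF IH] less.hyps) auto
    then show ?thesis
      by (simp only: emb_Cons wts_append[symmetric] append.simps)
  qed
  consider "rho g m c < 0" | "l = grd g (m + 1) r" "c = gs g m" | "l = grd g (m + 1) r" "0 < rho g m c" |
      "0 \<le> rho g m c" "l \<noteq> grd g (m + 1) r"
    using rho_0_iff[OF less.prems(1), of g m] by fastforce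
  then show ?case
  proof cases
    case 1
    then show ?thesis
      using less.prems by (intro Asp_base NF_good) auto
  next
    case 2
    then show ?thesis
      using less.prems by (intro Asp_base NF_good) (auto simp: grd_Suc)
  next
    case 3
    have "emb g m (Suc r) (dl (c # l)) = emb g m 1 (dl [c])"
      using emb_tp_grd[of g m 1 r "dl [c]"] 3 by (simp add: tp_dl)
    then show ?thesis
      using Zb_bad1[OF less.prems(1) 3(2)] by (simp only:) (intro Asp_base NF_Zb)
  next
    case 4
    then obtain d l' where l: "l = d # l'"
      using less.prems(2) by (cases l) auto
    then obtain r' where r': "r = Suc r'"
      using less.prems(2) by (cases r) auto
    have d: "okb d" "rho g (m + 1) d < 0" and l': "okl l'" "length l' = r'"
      using less.prems 4 r' l by auto
    have nn: "nonnormal c d"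
      using nonnormal_rho less.prems(1) d 4(1) by blast
    let ?f = "\<lambda>u. emb g m (Suc r) (tp 2 u (dl l'))"
    have lin: "lin ?f"
      by (rule lin_comp[OF lin_emb lin_tp_left])
    have "emb g m (Suc r) (dl (c # l)) = ?f (dl [c, d] - cmb (str c d)) + ?f (cmb (str c d))"
      by (simp add: vsp.linear_diff[OF lin] tp_dl l)
    also have "\<dots> \<in> Asp (NF g m (Suc r) (wts (c # l)))"
    proof (rule Asp_add)
      have "dl [c, d] - cmb (str c d) \<in> Nn 2"
        using less.prems(1) d by (intro Nsp_Nn str_Nsp)
      then show "?f (dl [c, d] - cmb (str c d)) \<in> Asp (NF g m (Suc r) (wts (c # l)))"
        using Nn_tp_right[OF dl_Tn[OF l'(2,1)], of _ 2] r'
        by (intro Asp_base NF_Zb Zb_Nn) simp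
      show "?f (cmb (str c d)) \<in> Asp (NF g m (Suc r) (wts (c # l)))"
      proof (rule emb_cmb_induct[OF Asp.zero Asp_add lin])
        fix k x y
        assume kxy: "(k, x, y) \<in> set (str c d)"
        note props = str_props[OF less.prems(1) d(1) kxy]
        have w: "wts (x # y # l') = wts (c # l)"
          using wts_append[of "[x, y]" l'] wts_append[of "[c, d]" l'] props(4) l by simp
        have "emb g m (Suc r) (dl (x # y # l')) \<in> Asp (NF g m (Suc r) (wts (x # y # l')))"
          using str_rho_less[OF less.prems(1) d(1) nn kxy] 4 props l' r' by (intro step) auto
        then show "sc k (?f (dl [x, y])) \<in> Asp (NF g m (Suc r) (wts (c # l)))"
          using props(1) by (intro Asp_scale) (simp_all add: tp_dl w)
      qed
    qed
    finally show ?thesis .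
  qed
qed

lemma normal_form:
  "length l = r \<Longrightarrow> okl l \<Longrightarrow> emb g m r (dl l) \<in> Asp (NF g m r (wts l))"
proof (induction r arbitrary: m l)
  case 0
  then show ?case
    by (intro Asp_base NF_good) auto
next
  case (Suc r)
  then obtain c l' where l: "l = c # l'" "length l' = r" "okb c" "okl l'"
    by (cases l) auto
  have "Lm 1 (dl [c]) (emb g (m + 1) r (dl l')) \<in> Asp (NF g m (Suc r) (wts [c] + wts l'))"
    using l by (intro NF_Lm[OF Suc.IH] normal_form_Cons Suc.IH) auto
  then show ?case
    by (simp only: l(1) emb_Cons wts_append[symmetric] append.simps)
qed

text \<open>The weight of a vector of nonpositive rank differs from that of the ground state by an
  element of \<open>- Q\<^sub>+\<close>; \<open>fst c\<close> and \<open>fst c - snd c\<close> are, up to shifts, the coefficients of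
  \<open>\<alpha>\<^sub>0\<close> and \<open>\<alpha>\<^sub>1\<close>.\<close>

lemma rho_le_0_iff:
  assumes "okb c"
  shows "rho g m c \<le> 0 \<longleftrightarrow>
    fst c \<le> fst (gs g m) \<and> fst c - int (snd c) \<le> fst (gs g m) - int (snd (gs g m))"
  using assms by (cases g; elim okb_cases) auto

text \<open>The expression 2 fst - snd adds the coefficients of \<alpha>_0 and \<alpha>_1 up to a
  shift, so it is a height. A factor of negative rank lowers it by at least 1, which bounds the
  number of such factors.\<close>

lemma rho_less_0_depth:
  assumes "okb c" "rho g m c < 0"
  shows "2 * fst c - int (snd c) < 2 * fst (gs g m) - int (snd (gs g m))"
  using assms by (cases g; elim okb_cases) (auto split: if_splits)

lemma good_wts:
  assumes "good g m l" "okl l"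
  shows "fst (wts l) \<le> fst (wts (grd g m (length l)))"
    "fst (wts l) - snd (wts l) \<le> fst (wts (grd g m (length l))) - snd (wts (grd g m (length l)))"
  using assms
proof (induction l arbitrary: m)
  case (Cons c l)
  {
    case 1
    then show ?case
      using Cons.IH(1)[of "m + 1"] rho_le_0_iff[of c g m] by (auto simp: grd_Suc wts_Cons)
  next
    case 2
    then show ?case
      using Cons.IH(2)[of "m + 1"] rho_le_0_iff[of c g m] by (auto simp: grd_Suc wts_Cons)
  }
qed auto

lemma Asp_Zb: "X \<in> Asp (Zb g m) \<Longrightarrow> X \<in> Zb g m"
  by (erule Asp_induct)
    (intro Zb_0 Zb_add
      Zb_scale | assumption)+

text \<open>No good list has such a weight, by \<open>good_wts\<close>, so the normal form has no
  terms outside Z.\<close>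

lemma high_weight_Zb:
  assumes "okl l" "length l = r"
    and "fst (wts l) > fst (wts (grd g m r)) \<or>
      fst (wts l) - snd (wts l) > fst (wts (grd g m r)) - snd (wts (grd g m r))"
  shows "emb g m r (dl l) \<in> Zb g m"
proof -
  have "NF g m r (wts l) = Zb g m"
    using assms good_wts by (fastforce simp: NF_def)
  then show ?thesis
    using normal_form[OF assms(2,1), of g m] Asp_Zb by simp
qed

text \<open>\<open>H\<close> is the height by which \<open>l\<close> lies below the ground state.
  Each factor before the final stretch of ground state uses up at least 1 of it, and no factor can
  use more than all of it.\<close>

lemma good_decomposition:
  assumes "good g m l" "okl l"
    and "H = 2 * fst (wts (grd g m (length l))) - snd (wts (grd g m (length l))) -
      (2 * fst (wts l) - snd (wts l))"
  shows "\<exists>l' p. l = l' @ grd g (m + int (length l')) p \<and> okl l' \<and> int (length l') \<le> H \<and>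
    (\<forall>c\<in>set l'. - H \<le> fst c \<and> fst c \<le> 1)"
  using assms
proof (induction l arbitrary: m H)
  case Nil
  then show ?case
    by (intro exI[of _ "[]"] exI[of _ 0]) simp
next
  case (Cons c l)
  show ?case
  proof (cases "c # l = grd g m (Suc (length l))")
    case True
    then show ?thesis
      using Cons.prems by (intro exI[of _ "[]"] exI[of _ "Suc (length l)"]) simp
  next
    case False
    then have c: "rho g m c < 0" "good g (m + 1) l" "okb c" "okl l"
      using Cons.prems by auto
    define h where "h = 2 * fst (gs g m) - int (snd (gs g m)) - (2 * fst c - int (snd c))"
    have h: "0 < h"
      using rho_less_0_depth[OF c(3,1)] by (simp add: h_def)
    have gs: "0 \<le> fst (gs g m)" "fst (gs g m) \<le> 1"
      by (cases g; simp)+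
    have H: "H - h = 2 * fst (wts (grd g (m + 1) (length l))) - snd (wts (grd g (m + 1) (length l))) -
        (2 * fst (wts l) - snd (wts l))"
      by (simp add: Cons.prems(3) grd_Suc wts_Cons h_def)
    obtain l' p where l': "l = l' @ grd g (m + 1 + int (length l')) p" "okl l'"
        "int (length l') \<le> H - h" "\<forall>c\<in>set l'. - (H - h) \<le> fst c \<and> fst c \<le> 1"
      using Cons.IH[OF c(2,4) H] by blast
    have "fst c \<le> fst (gs g m)" "fst c - int (snd c) \<le> fst (gs g m) - int (snd (gs g m))"
      using rho_le_0_iff[OF c(3), of g m] c(1) by auto
    \<comment> \<open>\<open>h\<close> is the sum of two nonnegative differences, one of which is
      \<open>fst (gs g m) - fst c\<close>.\<close>
    then have "- H \<le> fst c \<and> fst c \<le> 1"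
      using gs l'(3) by (auto simp: h_def)
    then show ?thesis
      using l' h c(3) by (intro exI[of _ "c # l'"] exI[of _ p]) (fastforce simp: add_ac)
  qed
qed

lemma finite_good_vectors:
  "finite {emb g m (length l) (dl l) | l. int (length l) \<le> H \<and> okl l \<and> (\<forall>c\<in>set l. - H \<le> fst c \<and> fst c \<le> 1)}"
proof -
  let ?C = "{- H..1} \<times> {..2 :: nat}"
  have "finite ((\<lambda>l. emb g m (length l) (dl l)) ` {l. set l \<subseteq> ?C \<and> length l \<le> nat H})"
    by (intro finite_imageI finite_lists_length_le) simp
  then show ?thesis
    by (rule rev_finite_subset) (force simp: subset_iff)
qed

section \<open>The kernel of the map to the Fock space\<close>

text \<open>A basis of \<open>Z\<close> is extended to the whole space; \<open>P\<close> kills the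
  old basis vectors and fixes the new ones.\<close>

lemma subspace_projection_exists:
  fixes Z :: "('a \<Rightarrow> K) set"
  assumes "vs.subspace Z"
  shows "\<exists>P. lin P \<and> (\<forall>X. P X = 0 \<longleftrightarrow> X \<in> Z) \<and> (\<forall>X. P (P X) = P X)"
proof -
  obtain B where B: "B \<subseteq> Z" "vs.independent B" "Z \<subseteq> vs.span B"
    using vs.maximal_independent_subset by blast
  define B' where "B' = vs.extend_basis B"
  have B': "B \<subseteq> B'" "vs.independent B'" "vs.span B' = UNIV"
    using vs.extend_basis_superset[OF B(2)] vs.independent_extend_basis[OF B(2)]
      vs.span_extend_basis[OF B(2)] by (auto simp: B'_def)
  obtain P where P: "lin P" "\<forall>b\<in>B'. P b = (if b \<in> B then 0 else b)"
    using vsp.linear_independent_extend[OF B'(2), of "\<lambda>b. if b \<in> B then 0 else b"] by blast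
  have Z: "vs.span B = Z"
    using B assms by (simp add: vs.span_subspace)
  have P0: "P X = 0" if "X \<in> Z" for X
  proof (rule vsp.linear_eq_0_on_span[OF P(1)])
    show "X \<in> vs.span B"
      using that by (simp only: Z)
    show "P b = 0" if "b \<in> B" for b
      using that P(2) B'(1) by (simp add: subset_iff)
  qed
  have "\<exists>Y Y'. X = Y + Y' \<and> Y \<in> Z \<and> P Y' = Y'" for X
  proof -
    have "X \<in> vs.span (B \<union> (B' - B))"
      using B' by (simp add: Un_absorb1)
    then obtain Y Y' where Y: "X = Y + Y'" "Y \<in> vs.span B" "Y' \<in> vs.span (B' - B)"
      unfolding vs.span_Un by blast
    have "P Y' = Y'"
      using P(2) by (intro vsp.linear_eq_on[OF P(1) linI Y(3)]) auto
    with Y show ?thesis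
      by (auto simp: Z)
  qed
  then have "P (P X) = P X \<and> (P X = 0 \<longrightarrow> X \<in> Z)" for X
    by (metis P0 vsp.linear_add[OF P(1)] add.left_neutral add.right_neutral)
  then show ?thesis
    using P(1) P0 by blast
qed

text \<open>An idempotent realising the quotient by \<^term>\<open>Zb g m\<close>, so that congruences become equations.\<close>

definition Pz :: "gsch \<Rightarrow> int \<Rightarrow> seqf \<Rightarrow> seqf" where
  "Pz g m = (SOME P. lin P \<and> (\<forall>X. P X = 0 \<longleftrightarrow> X \<in> Zb g m) \<and> (\<forall>X. P (P X) = P X))"

lemma Pz: "lin (Pz g m)" "Pz g m X = 0 \<longleftrightarrow> X \<in> Zb g m" "Pz g m (Pz g m X) = Pz g m X"
  using someI_ex[OF subspace_projection_exists[OF Zb_subspace], of g m] unfolding Pz_def by blast+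

lemmas Pz_lin = lin_simps[OF Pz(1)]

lemma Pz_eq_iff: "Pz g m X = Pz g m Y \<longleftrightarrow> X - Y \<in> Zb g m"
  by (metis Pz(2) Pz_lin(4) eq_iff_diff_eq_0)

lemma inqL_iff:
  assumes "u \<in> Tn r"
  shows "inqL g m n (r, u) \<longleftrightarrow> emb g m r u \<in> LN g m n"
proof
  assume "inqL g m n (r, u)"
  then obtain t z where tz: "t \<ge> r" "z \<in> Lat t"
      "(\<lambda>l. Defs.ext g m r t u l - qp (int n) * z l) \<in> Nn t"
    by (auto simp: inqL_def)
  let ?y = "Defs.ext g m r t u - sc (qq ^ n) z"
  have y: "?y \<in> Nn t"
    using tz(3) by (simp add: fun_diff_def sc_def qp_nat)
  have "emb g m r u = sc (qq ^ n) (emb g m t z) + emb g m t ?y"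
    unfolding emb_lin emb_ext[OF tz(1)] by simp
  then show "emb g m r u \<in> LN g m n"
    using LN_I[OF tz(2) y, of n g m] by (simp only:)
next
  assume "emb g m r u \<in> LN g m n"
  then obtain t0 where "\<And>t'. t0 \<le> t' \<Longrightarrow>
      \<exists>z y. z \<in> Lat t' \<and> y \<in> Nn t' \<and> emb g m r u = sc (qq ^ n) (emb g m t' z) + emb g m t' y"
    using LN_level by metis
  \<comment> \<open>At a level above both, injectivity of \<open>emb\<close> turns the equation of
    sequences into one of tensors.\<close>
  from this[of "max r t0"] obtain t z y where t: "t \<ge> r" "z \<in> Lat t" "y \<in> Nn t"
      "emb g m r u = sc (qq ^ n) (emb g m t z) + emb g m t y"
    by (metis max.cobounded1 max.cobounded2)
  have "emb g m t (Defs.ext g m r t u - sc (qq ^ n) z - y) = 0"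
    unfolding emb_lin emb_ext[OF t(1)] t(4) by simp
  moreover have "Defs.ext g m r t u - sc (qq ^ n) z - y \<in> Tn t"
    using t Nn_Tn[OF t(3)] ext_Tn[OF assms t(1)]
    by (intro vs.subspace_diff vs.subspace_scale Tn_subspace) (auto simp: Lat_def)
  ultimately have "Defs.ext g m r t u - sc (qq ^ n) z = y"
    using emb_eq_0 by fastforce
  then have "(\<lambda>l. Defs.ext g m r t u l - qp (int n) * z l) = y"
    by (simp add: fun_eq_iff qp_nat)
  then show "inqL g m n (r, u)"
    using t by (auto simp: inqL_def)
qed

lemma ext_prj:
  assumes "r \<le> t"
  shows "prj (\<mu> + wts (grd g (m + int r) (t - r))) (Defs.ext g m r t u) = Defs.ext g m r t (prj \<mu> u)"
  by (simp add: ext_tp[OF assms] prj_tp_dl_right)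

lemma Tn_prj_sum:
  assumes "u \<in> Tn r"
  shows "u = (\<Sum>\<mu>\<in>wts ` {l. u l \<noteq> 0}. prj \<mu> u)"
proof
  fix l
  have fin: "finite (wts ` {l. u l \<noteq> 0})"
    using assms by (simp add: Tn_def)
  have "(\<Sum>\<mu>\<in>wts ` {l. u l \<noteq> 0}. prj \<mu> u) l = (\<Sum>\<mu>\<in>wts ` {l. u l \<noteq> 0}. if \<mu> = wts l then u l else 0)"
    using fin by (induction rule: finite_induct) (auto simp: prj_def)
  also have "\<dots> = u l"
    using fin by (auto simp: sum.delta)
  finally show "u l = (\<Sum>\<mu>\<in>wts ` {l. u l \<noteq> 0}. prj \<mu> u) l"
    by simp
qed

text \<open>Modulo \<^term>\<open>Zb g m\<close>, the normal forms generate every weight space of the lattice by finitely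
  many elements.\<close>

lemma LN_prj_Zb:
  assumes u: "u \<in> Tn r" "\<And>n. emb g m r u \<in> LN g m n"
  shows "emb g m r (prj \<mu> u) \<in> Zb g m"
proof -
  define H where "H = 2 * fst (wts (grd g m r)) - snd (wts (grd g m r)) - (2 * fst \<mu> - snd \<mu>)"
  define X where "X = {emb g m (length l) (dl l) | l.
    int (length l) \<le> H \<and> okl l \<and> (\<forall>c\<in>set l. - H \<le> fst c \<and> fst c \<le> 1)}"
  have "finite (Pz g m ` X)"
    unfolding X_def by (intro finite_imageI finite_good_vectors)
  then have "Pz g m (emb g m r (prj \<mu> u)) = 0"
  proof (rule finitely_generated_q_separated)
    fix n
    obtain t z where tz: "t \<ge> r" "z \<in> Lat t"
      "(\<lambda>l. Defs.ext g m r t u l - qp (int n) * z l) \<in> Nn t"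
      using u(2)[of n] inqL_iff[OF u(1), of g m n] by (auto simp: inqL_def)
    define \<nu> where "\<nu> = \<mu> + wts (grd g (m + int r) (t - r))"
    define y where "y = Defs.ext g m r t u - sc (qq ^ n) z"
    have y: "y \<in> Nn t"
      using tz(3) by (simp add: fun_diff_def sc_def qp_nat y_def)
    have "grd g m t = grd g m r @ grd g (m + int r) (t - r)"
      using grd_add[of g m r "t - r"] tz(1) by simp
    \<comment> \<open>The added ground state factors shift \<open>\<mu>\<close> and the reference
      weight alike. Hence \<open>H\<close>, and with it the finite set \<open>X\<close>, is the same
      for every level \<open>t\<close> and so for every \<open>n\<close>.\<close>
    then have H': "H = 2 * fst (wts (grd g m t)) - snd (wts (grd g m t)) - (2 * fst \<nu> - snd \<nu>)"
      by (simp add: H_def \<nu>_def wts_append)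
    have "Defs.ext g m r t u = sc (qq ^ n) z + y"
      by (simp add: y_def)
    then have "Defs.ext g m r t (prj \<mu> u) = sc (qq ^ n) (prj \<nu> z) + prj \<nu> y"
      unfolding ext_prj[OF tz(1), symmetric] \<nu>_def[symmetric]
      by (simp only: vsp.linear_add[OF lin_prj] vsp.linear_scale[OF lin_prj])
    then have "emb g m r (prj \<mu> u) = sc (qq ^ n) (emb g m t (prj \<nu> z)) + emb g m t (prj \<nu> y)"
      unfolding emb_ext[OF tz(1), symmetric] by (simp only: emb_lin)
    moreover have "Pz g m (emb g m t (prj \<nu> y)) = 0"
      using Zb_Nn[OF prj_Nn[OF y]] by (simp add: Pz(2))
    ultimately have "Pz g m (emb g m r (prj \<mu> u)) = sc (qq ^ n) (Pz g m (emb g m t (prj \<nu> z)))"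
      by (simp only: Pz_lin add.right_neutral)
    moreover have "Pz g m (emb g m t (prj \<nu> z)) \<in> Asp (Pz g m ` X)"
    proof -
      have z: "prj \<nu> z \<in> Tn t" "\<And>l. prj \<nu> z l \<in> Areg"
        using prj_Lat[OF tz(2)] by (auto simp: Lat_def)
      have lin: "lin (\<lambda>x. Pz g m (emb g m t x))"
        by (rule lin_comp[OF Pz(1) lin_emb])
      show ?thesis
        unfolding Tn_lin_expand[OF z(1) lin]
      proof (intro Asp_sum Asp_scale z(2))
        fix l
        assume "l \<in> {l. prj \<nu> z l \<noteq> 0}"
        then have l: "length l = t" "okl l" "wts l = \<nu>"
          using Tn_support[OF z(1), of l] by (auto simp: prj_def split: if_splits)
        show "Pz g m (emb g m t (dl l)) \<in> Asp (Pz g m ` X)"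
        proof (rule Asp_linear_image[OF normal_form[OF l(1,2)] Pz(1)])
          fix s
          assume "s \<in> NF g m t (wts l)"
          then consider "s \<in> Zb g m" |
              l' where "s = emb g m t (dl l')" "length l' = t" "okl l'" "good g m l'" "wts l' = \<nu>"
            unfolding NF_def l(3) by blast
          then show "Pz g m s \<in> Asp (Pz g m ` X)"
          proof cases
            case 1
            then have *: "Pz g m s = 0"
              by (simp add: Pz(2))
            show ?thesis
              unfolding * by (rule Asp.zero)
          next
            case 2
            obtain l'' p where l'': "l' = l'' @ grd g (m + int (length l'')) p" "okl l''"
                "int (length l'') \<le> H" "\<forall>c\<in>set l''. - H \<le> fst c \<and> fst c \<le> 1"
              using good_decomposition[OF 2(4,3), of H] H' 2 by auto
            \<comment> \<open>Dropping the trailing ground state vectors brings \<open>s\<close>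
              into \<open>X\<close>, where lengths are bounded by \<open>H\<close> instead of
              \<open>t\<close>.\<close>
            have "s = emb g m (length l'') (dl l'')"
              using emb_tp_grd[of g m "length l''" p "dl l''"] 2(1,2) l''(1)
              by (simp add: tp_dl)
            then have "s \<in> X"
              using l'' by (auto simp: X_def)
            then show ?thesis
              by (intro Asp_base imageI)
          qed
        qed
      qed
    qed
    ultimately show "\<exists>x\<in>Asp (Pz g m ` X). Pz g m (emb g m r (prj \<mu> u)) = sc (qq ^ n) x"
      by blast
  qed
  then show ?thesis
    by (simp add: Pz(2))
qed

lemma LN_Zb:
  assumes "u \<in> Tn r" "\<And>n. emb g m r u \<in> LN g m n"
  shows "emb g m r u \<in> Zb g m"
proof -
  have "emb g m r u = (\<Sum>\<mu>\<in>wts ` {l. u l \<noteq> 0}. emb g m r (prj \<mu> u))"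
    using arg_cong[OF Tn_prj_sum[OF assms(1)], of "emb g m r"]
    by (simp only: vsp.linear_sum[OF lin_emb])
  also have "\<dots> \<in> Zb g m"
    using LN_prj_Zb[OF assms] by (intro vs.subspace_sum[OF Zb_subspace])
  finally show ?thesis .
qed

theorem fnull_iff:
  assumes "u \<in> Tn r"
  shows "fnull g m (r, u) \<longleftrightarrow> emb g m r u \<in> Zb g m"
  using LN_Zb[OF assms] Zb_LN by (auto simp: fnull_def inqL_iff[OF assms])

section \<open>Operators on the Fock spaces\<close>

definition gam :: "gsch \<Rightarrow> K" where
  "gam g = (case g of GS_A \<Rightarrow> 1 | GS_B \<Rightarrow> inverse (qint 2))"

definition eps :: "gsch \<Rightarrow> K" where
  "eps g = (case g of GS_A \<Rightarrow> 0 | GS_B \<Rightarrow> - (qq\<^sup>2))"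

definition kap :: "gsch \<Rightarrow> int \<Rightarrow> cowt \<Rightarrow> K" where
  "kap g m h = qp (pair h (lam g m))"

text \<open>\<open>f\<^sub>i |m\<rangle> = phi \<and> |m + 1\<rangle>\<close>: the coefficient \<open>gam\<close> sums the geometric series with ratio \<open>eps\<close>
  that the coproduct produces.\<close>

definition phi :: "gsch \<Rightarrow> int \<Rightarrow> I \<Rightarrow> tens" where
  "phi g m i = sc (gam g) (Fop i (dl [gs g m]))"

text \<open>The coproduct of \<open>f_i\<close> on \<open>u\<close> followed by the vacuum at m + r,
  on which t_i acts by \<open>kap\<close>. The first summand is padded with a ground state vector so
  that both have level r + 1.\<close>

definition tF :: "gsch \<Rightarrow> int \<Rightarrow> I \<Rightarrow> nat \<Rightarrow> tens \<Rightarrow> tens" where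
  "tF g m i r u = sc (kap g (m + int r) (hcor i)) (tp r (Fop i u) (dl [gs g (m + int r)])) +
    tp r u (phi g (m + int r) i)"

definition tK :: "gsch \<Rightarrow> int \<Rightarrow> cowt \<Rightarrow> nat \<Rightarrow> tens \<Rightarrow> tens" where
  "tK g m h r u = sc (kap g (m + int r) h) (Kop h u)"

lemma one_plus_qq_sq_nz [simp]: "1 + qq * qq \<noteq> 0"
  using qint_2_nz by (simp add: field_simps)

lemma kap_rec: "kap g m h = qp (pair h (wtb (gs g m))) * kap g (m + 1) h"
proof -
  have "pair h (lam g m) = pair h (wtb (gs g m)) + pair h (lam g (m + 1))"
    by (cases g; cases "even m") (auto simp: pair_def wtb_def algebra_simps elim!: evenE oddE)
  then show ?thesis
    by (simp add: kap_def qp_add)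
qed

text \<open>This fixes \<open>gam\<close> as the sum of the series \<open>kap\<close> (1 +
  \<open>eps\<close> + \<open>eps\<close>^2 + ...). In case (B) it reads q / (1 + q^2) = 1 /
  [2].\<close>

lemma kap_gam: "fco i (gs g m) \<noteq> 0 \<Longrightarrow> kap g (m + 1) (hcor i) = gam g * (1 - eps g)"
  by (cases g; cases i; cases "even m")
    (auto simp: kap_def pair_def gam_def eps_def field_simps power2_eq_square)

text \<open>The rank grows by 1 or 2 under each \<open>e_i\<close>. Hence \<open>e_i\<close> sends
  ground state vectors to multiples of vectors of positive rank and annihilates the vacuum.\<close>

lemma rho_ece: "okb c \<Longrightarrow> eco i c \<noteq> 0 \<Longrightarrow> rho g m c < rho g m (ece i c)"
  by (cases g; cases i; elim okb_cases) (auto split: if_splits)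

lemma Lm_Lm: "Lm r u (Lm s v X) = Lm (r + s) (tp r u v) X"
proof
  fix f :: "nat \<Rightarrow> bas"
  have "map f [0..<r + s] = map f [0..<r] @ map (\<lambda>k. f (r + k)) [0..<s]"
    by (rule nth_equalityI) (auto simp: nth_append)
  then show "Lm r u (Lm s v X) f = Lm (r + s) (tp r u v) X f"
    by (simp add: Lm_def tp_def add.assoc)
qed

lemma emb_tp1: "emb g m (Suc r) (tp r u w) = Lm r u (emb g (m + int r) 1 w)"
  using emb_tp[of g m r 1 u w] by simp

lemma emb_vac: "emb g m 1 (dl [gs g m]) = emb g m 0 (dl [])"
  using emb_Suc[of g m 0 "dl []"] by (simp add: tp_0)

lemma emb_vac': "emb g m r u = Lm r u (emb g (m + int r) 0 (dl []))"
  using emb_tp1[of g m r u "dl [gs g (m + int r)]"] emb_Suc[of g m r u]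
  by (simp only: emb_vac)

lemma E_bad:
  assumes "okb c" "0 \<le> rho g m c"
  shows "emb g m 1 (Eop i (dl [c])) \<in> Zb g m"
proof (cases "eco i c = 0")
  case True
  then show ?thesis
    using assms Zb_0 by (simp add: Eop_dl1 emb_lin)
next
  case False
  then show ?thesis
    using assms ece_ok[OF assms(1) False] rho_ece[OF assms(1) False, of g m]
    unfolding Eop_dl1[OF assms(1)] emb_lin
    by (intro Zb_scale Zb_bad1) auto
qed

text \<open>The conditions under which operators on representatives induce a map of Fock spaces:
  compatibility with the transition maps modulo Z, and both kinds of generators of Z sent into Z.
  \<open>d\<close> is the number of factors added, 1 for \<open>f_i\<close> and 0 for the
  others.\<close>

definition fock_op :: "gsch \<Rightarrow> int \<Rightarrow> nat \<Rightarrow> (nat \<Rightarrow> tens \<Rightarrow> tens) \<Rightarrow> bool" where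
  "fock_op g m d \<tau> \<longleftrightarrow>
    (\<forall>r. lin (\<tau> r)) \<and>
    (\<forall>r. \<forall>u\<in>Tn r. \<tau> r u \<in> Tn (r + d)) \<and>
    (\<forall>r. \<forall>u\<in>Tn r. emb g m (Suc r + d) (\<tau> (Suc r) (tp r u (dl [gs g (m + int r)]))) -
      emb g m (r + d) (\<tau> r u) \<in> Zb g m) \<and>
    (\<forall>t. \<forall>y\<in>Nn t. emb g m (t + d) (\<tau> t y) \<in> Zb g m) \<and>
    (\<forall>a c. okl a \<longrightarrow> okb c \<longrightarrow> 0 < rho g (m + int (length a)) c \<longrightarrow>
      emb g m (Suc (length a) + d) (\<tau> (Suc (length a)) (dl (a @ [c]))) \<in> Zb g m)"

lemma fock_op_E: "fock_op g m 0 (\<lambda>r. Eop i)"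
  unfolding fock_op_def
proof (intro conjI allI ballI impI)
  fix r u
  assume "u \<in> Tn r"
  then show "emb g m (Suc r + 0) (Eop i (tp r u (dl [gs g (m + int r)]))) - emb g m (r + 0) (Eop i u) \<in> Zb g m"
    unfolding Eop_tp emb_lin add_0_right emb_Suc add_diff_cancel_left'
    unfolding emb_tp1
    by (intro Zb_Lm Kop_Tn E_bad) auto
next
  fix a :: "bas list" and c
  assume *: "okl a" "okb c" "0 < rho g (m + int (length a)) c"
  have "dl (a @ [c]) = tp (length a) (dl a) (dl [c])"
    by (simp add: tp_dl)
  then show "emb g m (Suc (length a) + 0) (Eop i (dl (a @ [c]))) \<in> Zb g m"
    using * by (simp only: Eop_tp emb_lin add_0_right emb_tp1)
      (intro Zb_add Zb_Lm Zb_bad1 E_bad Kop_Tn Eop_Tn dl_Tn; simp)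
qed (auto intro: lin_Eop Eop_Tn Zb_Nn Eop_Nn)

lemma lin_scale: "lin f \<Longrightarrow> lin (\<lambda>x. sc k (f x))"
  by (rule linI) (simp_all only: vsp.linear_add vsp.linear_scale vs.scale_right_distrib vs.scale_left_commute)

lemma lin_diff: "lin f \<Longrightarrow> lin g \<Longrightarrow> lin (\<lambda>x. f x - g x)"
  by (rule linI) (simp_all only: vsp.linear_add vsp.linear_scale vs.scale_right_diff_distrib add_diff_add)

lemma fock_op_K: "fock_op g m 0 (tK g m h)"
  unfolding fock_op_def
proof (intro conjI allI ballI impI)
  show "lin (tK g m h r)" for r
    unfolding tK_def[abs_def] by (rule lin_scale[OF lin_Kop])
next
  fix r u
  assume "u \<in> Tn r"
  then show "tK g m h r u \<in> Tn (r + 0)"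
    unfolding tK_def by (simp add: Tn_scale Kop_Tn)
next
  fix r and u :: tens
  have "emb g m (Suc r) (tK g m h (Suc r) (tp r u (dl [gs g (m + int r)]))) = emb g m r (tK g m h r u)"
    unfolding tK_def Kop_tp Kop_dl tp_lin emb_lin emb_Suc kap_rec[of g "m + int r" h] vs.scale_scale
    by (simp add: hw_Cons mult.commute add_ac)
  then show "emb g m (Suc r + 0) (tK g m h (Suc r) (tp r u (dl [gs g (m + int r)]))) -
      emb g m (r + 0) (tK g m h r u) \<in> Zb g m"
    by (simp add: Zb_0)
next
  fix t y
  assume "y \<in> Nn t"
  then show "emb g m (t + 0) (tK g m h t y) \<in> Zb g m"
    unfolding tK_def add_0_right by (intro Zb_Nn Nn_scale Kop_Nn)
next
  fix a :: "bas list" and c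
  assume *: "okl a" "okb c" "0 < rho g (m + int (length a)) c"
  show "emb g m (Suc (length a) + 0) (tK g m h (Suc (length a)) (dl (a @ [c]))) \<in> Zb g m"
    unfolding tK_def Kop_dl emb_lin add_0_right
    using * by (intro Zb_scale Zb_bad) auto
qed

lemma phi_Tn: "phi g m i \<in> Tn 1"
  unfolding phi_def by (intro Tn_scale Fop_Tn dl_Tn) auto

lemma phi_dl: "phi g m i = sc (gam g * fco i (gs g m)) (dl [fce i (gs g m)])"
  by (simp add: phi_def Fop_dl1 vs.scale_scale)

lemma emb_tF:
  "emb g m (Suc r) (tF g m i r u) = sc (kap g (m + int r) (hcor i)) (emb g m r (Fop i u)) +
    Lm r u (emb g (m + int r) 1 (phi g (m + int r) i))"
  unfolding tF_def emb_lin emb_Suc unfolding emb_tp1 ..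

lemma str_Zb:
  assumes "okb c" "okb d"
  shows "emb g m 2 (dl [c, d]) - emb g m 2 (cmb (str c d)) \<in> Zb g m"
  unfolding emb_lin(4)[symmetric] using assms by (intro Zb_Nn Nsp_Nn str_Nsp)

lemma Zb_trans: "X - Y \<in> Zb g m \<Longrightarrow> Y - W \<in> Zb g m \<Longrightarrow> X - W \<in> Zb g m"
  using Zb_add[ of "X - Y" g m "Y - W"] by simp

lemma Lm_dl1: "Lm 1 (dl [b]) (emb g (m + 1) r (dl l)) = emb g m (Suc r) (dl (b # l))"
  by (rule emb_Cons[symmetric])

lemma emb_dl_Suc_gs: "emb g m (length l) (dl l) = emb g m (Suc (length l)) (dl (l @ [gs g (m + int (length l))]))"
  using emb_Suc[of g m "length l" "dl l"] by (simp add: tp_dl)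

text \<open>Moving \<open>f\<^sub>i b\<^sup>\<circ>\<^sub>m\<^sub>+\<^sub>1\<close> to the left past \<open>b\<^sup>\<circ>\<^sub>m\<close>; in case (A) the next tensor factor is needed too.\<close>

lemma phi_shift:
  "Lm 1 (dl [gs g m]) (emb g (m + 1) 1 (phi g (m + 1) i)) - sc (eps g) (emb g m 1 (phi g m i)) \<in> Zb g m"
proof (cases "g = GS_B")
  case True
  \<comment> \<open>In case (B) the straightening of this pair has the single coefficient -q^2,
    which is the origin of \<open>eps\<close>.\<close>
  have *: "emb g m 2 (dl [(0, 1), c]) - sc (- (qq\<^sup>2)) (emb g m 1 (dl [c])) \<in> Zb g m"
    if "c = (0, 2) \<or> c = (- 1, 0)" for c :: bas
  proof -
    have "emb g m 1 (dl [c]) = emb g m 2 (dl [c, (0, 1)])"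
      using emb_dl_Suc_gs[of g m "[c]"] True by (simp add: numeral_2_eq_2)
    then show ?thesis
      using str_Zb[of "(0, 1)" c g m] that by (auto simp: emb_lin)
  qed
  have "Lm 1 (dl [gs g m]) (emb g (m + 1) 1 (phi g (m + 1) i)) - sc (eps g) (emb g m 1 (phi g m i)) =
      sc (gam g * fco i (0, 1)) (emb g m 2 (dl [(0, 1), fce i (0, 1)]) -
        sc (- (qq\<^sup>2)) (emb g m 1 (dl [fce i (0, 1)])))"
    unfolding phi_dl emb_lin Lm_lin Lm_dl1 vs.scale_right_diff_distrib vs.scale_scale
    using True by (simp add: eps_def numeral_2_eq_2 mult.commute)
  also have "\<dots> \<in> Zb g m"
    by (intro Zb_scale *) (cases i; auto simp: numeral_2_eq_2)
  finally show ?thesis .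
next
  case False
  then have g: "g = GS_A"
    by (cases g) auto
  have *: "emb g m 2 (dl [b, d]) \<in> Zb g m"
    if "b = (0, 0) \<and> d = (0, 1) \<and> odd m \<or> b = (1, 2) \<and> d = (0, 1) \<and> even m" for b d :: bas
  proof -
    \<comment> \<open>In case (A) the sequence has period 2, so moving \<open>d\<close> to the left
      of \<open>b\<close> leaves b \<otimes> b, which lies in N. This is why \<open>eps\<close> is
      0.\<close>
    have bm: "gs g (m + 2) = b"
      using that g by auto
    have "emb g m 2 (dl [b, d]) = emb g m 3 (dl [b, d, b])"
      using emb_dl_Suc_gs[of g m "[b, d]"] bm by (simp add: numeral_2_eq_2 numeral_3_eq_3)
    also have "\<dots> = emb g m 3 (tp 2 (dl [b, d] - cmb (str b d)) (dl [b])) +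
        emb g m 3 (tp 2 (cmb (str b d)) (dl [b]))"
      by (simp add: tp_lin emb_lin tp_dl)
    also have "\<dots> \<in> Zb g m"
    proof (rule Zb_add)
      have "tp 2 (dl [b, d] - cmb (str b d)) (dl [b]) \<in> Nn (2 + 1)"
        using that by (intro Nn_tp_right dl_Tn Nsp_Nn str_Nsp) auto
      then show "emb g m 3 (tp 2 (dl [b, d] - cmb (str b d)) (dl [b])) \<in> Zb g m"
        by (intro Zb_Nn) (simp add: numeral_2_eq_2 numeral_3_eq_3)
      have "dl [b, b] \<in> Nsp"
        using str_Nsp[of b b] that by auto
      then have "tp 1 (dl [d]) (dl [b, b]) \<in> Nn (1 + 2)"
        using that by (intro Nn_tp_left dl_Tn Nsp_Nn) auto
      then have "emb g m 3 (dl [d, b, b]) \<in> Zb g m"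
        by (intro Zb_Nn) (simp add: tp_dl numeral_2_eq_2 numeral_3_eq_3)
      moreover have "cmb (str b d) = sc (- (qq\<^sup>2)) (dl [d, b])"
        using that by auto
      then have "emb g m 3 (tp 2 (cmb (str b d)) (dl [b])) = sc (- (qq\<^sup>2)) (emb g m 3 (dl [d, b, b]))"
        by (simp only: tp_lin emb_lin) (simp add: tp_dl)
      ultimately show "emb g m 3 (tp 2 (cmb (str b d)) (dl [b])) \<in> Zb g m"
        using Zb_scale by (simp only:)
    qed
    finally show ?thesis .
  qed
  have 0: "fco i (gs g (m + 1)) = 0 \<or> emb g m 2 (dl [gs g m, fce i (gs g (m + 1))]) \<in> Zb g m"
    using *[of "gs g m" "fce i (gs g (m + 1))"] g by (cases i; cases "even m"; simp)
  have "Lm 1 (dl [gs g m]) (emb g (m + 1) 1 (phi g (m + 1) i)) - sc (eps g) (emb g m 1 (phi g m i)) =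
      sc (gam g * fco i (gs g (m + 1))) (emb g m 2 (dl [gs g m, fce i (gs g (m + 1))]))"
    unfolding phi_dl emb_lin Lm_lin Lm_dl1
    using g by (simp add: eps_def numeral_2_eq_2)
  moreover have "\<dots> \<in> Zb g m"
    using 0 by (auto intro: Zb_scale simp: Zb_0)
  ultimately show ?thesis
    by (simp only:)
qed

text \<open>Compatibility of the vacuum value of \<open>f_i\<close> with splitting off the first
  ground state vector. By \<open>kap_gam\<close> and \<open>phi_shift\<close> it is the equation (1
  - \<open>eps\<close>) x + \<open>eps\<close> x = x.\<close>

lemma phi_rec:
  "sc (kap g (m + 1) (hcor i)) (emb g m 1 (Fop i (dl [gs g m]))) +
    Lm 1 (dl [gs g m]) (emb g (m + 1) 1 (phi g (m + 1) i)) - emb g m 1 (phi g m i) \<in> Zb g m"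
proof -
  have 1: "sc (kap g (m + 1) (hcor i)) (emb g m 1 (Fop i (dl [gs g m]))) =
      sc (1 - eps g) (emb g m 1 (phi g m i))"
    unfolding phi_dl Fop_dl1[OF okb_gs] emb_lin vs.scale_scale
    using kap_gam[of i g m] by (cases "fco i (gs g m) = 0") (simp_all add: mult_ac)
  have "sc (1 - eps g) (emb g m 1 (phi g m i)) +
      Lm 1 (dl [gs g m]) (emb g (m + 1) 1 (phi g (m + 1) i)) - emb g m 1 (phi g m i) =
    Lm 1 (dl [gs g m]) (emb g (m + 1) 1 (phi g (m + 1) i)) - sc (eps g) (emb g m 1 (phi g m i))"
    by (simp only: vs.scale_left_diff_distrib vs.scale_one) simp
  then show ?thesis
    unfolding 1 using phi_shift[of g m i] by (simp only:)
qed

text \<open>The pairs of a vector \<open>c\<close> of positive rank and an \<open>f_i\<close> that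
  lowers its weight so far that \<open>high_weight_Zb\<close> no longer applies.\<close>

definition special :: "gsch \<Rightarrow> int \<Rightarrow> (bas \<times> I) set" where
  "special g m = (case g of GS_B \<Rightarrow> {((0, 0), i1), ((1, 2), i0)}
    | GS_A \<Rightarrow> if even m then {((1, 1), i1), ((0, 0), i1)} else {((1, 1), i0), ((1, 2), i0)})"

lemma bad_F_high:
  assumes "okb c" "0 < rho g m c" "(c, i) \<notin> special g m"
  shows "fst (gs g m) < fst c - fst (ewt i) \<or>
    fst (gs g m) - int (snd (gs g m)) < fst c - int (snd c) - (fst (ewt i) - snd (ewt i))"
  using assms by (cases g; cases i; cases "even m"; elim okb_cases; simp add: special_def ewt_def)

lemma fce_components:
  assumes "fco i c \<noteq> 0"
  shows "fst (fce i c) = fst c - fst (ewt i)" "int (snd (fce i c)) = int (snd c) - snd (ewt i)"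
  using assms by (cases i; cases c; auto simp: ewt_def of_nat_diff split: if_splits)+

lemma grd_2: "grd g m 2 = [gs g m, gs g (m + 1)]"
  by (simp add: grd_Suc numeral_2_eq_2)

text \<open>The second summand is a multiple of the left side of a straightening rule, and the first
  summand matches one of the terms on its right side. Every remaining term has a second factor of
  positive rank and lies in Z.\<close>

lemma bad_F_special:
  assumes "(c, i) \<in> special g m"
  shows "sc (kap g (m + 1) (hcor i) * fco i c) (emb g m 2 (dl [fce i c, gs g (m + 1)])) +
    sc (gam g * fco i (gs g (m + 1))) (emb g m 2 (dl [c, fce i (gs g (m + 1))])) \<in> Zb g m"
    (is "?X \<in> _")
proof -
  let ?d = "fce i (gs g (m + 1))"
  let ?b = "gs g (m + 1)"
  have Zb_eqI: "X \<in> Zb g m" if "Y \<in> Zb g m" "X = Y" for X Y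
    using that by simp
  note [simp] = kap_def pair_def gam_def fun_eq_iff emb_lin numeral_2_eq_2[symmetric]
  consider "g = GS_B" "c = (0, 0)" "i = i1" | "g = GS_B" "c = (1, 2)" "i = i0"
    | "g = GS_A" "even m" "c = (1, 1)" "i = i1" | "g = GS_A" "even m" "c = (0, 0)" "i = i1"
    | "g = GS_A" "odd m" "c = (1, 1)" "i = i0" | "g = GS_A" "odd m" "c = (1, 2)" "i = i0"
    using assms by (auto simp: special_def split: gsch.splits if_splits)
  then show ?thesis
  proof cases
    case 1
    have "emb g m 2 (dl [(0, 2), (0, 0)]) \<in> Zb g m"
      by (rule Zb_bad2) (simp_all add: 1)
    from Zb_add[OF str_Zb[of "(0, 0)" "(0, 2)" g m]
        Zb_scale[OF this, of "- (qq ^ 4)"]]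
    show ?thesis
      by (rule Zb_eqI) (simp_all add: 1)
  next
    case 2
    have "emb g m 2 (dl [(- 1, 0), (1, 2)]) \<in> Zb g m"
      by (rule Zb_bad2) (simp_all add: 2)
    from Zb_add[OF str_Zb[of "(1, 2)" "(- 1, 0)" g m]
        Zb_scale[OF this, of "- (qq ^ 4)"]]
    show ?thesis
      by (rule Zb_eqI) (simp_all add: 2)
  next
    case 3
    have "emb g m 2 (dl [(0, 1), (1, 1)]) \<in> Zb g m" "emb g m 2 (dl [(0, 0), (1, 2)]) \<in> Zb g m"
      by (rule Zb_bad2; simp add: 3)+
    from Zb_add[OF str_Zb[of "(1, 1)" "(0, 1)" g m]
        Zb_add[OF Zb_scale[OF this(1), of "- (qq\<^sup>2)"]
         Zb_scale[OF this(2), of "- (qq + qq ^ 3)"]]]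
    show ?thesis
      by (rule Zb_eqI) (simp_all add: 3, simp add: field_simps power2_eq_square power3_eq_cube)
  next
    case 4
    from str_Zb[of "(0, 0)" "(0, 1)" g m]
    show ?thesis
      by (rule Zb_eqI) (simp_all add: 4)
  next
    case 5
    have "emb g m 2 (dl [(0, 1), (1, 1)]) \<in> Zb g m" "emb g m 2 (dl [(1, 2), (0, 0)]) \<in> Zb g m"
      by (rule Zb_bad2; simp add: 5)+
    from Zb_add[OF str_Zb[of "(1, 1)" "(0, 1)" g m]
        Zb_add[OF Zb_scale[OF this(1), of "- (qq\<^sup>2)"]
         Zb_scale[OF this(2), of "- (qq + qq ^ 3)"]]]
    show ?thesis
      by (rule Zb_eqI) (simp_all add: 5, simp add: field_simps power2_eq_square power3_eq_cube)
  next
    case 6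
    from str_Zb[of "(1, 2)" "(0, 1)" g m]
    show ?thesis
      by (rule Zb_eqI) (simp_all add: 6)
  qed
qed

text \<open>If \<open>c\<close> has positive rank then \<open>f\<^sub>i (G(c) \<and> |m + 1\<rangle>)\<close> vanishes: either its weight is too high,
  or this is one of finitely many explicit relations.\<close>

lemma bad_F:
  assumes "okb c" "0 < rho g m c"
  shows "sc (kap g (m + 1) (hcor i)) (emb g m 1 (Fop i (dl [c]))) +
    Lm 1 (dl [c]) (emb g (m + 1) 1 (phi g (m + 1) i)) \<in> Zb g m"
proof -
  let ?b = "gs g (m + 1)"
  have 1: "emb g m 1 (dl [fce i c]) = emb g m 2 (dl [fce i c, ?b])"
    using emb_dl_Suc_gs[of g m "[fce i c]"] by (simp add: numeral_2_eq_2)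
  have eq: "sc (kap g (m + 1) (hcor i)) (emb g m 1 (Fop i (dl [c]))) +
      Lm 1 (dl [c]) (emb g (m + 1) 1 (phi g (m + 1) i)) =
    sc (kap g (m + 1) (hcor i) * fco i c) (emb g m 2 (dl [fce i c, ?b])) +
      sc (gam g * fco i ?b) (emb g m 2 (dl [c, fce i ?b]))"
    unfolding phi_dl Fop_dl1[OF assms(1)] emb_lin Lm_lin Lm_dl1 vs.scale_scale 1
    by (simp add: numeral_2_eq_2)
  show ?thesis
  proof (cases "(c, i) \<in> special g m")
    case True
    then show ?thesis
      unfolding eq by (rule bad_F_special)
  next
    case False
    note high = bad_F_high[OF assms False]
    have "fco i c = 0 \<or> emb g m 2 (dl [fce i c, ?b]) \<in> Zb g m"
    proof (cases "fco i c = 0")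
      case nz: False
      have "emb g m 2 (dl [fce i c, ?b]) \<in> Zb g m"
        using high fce_ok[OF assms(1) nz] fce_components[OF nz]
        by (intro high_weight_Zb) (auto simp: grd_2 wts_Cons)
      then show ?thesis
        by blast
    qed auto
    moreover have "fco i ?b = 0 \<or> emb g m 2 (dl [c, fce i ?b]) \<in> Zb g m"
    proof (cases "fco i ?b = 0")
      case nz: False
      have "emb g m 2 (dl [c, fce i ?b]) \<in> Zb g m"
        using high assms(1) fce_ok[OF okb_gs nz] fce_components[OF nz]
        by (intro high_weight_Zb) (auto simp: grd_2 wts_Cons)
      then show ?thesis
        by blast
    qed auto
    ultimately show ?thesis
      unfolding eq
      by (intro Zb_add)
        (auto intro: Zb_scale simp: Zb_0)
  qed
qed

lemma emb_tF_tp: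
  "emb g m (Suc (Suc r)) (tF g m i (Suc r) (tp r u w)) =
    sc (kap g (m + int r + 1) (hcor i)) (Lm r (Fop i u) (emb g (m + int r) 1 (Kop (hcor i) w))) +
    Lm r u (sc (kap g (m + int r + 1) (hcor i)) (emb g (m + int r) 1 (Fop i w)) +
      Lm 1 w (emb g (m + int r + 1) 1 (phi g (m + int r + 1) i)))"
proof -
  have "m + int (Suc r) = m + int r + 1"
    by simp
  then show ?thesis
    unfolding emb_tF Fop_tp emb_lin emb_tp1 Lm_lin Lm_Lm
    by (simp only: vs.scale_right_distrib add.assoc Suc_eq_plus1)
qed

lemma fock_op_F: "fock_op g m 1 (tF g m i)"
  unfolding fock_op_def
proof (intro conjI allI ballI impI)
  show "lin (tF g m i r)" for r
    by (rule linI) (simp_all add: tF_def Fop_lin tp_lin vs.scale_right_distrib vs.scale_left_commute add_ac)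
next
  fix r u
  assume "u \<in> Tn r"
  then show "tF g m i r u \<in> Tn (r + 1)"
    unfolding tF_def
    by (intro vs.subspace_add vs.subspace_scale Tn_subspace tp_Tn Fop_Tn dl_Tn phi_Tn) auto
next
  fix r u
  assume u: "u \<in> Tn r"
  let ?M = "m + int r"
  let ?b = "gs g ?M"
  have Kb: "sc (kap g (?M + 1) (hcor i)) (Lm r (Fop i u) (emb g ?M 1 (Kop (hcor i) (dl [?b])))) =
      sc (kap g ?M (hcor i)) (emb g m r (Fop i u))"
    unfolding Kop_dl emb_lin Lm_lin vs.scale_scale kap_rec[of g ?M]
      emb_vac emb_vac'[of g m r, symmetric]
    by (simp add: hw_Cons mult.commute)
  have 1: "emb g m (Suc (Suc r)) (tF g m i (Suc r) (tp r u (dl [?b]))) =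
      sc (kap g ?M (hcor i)) (emb g m r (Fop i u)) +
      Lm r u (sc (kap g (?M + 1) (hcor i)) (emb g ?M 1 (Fop i (dl [?b]))) +
        Lm 1 (dl [?b]) (emb g (?M + 1) 1 (phi g (?M + 1) i)))"
    unfolding emb_tF_tp Kb ..
  have "emb g m (Suc (Suc r)) (tF g m i (Suc r) (tp r u (dl [?b]))) - emb g m (Suc r) (tF g m i r u) =
      Lm r u (sc (kap g (?M + 1) (hcor i)) (emb g ?M 1 (Fop i (dl [?b]))) +
        Lm 1 (dl [?b]) (emb g (?M + 1) 1 (phi g (?M + 1) i)) - emb g ?M 1 (phi g ?M i))"
    unfolding 1 unfolding emb_tF Lm_lin by simp
  also have "\<dots> \<in> Zb g m"
    by (intro Zb_Lm phi_rec u)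
  finally show "emb g m (Suc r + 1) (tF g m i (Suc r) (tp r u (dl [?b]))) -
      emb g m (r + 1) (tF g m i r u) \<in> Zb g m"
    by simp
next
  fix t y
  assume y: "y \<in> Nn t"
  have "tF g m i t y \<in> Nn (t + 1)"
    unfolding tF_def
    by (intro vs.subspace_add vs.subspace_scale Nn_subspace Nn_tp_right Fop_Nn dl_Tn phi_Tn y) auto
  then show "emb g m (t + 1) (tF g m i t y) \<in> Zb g m"
    by (rule Zb_Nn)
next
  fix a :: "bas list" and c
  let ?r = "length a"
  let ?M = "m + int ?r"
  assume *: "okl a" "okb c" "0 < rho g (m + int (length a)) c"
  have ac: "dl (a @ [c]) = tp ?r (dl a) (dl [c])"
    by (simp add: tp_dl)
  have "emb g m (Suc (Suc ?r)) (tF g m i (Suc ?r) (dl (a @ [c]))) =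
      sc (kap g (?M + 1) (hcor i)) (Lm ?r (Fop i (dl a)) (emb g ?M 1 (Kop (hcor i) (dl [c])))) +
      Lm ?r (dl a) (sc (kap g (?M + 1) (hcor i)) (emb g ?M 1 (Fop i (dl [c]))) +
        Lm 1 (dl [c]) (emb g (?M + 1) 1 (phi g (?M + 1) i)))"
    unfolding ac emb_tF_tp ..
  also have "\<dots> \<in> Zb g m"
  proof -
    have "emb g ?M 1 (Kop (hcor i) (dl [c])) \<in> Zb g ?M"
      unfolding Kop_dl emb_lin by (intro Zb_scale Zb_bad1 *)
    moreover have "sc (kap g (?M + 1) (hcor i)) (emb g ?M 1 (Fop i (dl [c]))) +
        Lm 1 (dl [c]) (emb g (?M + 1) 1 (phi g (?M + 1) i)) \<in> Zb g ?M"
      by (intro bad_F *)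
    moreover have "dl a \<in> Tn ?r" "Fop i (dl a) \<in> Tn ?r"
      using * by (auto intro!: Fop_Tn dl_Tn)
    ultimately show ?thesis
      using Zb_add[OF Zb_scale[OF Zb_Lm] Zb_Lm] by blast
  qed
  finally show "emb g m (Suc ?r + 1) (tF g m i (Suc ?r) (dl (a @ [c]))) \<in> Zb g m"
    by simp
qed

section \<open>Induced linear maps and the vectors c \<and> x\<close>

definition fv :: "gsch \<Rightarrow> int \<Rightarrow> nat \<Rightarrow> tens \<Rightarrow> seqf" where
  "fv g m r u = Pz g m (emb g m r u)"

lemma lin_fv: "lin (fv g m r)"
  unfolding fv_def[abs_def] by (rule lin_comp[OF Pz(1) lin_emb])

lemmas fv_lin = lin_simps[OF lin_fv]

lemma fock_op_compat:
  assumes "fock_op g m d \<tau>" "u \<in> Tn r"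
  shows "fv g m (r + p + d) (\<tau> (r + p) (tp r u (dl (grd g (m + int r) p)))) = fv g m (r + d) (\<tau> r u)"
proof (induction p)
  case 0
  have "tp r u (dl []) = u"
    using assms(2) by (auto simp: fun_eq_iff tp_def dl_def Tn_def)
  then show ?case
    by simp
next
  case (Suc p)
  let ?u = "tp r u (dl (grd g (m + int r) p))"
  have "tp r u (dl (grd g (m + int r) (Suc p))) = tp (r + p) ?u (dl [gs g (m + int (r + p))])"
    using grd_add[of g "m + int r" p 1] by (simp add: tp_assoc[symmetric] tp_dl add.assoc)
  moreover have "?u \<in> Tn (r + p)"
    by (intro tp_Tn assms(2) dl_Tn) auto
  then have "fv g m (Suc (r + p) + d) (\<tau> (Suc (r + p)) (tp (r + p) ?u (dl [gs g (m + int (r + p))]))) =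
      fv g m (r + p + d) (\<tau> (r + p) ?u)"
    unfolding fv_def Pz_eq_iff using assms(1) unfolding fock_op_def by blast
  ultimately show ?case
    using Suc by simp
qed

lemma fock_op_ext:
  assumes "fock_op g m d \<tau>" "u \<in> Tn r" "r \<le> t"
  shows "fv g m (t + d) (\<tau> t (Defs.ext g m r t u)) = fv g m (r + d) (\<tau> r u)"
  using fock_op_compat[OF assms(1,2), of "t - r"] assms(3) ext_tp[OF assms(3), of g m u] by simp

text \<open>A linear map on all sequences lets the relations be stated without representatives.
  Well-definedness holds because two tensors with the same embedding agree after extension to a
  common level, and Z is mapped to 0.\<close>

lemma fock_op_linear:
  assumes op: "fock_op g m d \<tau>"
  shows "\<exists>T. lin T \<and> (\<forall>r. \<forall>u\<in>Tn r. T (fv g m r u) = fv g m (r + d) (\<tau> r u))"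
proof -
  have lin: "lin (\<tau> r)" for r
    using op by (simp add: fock_op_def)
  have lin': "lin (\<lambda>u. fv g m (r + d) (\<tau> r u))" for r
    by (rule lin_comp[OF lin_fv lin])
  define W where "W r u = fv g m (r + d) (\<tau> r u)" for r u
  have W_lin: "lin (W r)" for r
    unfolding W_def[abs_def] by (rule lin')
  have W_ext: "W t (Defs.ext g m r t u) = W r u" if "u \<in> Tn r" "r \<le> t" for r t u
    unfolding W_def by (rule fock_op_ext[OF op that])
  have W_unique: "W r u = W s w" if "u \<in> Tn r" "w \<in> Tn s" "emb g m r u = emb g m s w" for r s u w
  proof -
    let ?t = "max r s"
    have "Defs.ext g m r ?t u - Defs.ext g m s ?t w = 0"
      using that by (intro emb_eq_0[of _ ?t g m] vs.subspace_diff Tn_subspace ext_Tn)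
        (auto simp: emb_lin emb_ext)
    then show ?thesis
      using W_ext[OF that(1), of ?t] W_ext[OF that(2), of ?t] by (simp only: max.cobounded1
        max.cobounded2 simp_thms eq_iff_diff_eq_0[symmetric])
  qed
  define S where "S = {emb g m r u | r u. u \<in> Tn r}"
  obtain B where B: "B \<subseteq> S" "vs.independent B" "S \<subseteq> vs.span B"
    using vs.maximal_independent_subset by blast
  have "\<forall>b\<in>B. \<exists>p. snd p \<in> Tn (fst p) \<and> emb g m (fst p) (snd p) = b"
    using B(1) unfolding S_def by fastforce
  then obtain \<rho> where \<rho>: "\<forall>b\<in>B. snd (\<rho> b) \<in> Tn (fst (\<rho> b)) \<and> emb g m (fst (\<rho> b)) (snd (\<rho> b)) = b"
    by metis
  obtain T where T: "lin T" "\<forall>b\<in>B. T b = W (fst (\<rho> b)) (snd (\<rho> b))"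
    using vsp.linear_independent_extend[OF B(2), of "\<lambda>b. W (fst (\<rho> b)) (snd (\<rho> b))"] by blast
  \<comment> \<open>\<open>T\<close> is prescribed only on a basis consisting of embedded tensors.
    Agreement with \<open>W\<close> is carried over to all embedded tensors by showing that it
    defines a subspace.\<close>
  define G where "G = {X. \<exists>r u. u \<in> Tn r \<and> X = emb g m r u \<and> T X = W r u}"
  have "vs.subspace G"
  proof (rule vs.subspaceI)
    have "0 \<in> Tn 0 \<and> 0 = emb g m 0 0 \<and> T 0 = W 0 0"
      by (simp only: Tn_0 emb_lin vsp.linear_0[OF T(1)]
          vsp.linear_0[OF W_lin] simp_thms)
    then show "0 \<in> G"
      unfolding G_def by blast
  next
    fix X Y
    assume "X \<in> G" "Y \<in> G"
    then obtain r u s w where *: "u \<in> Tn r" "X = emb g m r u" "T X = W r u"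
        "w \<in> Tn s" "Y = emb g m s w" "T Y = W s w"
      unfolding G_def by blast
    let ?t = "max r s"
    let ?v = "Defs.ext g m r ?t u + Defs.ext g m s ?t w"
    have "?v \<in> Tn ?t"
      by (intro vs.subspace_add Tn_subspace ext_Tn *) auto
    moreover have "X + Y = emb g m ?t ?v"
      unfolding emb_lin * by (simp add: emb_ext)
    moreover have "T (X + Y) = W ?t ?v"
      unfolding vsp.linear_add[OF T(1)] vsp.linear_add[OF W_lin] *(3,6)
      using W_ext[OF *(1), of ?t] W_ext[OF *(4), of ?t] by simp
    ultimately show "X + Y \<in> G"
      unfolding G_def by blast
  next
    fix c X
    assume "X \<in> G"
    then obtain r u where *: "u \<in> Tn r" "X = emb g m r u" "T X = W r u"
      unfolding G_def by blast
    have "sc c u \<in> Tn r" "sc c X = emb g m r (sc c u)" "T (sc c X) = W r (sc c u)"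
      using * by (simp_all only: Tn_scale emb_lin vsp.linear_scale[OF T(1)]
          vsp.linear_scale[OF W_lin])
    then show "sc c X \<in> G"
      unfolding G_def by blast
  qed
  moreover have "B \<subseteq> G"
    using \<rho> T(2) unfolding G_def by (intro subsetI CollectI) metis
  ultimately have SG: "S \<subseteq> G"
    using B(3) vs.span_minimal by blast
  have T_emb: "T (emb g m r u) = W r u" if u: "u \<in> Tn r" for r u
  proof -
    have "emb g m r u \<in> G"
      using SG u unfolding S_def by blast
    then obtain s w where "w \<in> Tn s" "emb g m r u = emb g m s w" "T (emb g m r u) = W s w"
      unfolding G_def by blast
    then show ?thesis
      using W_unique u by metis
  qed
  have T_Zb: "T X = 0" if X: "X \<in> Zb g m" for X
  proof -
    have "T X \<in> {0}"
      using X T(1) vs.subspace_single_0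
    proof (rule Zb_induct)
      fix t y
      assume y: "y \<in> Nn t"
      have "emb g m (t + d) (\<tau> t y) \<in> Zb g m"
        using op y unfolding fock_op_def by blast
      then show "T (emb g m t y) \<in> {0}"
        unfolding T_emb[OF Nn_Tn[OF y]] W_def fv_def singleton_iff Pz(2) .
    next
      fix r and a :: "bas list" and c
      assume *: "length a = r" "okl a" "okb c" "0 < rho g (m + int r) c"
      have "emb g m (Suc r + d) (\<tau> (Suc r) (dl (a @ [c]))) \<in> Zb g m"
        using op * unfolding fock_op_def by blast
      moreover have "dl (a @ [c]) \<in> Tn (Suc r)"
        using * by (intro dl_Tn) auto
      ultimately show "T (emb g m (Suc r) (dl (a @ [c]))) \<in> {0}"
        using T_emb[of "dl (a @ [c])" "Suc r"] unfolding W_def fv_def singleton_iff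
        by (simp only: Pz(2))
    qed
    then show ?thesis
      by (simp only: singleton_iff)
  qed
  \<comment> \<open>\<open>Pz\<close> changes a vector by an element of Z, which \<open>T\<close>
    kills.\<close>
  have "T (fv g m r u) = W r u" if u: "u \<in> Tn r" for r u
  proof -
    have "emb g m r u - Pz g m (emb g m r u) \<in> Zb g m"
      unfolding Pz(2)[symmetric] by (simp only: Pz_lin Pz(3) diff_self)
    from T_Zb[OF this] show ?thesis
      unfolding vsp.linear_diff[OF T(1)] fv_def T_emb[OF u] by (simp only: eq_iff_diff_eq_0[symmetric])
  qed
  then show ?thesis
    using T(1) unfolding W_def by blast
qed

definition Eh :: "gsch \<Rightarrow> int \<Rightarrow> I \<Rightarrow> seqf \<Rightarrow> seqf" where
  "Eh g m i = (SOME T. lin T \<and> (\<forall>r. \<forall>u\<in>Tn r. T (fv g m r u) = fv g m (r + 0) (Eop i u)))"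

definition Fh :: "gsch \<Rightarrow> int \<Rightarrow> I \<Rightarrow> seqf \<Rightarrow> seqf" where
  "Fh g m i = (SOME T. lin T \<and> (\<forall>r. \<forall>u\<in>Tn r. T (fv g m r u) = fv g m (r + 1) (tF g m i r u)))"

definition Kh :: "gsch \<Rightarrow> int \<Rightarrow> cowt \<Rightarrow> seqf \<Rightarrow> seqf" where
  "Kh g m h = (SOME T. lin T \<and> (\<forall>r. \<forall>u\<in>Tn r. T (fv g m r u) = fv g m (r + 0) (tK g m h r u)))"

lemma lin_Eh: "lin (Eh g m i)" and Eh_fv: "u \<in> Tn r \<Longrightarrow> Eh g m i (fv g m r u) = fv g m r (Eop i u)"
  using someI_ex[OF fock_op_linear[OF fock_op_E[of g m i]]] unfolding Eh_def[symmetric] by auto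

lemma lin_Fh: "lin (Fh g m i)"
  and Fh_fv: "u \<in> Tn r \<Longrightarrow> Fh g m i (fv g m r u) = fv g m (Suc r) (tF g m i r u)"
  using someI_ex[OF fock_op_linear[OF fock_op_F[of g m i]]] unfolding Fh_def[symmetric] by auto

lemma lin_Kh: "lin (Kh g m h)" and Kh_fv: "u \<in> Tn r \<Longrightarrow> Kh g m h (fv g m r u) = fv g m r (tK g m h r u)"
  using someI_ex[OF fock_op_linear[OF fock_op_K[of g m h]]] unfolding Kh_def[symmetric] by auto

definition Vm :: "gsch \<Rightarrow> int \<Rightarrow> seqf set" where
  "Vm g m = {fv g m r u | r u. u \<in> Tn r}"

text \<open>Wedging with \<open>c\<close> on the left, from the Fock space at m + 1 to the one at
  m.\<close>

definition Cm :: "gsch \<Rightarrow> int \<Rightarrow> bas \<Rightarrow> seqf \<Rightarrow> seqf" where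
  "Cm g m c X = Pz g m (Lm 1 (dl [c]) X)"

text \<open>The vector \<open>c\<^sub>1 \<and> \<dots> \<and> c\<^sub>r \<and> |m + r\<rangle>\<close> of the Fock space.\<close>

definition wv :: "gsch \<Rightarrow> int \<Rightarrow> bas list \<Rightarrow> seqf" where
  "wv g m l = fv g m (length l) (dl l)"

lemma lin_Cm: "lin (Cm g m c)"
  unfolding Cm_def[abs_def] by (rule lin_comp[OF Pz(1) lin_Lm])

lemma Lm_fv:
  assumes "v \<in> Tn r"
  shows "Pz g m (Lm r v (fv g (m + int r) s u)) = fv g m (r + s) (tp r v u)"
  unfolding fv_def emb_tp Pz_eq_iff vsp.linear_diff[OF lin_Lm, symmetric]
proof (rule Zb_Lm[OF _ assms])
  show "Pz g (m + int r) (emb g (m + int r) s u) - emb g (m + int r) s u \<in> Zb g (m + int r)"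
    unfolding Pz(2)[symmetric] by (simp only: Pz_lin Pz(3) diff_self)
qed

lemma Cm_fv: "okb c \<Longrightarrow> Cm g m c (fv g (m + 1) s u) = fv g m (Suc s) (tp 1 (dl [c]) u)"
  using Lm_fv[OF dl_Tn[of "[c]" 1], of g m s u] by (simp add: Cm_def)

lemma wv_Cons: "okb c \<Longrightarrow> wv g m (c # l) = Cm g m c (wv g (m + 1) l)"
  unfolding wv_def by (simp add: Cm_fv tp_dl)

lemma wv_Vm: "okl l \<Longrightarrow> wv g m l \<in> Vm g m"
  unfolding wv_def Vm_def by (auto intro!: dl_Tn)

lemma wv_vac: "wv g m [] = Cm g m (gs g m) (wv g (m + 1) [])"
proof -
  have "wv g m [] = wv g m [gs g m]"
    unfolding wv_def fv_def by (simp add: emb_vac[simplified])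
  then show ?thesis
    by (simp add: wv_Cons)
qed

text \<open>The coproduct with one factor split off. This, its analogues for K and F, and the values
  on the vacuum drive the inductions on the number of factors below.\<close>

lemma E_Cm:
  assumes "okb c" "x \<in> Vm g (m + 1)"
  shows "Eh g m i (Cm g m c x) = sc (eco i c) (Cm g m (ece i c) x) +
    sc (qp (- pair (hcor i) (wtb c))) (Cm g m c (Eh g (m + 1) i x))"
proof -
  obtain s u where u: "u \<in> Tn s" "x = fv g (m + 1) s u"
    using assms(2) by (auto simp: Vm_def)
  have "tp 1 (dl [c]) u \<in> Tn (Suc s)"
    using tp_Tn[of "dl [c]" 1 u s] assms(1) u(1) by (simp add: dl_Tn)
  then have "Eh g m i (Cm g m c x) = fv g m (Suc s) (Eop i (tp 1 (dl [c]) u))"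
    by (simp only: u(2) Cm_fv[OF assms(1)] Eh_fv)
  also have "\<dots> = sc (eco i c) (fv g m (Suc s) (tp 1 (dl [ece i c]) u)) +
      sc (qp (- pair (hcor i) (wtb c))) (fv g m (Suc s) (tp 1 (dl [c]) (Eop i u)))"
    by (simp only: Eop_tp Eop_dl1[OF assms(1)] Kop_dl tp_lin fv_lin hw_Cons hw_Nil pair_cneg add_0_right)
  \<comment> \<open>If the coefficient vanishes, \<open>ece i c\<close> may be a junk value outside
    the range of \<open>Cm_fv\<close>.\<close>
  also have "sc (eco i c) (fv g m (Suc s) (tp 1 (dl [ece i c]) u)) = sc (eco i c) (Cm g m (ece i c) x)"
    using ece_ok[OF assms(1)] Cm_fv[of "ece i c" g m s u] u(2) by (cases "eco i c = 0") auto
  also have "fv g m (Suc s) (tp 1 (dl [c]) (Eop i u)) = Cm g m c (Eh g (m + 1) i x)"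
    by (simp only: u(2) Eh_fv[OF u(1)] Cm_fv[OF assms(1)])
  finally show ?thesis .
qed

lemma K_Cm:
  assumes "okb c" "x \<in> Vm g (m + 1)"
  shows "Kh g m h (Cm g m c x) = sc (qp (pair h (wtb c))) (Cm g m c (Kh g (m + 1) h x))"
proof -
  obtain s u where u: "u \<in> Tn s" "x = fv g (m + 1) s u"
    using assms(2) by (auto simp: Vm_def)
  have "tp 1 (dl [c]) u \<in> Tn (Suc s)"
    using tp_Tn[of "dl [c]" 1 u s] assms(1) u(1) by (simp add: dl_Tn)
  then have "Kh g m h (Cm g m c x) = fv g m (Suc s) (tK g m h (Suc s) (tp 1 (dl [c]) u))"
    by (simp only: u(2) Cm_fv[OF assms(1)] Kh_fv)
  also have "tK g m h (Suc s) (tp 1 (dl [c]) u) =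
      sc (qp (pair h (wtb c))) (tp 1 (dl [c]) (tK g (m + 1) h s u))"
    by (simp add: tK_def Kop_tp Kop_dl tp_lin hw_Cons add_ac mult.commute)
  finally show ?thesis
    by (simp only: u(2) Kh_fv[OF u(1)] Cm_fv[OF assms(1)] fv_lin)
qed

lemma F_Cm:
  assumes "okb c" "x \<in> Vm g (m + 1)"
  shows "Fh g m i (Cm g m c x) = sc (fco i c) (Cm g m (fce i c) (Kh g (m + 1) (hcor i) x)) +
    Cm g m c (Fh g (m + 1) i x)"
proof -
  obtain s u where u: "u \<in> Tn s" "x = fv g (m + 1) s u"
    using assms(2) by (auto simp: Vm_def)
  let ?b = "gs g (m + int (Suc s))" and ?k = "kap g (m + int (Suc s)) (hcor i)"
  have "tp 1 (dl [c]) u \<in> Tn (Suc s)"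
    using tp_Tn[of "dl [c]" 1 u s] assms(1) u(1) by (simp add: dl_Tn)
  then have "Fh g m i (Cm g m c x) = fv g m (Suc (Suc s)) (tF g m i (Suc s) (tp 1 (dl [c]) u))"
    by (simp only: u(2) Cm_fv[OF assms(1)] Fh_fv)
  also have "tF g m i (Suc s) (tp 1 (dl [c]) u) =
      tp (Suc s) (tp 1 (sc (fco i c) (dl [fce i c])) (tK g (m + 1) (hcor i) s u)) (dl [?b]) +
      tp 1 (dl [c]) (tF g (m + 1) i s u)"
    unfolding tF_def tK_def Fop_tp Fop_dl1[OF assms(1)] tp_lin
    by (simp add: tp_assoc vs.scale_right_distrib vs.scale_left_commute mult.commute add_ac)
  also have "fv g m (Suc (Suc s)) \<dots> =
      fv g m (Suc s) (tp 1 (sc (fco i c) (dl [fce i c])) (tK g (m + 1) (hcor i) s u)) +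
      fv g m (Suc (Suc s)) (tp 1 (dl [c]) (tF g (m + 1) i s u))"
    unfolding fv_lin(1) by (simp only: fv_def emb_Suc)
  also have "fv g m (Suc s) (tp 1 (sc (fco i c) (dl [fce i c])) (tK g (m + 1) (hcor i) s u)) =
      sc (fco i c) (Cm g m (fce i c) (Kh g (m + 1) (hcor i) x))"
    using fce_ok[OF assms(1)] Cm_fv[of "fce i c" g m s "tK g (m + 1) (hcor i) s u"] Kh_fv[OF u(1)] u(2)
    by (cases "fco i c = 0") (auto simp: tp_lin fv_lin)
  also have "fv g m (Suc (Suc s)) (tp 1 (dl [c]) (tF g (m + 1) i s u)) = Cm g m c (Fh g (m + 1) i x)"
    by (simp only: u(2) Fh_fv[OF u(1)] Cm_fv[OF assms(1)])
  finally show ?thesis .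
qed

lemma E_vac: "Eh g m i (wv g m []) = 0"
proof -
  have "Eop i (dl []) = 0"
    by (auto simp: fun_eq_iff Eop_def atpos_def dl_def intro!: sum.neutral)
  then show ?thesis
    using Eh_fv[OF dl_Tn[of "[]" 0], of g m i] by (simp add: wv_def fv_lin)
qed

lemma K_vac: "Kh g m h (wv g m []) = sc (kap g m h) (wv g m [])"
  using Kh_fv[OF dl_Tn[of "[]" 0], of g m h] by (simp add: wv_def tK_def Kop_dl fv_lin)

lemma F_vac:
  "Fh g m i (wv g m []) = sc (gam g * fco i (gs g m)) (Cm g m (fce i (gs g m)) (wv g (m + 1) []))"
proof -
  have "Fop i (dl []) = 0"
    by (auto simp: fun_eq_iff Fop_def atpos_def dl_def intro!: sum.neutral)
  then have "tF g m i 0 (dl []) = phi g m i"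
    by (simp add: tF_def tp_lin tp_0)
  then have "Fh g m i (wv g m []) = fv g m 1 (phi g m i)"
    using Fh_fv[OF dl_Tn[of "[]" 0], of g m i] by (simp add: wv_def)
  also have "\<dots> = sc (gam g * fco i (gs g m)) (wv g m [fce i (gs g m)])"
    by (simp add: phi_dl fv_lin wv_def)
  also have "\<dots> = sc (gam g * fco i (gs g m)) (Cm g m (fce i (gs g m)) (wv g (m + 1) []))"
    using fce_ok[OF okb_gs, of i g m] wv_Cons[of "fce i (gs g m)" g m "[]"]
    by (cases "fco i (gs g m) = 0") auto
  finally show ?thesis .
qed

section \<open>Quantum \<open>sl\<^sub>2\<close> and the Serre relations\<close>

text \<open>The induction step for the coefficient in \<open>sl2_e_f_pow\<close>. With a = q^n and b
  = q^k it is an identity of rational functions.\<close>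

lemma qi_identity: "qi (int n) * qi (k - int n + 1) + qi (k - 2 * int n) = qi (int n + 1) * qi (k - int n)"
proof -
  define a where "a = qp (int n)"
  define b where "b = qp k"
  define d where "d = qq - inverse qq"
  have nz: "a \<noteq> 0" "b \<noteq> 0" "d \<noteq> 0"
    by (simp_all add: a_def b_def d_def)
  have aa: "qp (2 * int n) = a * a"
    using qp_add[of "int n" "int n"] by (simp add: a_def)
  have eqs: "qi (int n) = (a - inverse a) / d" "qi (k - int n + 1) = (b * qq / a - a / (b * qq)) / d"
    "qi (k - 2 * int n) = (b / (a * a) - a * a / b) / d" "qi (int n + 1) = (a * qq - inverse (a * qq)) / d"
    "qi (k - int n) = (b / a - a / b) / d"
    by (simp_all add: qi_def qp_minus qp_add qp_diff aa a_def[symmetric] b_def[symmetric] d_def[symmetric]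
        del: minus_add_distrib minus_diff_eq)
  have *: "(a - inverse a) * (b * qq / a - a / (b * qq)) + (b / (a * a) - a * a / b) * d =
      (a * qq - inverse (a * qq)) * (b / a - a / b)"
    unfolding d_def using nz(1,2) by (simp add: field_simps)
  have gen: "x / d * (y / d) + z / d = (x * y + z * d) / (d * d)" for x y z
    using nz(3) by (simp add: field_simps)
  show ?thesis
    unfolding eqs gen * by simp
qed

definition serre :: "(seqf \<Rightarrow> seqf) \<Rightarrow> (seqf \<Rightarrow> seqf) \<Rightarrow> seqf \<Rightarrow> seqf" where
  "serre e y x = e (e (e (y x))) - sc (qint 3) (e (e (y (e x)))) + sc (qint 3) (e (y (e (e x)))) -
    y (e (e (e x)))"

lemma lin_serre:
  assumes "lin e" "lin y"
  shows "lin (serre e y)"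
  unfolding serre_def[abs_def]
  by (rule lin_diff lin_plus lin_scale assms lin_comp[OF assms(1)] lin_comp[OF assms(2)])+

text \<open>An integrable module for one copy of quantum sl_2, given by its weight spaces; t_i
  appears only through the index k, by the scalar [k].\<close>

definition sl2 :: "(seqf \<Rightarrow> seqf) \<Rightarrow> (seqf \<Rightarrow> seqf) \<Rightarrow> (int \<Rightarrow> seqf set) \<Rightarrow> bool" where
  "sl2 e f W \<longleftrightarrow> lin e \<and> lin f \<and> (\<forall>k. vs.subspace (W k)) \<and>
    (\<forall>k. \<forall>x\<in>W k. e x \<in> W (k + 2) \<and> f x \<in> W (k - 2) \<and> e (f x) = f (e x) + sc (qi k) x \<and>
      (\<exists>n. (e ^^ n) x = 0) \<and> (\<exists>n. (f ^^ n) x = 0))"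

lemma sl2_dual:
  assumes "sl2 e f W"
  shows "sl2 f e (\<lambda>k. W (- k))"
proof -
  have *: "f x \<in> W (- (k + 2))" "e x \<in> W (- (k - 2))" "f (e x) = e (f x) + sc (qi k) x"
    if "x \<in> W (- k)" for x k
  proof -
    have "f x \<in> W (- k - 2)" "e x \<in> W (- k + 2)" "e (f x) = f (e x) + sc (qi (- k)) x"
      using assms that unfolding sl2_def by blast+
    moreover have "- k - 2 = - (k + 2)" "- k + 2 = - (k - 2)"
      by simp_all
    ultimately have "f x \<in> W (- (k + 2))" "e x \<in> W (- (k - 2))" "e (f x) = f (e x) - sc (qi k) x"
      by (simp_all only: qi_minus vs.scale_minus_left diff_conv_add_uminus)
    then show "f x \<in> W (- (k + 2))" "e x \<in> W (- (k - 2))" "f (e x) = e (f x) + sc (qi k) x"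
      by (simp_all only: diff_add_cancel)
  qed
  then show ?thesis
    using assms unfolding sl2_def by blast
qed

lemma funpow_lin:
  fixes f :: "('a \<Rightarrow> K) \<Rightarrow> 'a \<Rightarrow> K"
  shows "lin f \<Longrightarrow> lin (f ^^ n)"
proof (induction n)
  case 0
  have *: "f ^^ 0 = (\<lambda>x. x)"
    by auto
  show ?case
    unfolding * by (rule linI) (rule refl)+
next
  case (Suc n)
  then show ?case
    using lin_comp[of f "f ^^ n"] by (simp only: funpow.simps o_def)
qed

context
  fixes e f :: "seqf \<Rightarrow> seqf" and W :: "int \<Rightarrow> seqf set"
  assumes sl2: "sl2 e f W"
begin

lemma sl2_lin: "lin e" "lin f"
  using sl2 by (auto simp: sl2_def)

lemmas sl2_simps = lin_simps[OF sl2_lin(1)]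
  lin_simps[OF sl2_lin(2)]

lemma sl2_e: "x \<in> W k \<Longrightarrow> e x \<in> W (k + 2)" and sl2_f: "x \<in> W k \<Longrightarrow> f x \<in> W (k - 2)"
  and sl2_comm: "x \<in> W k \<Longrightarrow> e (f x) = f (e x) + sc (qi k) x"
  and sl2_nil_e: "x \<in> W k \<Longrightarrow> \<exists>n. (e ^^ n) x = 0"
  and sl2_nil_f: "x \<in> W k \<Longrightarrow> \<exists>n. (f ^^ n) x = 0"
  using sl2 unfolding sl2_def by blast+

lemma sl2_f_pow: "x \<in> W k \<Longrightarrow> (f ^^ n) x \<in> W (k - 2 * int n)"
proof (induction n)
  case (Suc n)
  then have "f ((f ^^ n) x) \<in> W (k - 2 * int n - 2)"
    by (intro sl2_f)
  moreover have "k - 2 * int n - 2 = k - 2 * int (Suc n)"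
    by simp
  ultimately show ?case
    by (simp only: funpow.simps o_apply)
qed simp

lemma sl2_e_pow: "x \<in> W k \<Longrightarrow> (e ^^ n) x \<in> W (k + 2 * int n)"
proof (induction n)
  case (Suc n)
  then have "e ((e ^^ n) x) \<in> W (k + 2 * int n + 2)"
    by (intro sl2_e)
  moreover have "k + 2 * int n + 2 = k + 2 * int (Suc n)"
    by simp
  ultimately show ?case
    by (simp only: funpow.simps o_apply)
qed simp

lemma sl2_e_f_pow:
  assumes "x \<in> W k"
  shows "e ((f ^^ Suc n) x) = (f ^^ Suc n) (e x) + sc (qi (int n + 1) * qi (k - int n)) ((f ^^ n) x)"
proof (induction n)
  case 0
  then show ?case
    using sl2_comm[OF assms] by simp
next
  case (Suc n)
  have c: "qi (int n + 1) * qi (k - int n) + qi (k - 2 * int (Suc n)) =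
      qi (int (Suc n) + 1) * qi (k - int (Suc n))"
    using qi_identity[of "Suc n" k] by (simp add: algebra_simps)
  have "e ((f ^^ Suc (Suc n)) x) = f (e ((f ^^ Suc n) x)) + sc (qi (k - 2 * int (Suc n))) ((f ^^ Suc n) x)"
    using sl2_comm[OF sl2_f_pow[OF assms, of "Suc n"]] by simp
  also have "\<dots> = (f ^^ Suc (Suc n)) (e x) +
      (sc (qi (int n + 1) * qi (k - int n)) ((f ^^ Suc n) x) +
       sc (qi (k - 2 * int (Suc n))) ((f ^^ Suc n) x))"
    unfolding Suc sl2_simps by (simp add: add.assoc)
  finally show ?case
    unfolding vs.scale_left_distrib[symmetric] c .
qed

text \<open>On a highest weight vector, \<open>e\<close> takes the (a+1)-st power of
  \<open>f\<close> back to the a-th with factor [a+1] [p-a], which is nonzero as long as a <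
  p.\<close>

lemma sl2_highest_eq_0:
  assumes "x \<in> W p" "e x = 0" "(f ^^ a) x = 0" "int a \<le> p"
  shows "x = 0"
  using assms(3,4)
proof (induction a)
  case (Suc a)
  have "sc (qi (int a + 1) * qi (p - int a)) ((f ^^ a) x) = 0"
    using sl2_e_f_pow[OF assms(1), of a] Suc.prems(1) assms(2) funpow_lin[OF sl2_lin(2), of "Suc a"]
    by (simp only: vsp.linear_0 sl2_simps add.left_neutral)
  moreover have "qi (int a + 1) * qi (p - int a) \<noteq> 0"
    using Suc.prems(2) by (simp add: qi_nz)
  ultimately have "(f ^^ a) x = 0"
    by (simp only: vs.scale_eq_0_iff) simp
  then show ?case
    using Suc by simp
qed simp

text \<open>Induction on the nilpotency index of \<open>e\<close>: applying \<open>e\<close> to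
  f^(a+1) x = 0 shows that f^(a+1) kills \<open>e x\<close>. There the weight p + 2 still admits the
  exponent a + 1, so \<open>e x = 0\<close> and \<open>x\<close> is a highest weight vector.\<close>

lemma sl2_f_pow_inj:
  "x \<in> W p \<Longrightarrow> (e ^^ n) x = 0 \<Longrightarrow> (f ^^ a) x = 0 \<Longrightarrow> int a \<le> p \<Longrightarrow> x = 0"
proof (induction n arbitrary: x p a)
  case (Suc n)
  have "(f ^^ Suc a) x = 0"
    by (simp only: funpow.simps o_apply Suc.prems(3) sl2_simps)
  then have 1: "(f ^^ Suc a) (e x) = 0"
    using sl2_e_f_pow[OF Suc.prems(1), of a] Suc.prems(3)
    by (simp only: sl2_simps vs.scale_zero_right add.right_neutral)
  have 2: "(e ^^ n) (e x) = 0"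
    using Suc.prems(2) by (simp only: funpow_Suc_right o_apply)
  have "e x = 0"
    by (rule Suc.IH[OF sl2_e[OF Suc.prems(1)] 2 1]) (use Suc.prems(4) in simp)
  with Suc.prems show ?case
    using sl2_highest_eq_0 by blast
qed (simp only: funpow_0)

end

context
  fixes e f :: "seqf \<Rightarrow> seqf" and W :: "int \<Rightarrow> seqf set"
  assumes sl2: "sl2 e f W"
begin

lemma sl2_f_e_pow:
  assumes "x \<in> W k"
  shows "f ((e ^^ Suc n) x) = (e ^^ Suc n) (f x) - sc (qi (int n + 1) * qi (k + int n)) ((e ^^ n) x)"
proof -
  have "f ((e ^^ Suc n) x) = (e ^^ Suc n) (f x) + sc (qi (int n + 1) * qi (- k - int n)) ((e ^^ n) x)"
    using sl2_e_f_pow[OF sl2_dual[OF sl2], of x "- k" n] assms by simp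
  moreover have "qi (- k - int n) = - qi (k + int n)"
    using qi_minus[of "k + int n"] by simp
  ultimately show ?thesis
    by simp
qed

text \<open>By induction on the nilpotency index of \<open>e\<close> at
  \<open>x\<close>, \<open>S\<close> vanishes on the submodule generated by \<open>e x\<close>; modulo the latter \<open>x\<close> is a highest weight
  vector, so a power \<open>f\<^sup>b x\<close> small enough for \<open>f\<^sup>b\<close> to be injective on the weight of \<open>S x\<close> is killed.\<close>

lemma sl2_commuting_eq_0:
  fixes S :: "seqf \<Rightarrow> seqf"
  assumes S: "lin S" "\<And>k x. x \<in> W k \<Longrightarrow> S x \<in> W (k + 4)" "\<And>k x. x \<in> W k \<Longrightarrow> f (S x) = S (f x)"
    and x: "x \<in> W k"
  shows "S x = 0"
proof -
  have SW: "S ((f ^^ n) x) = (f ^^ n) (S x)" if "x \<in> W k" for x k n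
    using that
  proof (induction n)
    case (Suc n)
    then show ?case
      using S(3)[OF sl2_f_pow[OF sl2 Suc.prems, of n]] by simp
  qed simp
  have "(e ^^ n) x = 0 \<Longrightarrow> x \<in> W k \<Longrightarrow> S x = 0" for n k x
  proof (induction n arbitrary: k x)
    case 0
    then have "x = 0"
      by (simp only: funpow_0)
    then show ?case
      by (simp only: vsp.linear_0[OF S(1)])
  next
    case (Suc n)
    note x = Suc.prems(2)
    \<comment> \<open>The weight vectors in \<open>D\<close> stay in \<open>D\<close> under
      \<open>e\<close> and \<open>f\<close>, so it serves as a submodule on which \<open>S\<close>
      vanishes. It contains \<open>e x\<close> by the induction hypothesis.\<close>
    define D where "D = {z. \<forall>j. S ((e ^^ j) z) = 0}"
    have D_e: "e z \<in> D" if "z \<in> D" for z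
    proof -
      have "S ((e ^^ Suc j) z) = 0" for j
        using that unfolding D_def by blast
      then show ?thesis
        unfolding D_def by (simp only: funpow_Suc_right o_apply mem_Collect_eq simp_thms)
    qed
    have D_f: "f z \<in> D" if z: "z \<in> D" "z \<in> W p" for z p
    proof -
      have "S ((e ^^ j) (f z)) = 0" for j
      proof (cases j)
        case 0
        have "S z = S ((e ^^ 0) z)"
          by simp
        also have "\<dots> = 0"
          using z(1) unfolding D_def by blast
        finally show ?thesis
          using S(3)[OF z(2)] 0 by (simp add: sl2_simps[OF sl2])
      next
        case (Suc j')
        have "(e ^^ Suc j') (f z) = f ((e ^^ Suc j') z) + sc (qi (int j' + 1) * qi (p + int j')) ((e ^^ j') z)"
          using sl2_f_e_pow[OF z(2), of j'] by simp
        moreover have "S ((e ^^ Suc j') z) = 0" "S ((e ^^ j') z) = 0"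
          using z(1) unfolding D_def by blast+
        ultimately show ?thesis
          using S(3)[OF sl2_e_pow[OF sl2 z(2), of "Suc j'"]] Suc
          by (simp only: vsp.linear_add[OF S(1)] vsp.linear_scale[OF S(1)]) (simp add: sl2_simps[OF sl2])
      qed
      then show ?thesis
        unfolding D_def by blast
    qed
    have D_sub: "vs.subspace D"
      unfolding D_def
    proof (rule vs.subspaceI)
      have "lin (\<lambda>z. S ((e ^^ j) z))" for j
        by (rule lin_comp[OF S(1) funpow_lin[OF sl2_lin(1)[OF sl2]]])
      then show "0 \<in> {z. \<forall>j. S ((e ^^ j) z) = 0}"
        and "\<And>x y. x \<in> {z. \<forall>j. S ((e ^^ j) z) = 0} \<Longrightarrow> y \<in> {z. \<forall>j. S ((e ^^ j) z) = 0} \<Longrightarrow>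
          x + y \<in> {z. \<forall>j. S ((e ^^ j) z) = 0}"
        and "\<And>c x. x \<in> {z. \<forall>j. S ((e ^^ j) z) = 0} \<Longrightarrow> sc c x \<in> {z. \<forall>j. S ((e ^^ j) z) = 0}"
        by (simp_all add: vsp.linear_0[of "\<lambda>z. S ((e ^^ _) z)"] vsp.linear_add[of "\<lambda>z. S ((e ^^ _) z)"]
            vsp.linear_scale[of "\<lambda>z. S ((e ^^ _) z)"])
    qed
    have ex: "e x \<in> D"
    proof -
      have "S ((e ^^ j) (e x)) = 0" for j
      proof (rule Suc.IH)
        have "(e ^^ n) ((e ^^ j) (e x)) = (e ^^ j) ((e ^^ Suc n) x)"
          by (simp only: funpow_Suc_right o_apply funpow_add[symmetric, THEN fun_cong, unfolded o_apply] add.commute)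
        then show "(e ^^ n) ((e ^^ j) (e x)) = 0"
          unfolding Suc.prems(1) by (simp only: vsp.linear_0[OF funpow_lin[OF sl2_lin(1)[OF sl2]]])
        show "(e ^^ j) (e x) \<in> W (k + 2 + 2 * int j)"
          by (intro sl2_e_pow[OF sl2] sl2_e[OF sl2] x)
      qed
      then show ?thesis
        unfolding D_def by blast
    qed
    have fex: "(f ^^ b) (e x) \<in> D" for b
    proof (induction b)
      case (Suc b)
      then show ?case
        using D_f[OF _ sl2_f_pow[OF sl2 sl2_e[OF sl2 x]]] by simp
    qed (simp add: ex)
    \<comment> \<open>Modulo \<open>D\<close> the vector \<open>x\<close> is a highest weight
      vector, so \<open>e\<close> leads back from f^(b+1) x to f^b x unless the factor [k-b] is
      zero.\<close>
    have descend: "(f ^^ b) x \<in> D" if "(f ^^ Suc b) x \<in> D" "int b \<noteq> k" for b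
    proof -
      have "sc (qi (int b + 1) * qi (k - int b)) ((f ^^ b) x) = e ((f ^^ Suc b) x) - (f ^^ Suc b) (e x)"
        using sl2_e_f_pow[OF sl2 x, of b] by simp
      also have "\<dots> \<in> D"
        by (intro vs.subspace_diff[OF D_sub] D_e that(1) fex)
      finally have *: "sc (qi (int b + 1) * qi (k - int b)) ((f ^^ b) x) \<in> D" .
      have "qi (int b + 1) * qi (k - int b) \<noteq> 0"
        using that(2) by (simp add: qi_nz)
      then have "inverse (qi (int b + 1) * qi (k - int b)) * (qi (int b + 1) * qi (k - int b)) = 1"
        by (rule left_inverse)
      then show ?thesis
        using vs.subspace_scale[OF D_sub *, of "inverse (qi (int b + 1) * qi (k - int b))"]
        by (simp only: vs.scale_scale vs.scale_one)
    qed
    have descend_to: "(f ^^ b) x \<in> D" if "(f ^^ (b + p)) x \<in> D" "\<And>j. b \<le> j \<Longrightarrow> j < b + p \<Longrightarrow> int j \<noteq> k" for b p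
      using that
    proof (induction p)
      case (Suc p)
      have "(f ^^ (b + p)) x \<in> D"
        by (rule descend) (use Suc.prems(1) Suc.prems(2)[of "b + p"] in simp_all)
      then show ?case
        by (rule Suc.IH) (use Suc.prems(2) in simp)
    qed simp
    obtain N where N: "(f ^^ N) x = 0"
      using sl2_nil_f[OF sl2 x] by blast
    have ND: "(f ^^ N) x \<in> D"
      unfolding N by (rule vs.subspace_0[OF D_sub])
    show "S x = 0"
    proof (cases "k < 0 \<or> int N \<le> k")
      case True
      then have "(f ^^ 0) x \<in> D"
        using ND by (intro descend_to[of 0 N]) auto
      then have "S ((e ^^ 0) x) = 0"
        unfolding D_def by (simp only: funpow_0 mem_Collect_eq) (metis funpow_0)
      then show ?thesis
        by simp
    next
      case False
      \<comment> \<open>The descent from f^N x = 0 is blocked exactly at the exponent k and stops at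
        k + 1. Since \<open>S x\<close> has weight k + 4, the power k + 1 of \<open>f\<close> is
        still injective there.\<close>
      define b where "b = nat k + 1"
      have "b + (N - b) = N"
        using False unfolding b_def by linarith
      then have "(f ^^ (b + (N - b))) x \<in> D"
        using ND by (simp only:)
      then have "(f ^^ b) x \<in> D"
        by (rule descend_to) (auto simp: b_def)
      then have "S ((e ^^ 0) ((f ^^ b) x)) = 0"
        unfolding D_def by blast
      then have 1: "(f ^^ b) (S x) = 0"
        using SW[OF x, of b] by simp
      obtain n where 2: "(e ^^ n) (S x) = 0"
        using sl2_nil_e[OF sl2 S(2)[OF x]] by blast
      have "int b \<le> k + 4"
        using False unfolding b_def by linarith
      then show ?thesis
        by (rule sl2_f_pow_inj[OF sl2 S(2)[OF x] 2 1])
    qed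
  qed
  then show ?thesis
    using x sl2_nil_e[OF sl2] by blast
qed

text \<open>The Serre element has weight 3 * 2 - 2 = 4. It commutes with \<open>f\<close> because
  the corrections from moving \<open>f\<close> through its four terms cancel in pairs.\<close>

lemma sl2_serre:
  assumes y: "lin y" "\<And>k x. x \<in> W k \<Longrightarrow> y x \<in> W (k - 2)" "\<And>k x. x \<in> W k \<Longrightarrow> f (y x) = y (f x)"
    and x: "x \<in> W k"
  shows "serre e y x = 0"
proof -
  note lins = sl2_simps[OF sl2] vsp.linear_add[OF y(1)] vsp.linear_scale[OF y(1)] vsp.linear_diff[OF y(1)]
  have fe1: "f (e z) = e (f z) - sc (qi p) z" if "z \<in> W p" for z p
    using sl2_f_e_pow[OF that, of 0] by simp
  have fe2: "f (e (e z)) = e (e (f z)) - sc (qi 2 * qi (p + 1)) (e z)" if "z \<in> W p" for z p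
    using sl2_f_e_pow[OF that, of 1] by (simp add: numeral_2_eq_2)
  have fe3: "f (e (e (e z))) = e (e (e (f z))) - sc (qi 3 * qi (p + 2)) (e (e z))" if "z \<in> W p" for z p
    using sl2_f_e_pow[OF that, of 2] by (simp add: numeral_2_eq_2)
  show ?thesis
  proof (rule sl2_commuting_eq_0[where S = "serre e y" and x = x and k = k])
    show "lin (serre e y)"
      by (rule lin_serre[OF sl2_lin(1)[OF sl2] y(1)])
  next
    fix k x
    assume x: "x \<in> W k"
    have sub: "vs.subspace (W j)" for j
      using sl2 by (simp add: sl2_def)
    have m: "e (e (e (y x))) \<in> W (k - 2 + 2 + 2 + 2)" "e (e (y (e x))) \<in> W (k + 2 - 2 + 2 + 2)"
      "e (y (e (e x))) \<in> W (k + 2 + 2 - 2 + 2)" "y (e (e (e x))) \<in> W (k + 2 + 2 + 2 - 2)"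
      by (intro sl2_e[OF sl2] y x)+
    have "k - 2 + 2 + 2 + 2 = k + 4" "k + 2 - 2 + 2 + 2 = k + 4" "k + 2 + 2 - 2 + 2 = k + 4"
      "k + 2 + 2 + 2 - 2 = k + 4"
      by simp_all
    note m = m[unfolded this]
    show "serre e y x \<in> W (k + 4)"
      unfolding serre_def
      by (intro vs.subspace_add[OF sub] vs.subspace_diff[OF sub] vs.subspace_scale[OF sub] m)
    have yx: "y x \<in> W (k - 2)" "y (e x) \<in> W k" "y (e (e x)) \<in> W (k + 2)"
      using y(2)[OF x] y(2)[OF sl2_e[OF sl2 x]] y(2)[OF sl2_e[OF sl2 sl2_e[OF sl2 x]]]
      by (simp_all add: add.commute)
    have ex: "e x \<in> W (k + 2)" "e (e x) \<in> W (k + 4)" "e (e (e x)) \<in> W (k + 6)"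
      using sl2_e[OF sl2 x] sl2_e[OF sl2 sl2_e[OF sl2 x]] sl2_e[OF sl2 sl2_e[OF sl2 sl2_e[OF sl2 x]]]
      by (simp_all add: add.commute)
    have 1: "f (e (e (e (y x)))) = e (e (e (y (f x)))) - sc (qi 3 * qi k) (e (e (y x)))"
      using fe3[OF yx(1)] y(3)[OF x] by simp
    have 2: "f (e (e (y (e x)))) = e (e (y (e (f x)))) - sc (qi k) (e (e (y x))) -
        sc (qi 2 * qi (k + 1)) (e (y (e x)))"
      unfolding fe2[OF yx(2)] y(3)[OF ex(1)] fe1[OF x] lins ..
    have 3: "f (e (y (e (e x)))) = e (y (e (e (f x)))) - sc (qi 2 * qi (k + 1)) (e (y (e x))) -
        sc (qi (k + 2)) (y (e (e x)))"
      unfolding fe1[OF yx(3)] y(3)[OF ex(2)] fe2[OF x] lins ..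
    have 4: "f (y (e (e (e x)))) = y (e (e (e (f x)))) - sc (qi 3 * qi (k + 2)) (y (e (e x)))"
      unfolding y(3)[OF ex(3)] fe3[OF x] lins ..
    have q3: "qint 3 = qi 3"
      by (simp only: qint_qi of_nat_numeral)
    show "f (serre e y x) = serre e y (f x)"
      unfolding serre_def lins 1 2 3 4 q3 by (simp add: fun_eq_iff algebra_simps)
  qed (rule x)
qed

end

section \<open>Relations in the Fock spaces\<close>

definition wtw :: "gsch \<Rightarrow> int \<Rightarrow> bas list \<Rightarrow> cowt \<Rightarrow> int" where
  "wtw g m l h = pair h (lam g (m + int (length l))) + hw h l"

lemma K_wv: "okl l \<Longrightarrow> Kh g m h (wv g m l) = sc (qp (wtw g m l h)) (wv g m l)"
  using Kh_fv[OF dl_Tn[of l "length l"], of g m h]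
  by (simp add: wv_def tK_def Kop_dl fv_lin vs.scale_scale kap_def wtw_def qp_add)

lemma wtw_Cons: "wtw g m (c # l) h = pair h (wtb c) + wtw g (m + 1) l h"
  by (simp add: wtw_def hw_Cons add_ac)

lemma fv_expand:
  assumes "u \<in> Tn r"
  shows "fv g m r u = (\<Sum>l | u l \<noteq> 0. sc (u l) (wv g m l))"
  unfolding Tn_lin_expand[OF assms lin_fv] wv_def
  by (intro sum.cong) (use Tn_support[OF assms] in auto)

lemma fv_Vm: "u \<in> Tn r \<Longrightarrow> fv g m r u \<in> Vm g m"
  by (auto simp: Vm_def)

lemma Vm_E: "x \<in> Vm g m \<Longrightarrow> (\<And>r u. u \<in> Tn r \<Longrightarrow> x = fv g m r u \<Longrightarrow> P) \<Longrightarrow> P"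
  by (auto simp: Vm_def)

lemma Vm_into:
  assumes "x \<in> Vm g m" "lin f" "vs.subspace S" "\<And>l. okl l \<Longrightarrow> f (wv g m l) \<in> S"
  shows "f x \<in> S"
proof -
  obtain r u where u: "u \<in> Tn r" "x = fv g m r u"
    using assms(1) by (rule Vm_E)
  have "f (fv g m r u) \<in> S"
    unfolding fv_expand[OF u(1)] vsp.linear_sum[OF assms(2)] vsp.linear_scale[OF assms(2)]
    by (intro vs.subspace_sum vs.subspace_scale assms(3,4)) (use Tn_support[OF u(1)] in blast)
  then show ?thesis
    by (simp only: u(2))
qed

lemma Vm_eqI:
  assumes "x \<in> Vm g m" "lin f" "lin f'" "\<And>l. okl l \<Longrightarrow> f (wv g m l) = f' (wv g m l)"
  shows "f x = f' x"
proof -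
  have "f x - f' x \<in> {0}"
    by (rule Vm_into[OF assms(1) lin_diff[OF assms(2,3)] vs.subspace_single_0]) (simp add: assms(4))
  then show ?thesis
    by simp
qed

lemma Vm_subspace: "vs.subspace (Vm g m)"
proof (rule vs.subspaceI)
  show "0 \<in> Vm g m"
    using fv_Vm[OF Tn_0, of g m 0] by (simp only: fv_lin)
next
  fix x y
  assume "x \<in> Vm g m" "y \<in> Vm g m"
  then obtain r u s w where *: "u \<in> Tn r" "x = fv g m r u" "w \<in> Tn s" "y = fv g m s w"
    by (auto elim!: Vm_E)
  let ?t = "max r s"
  have "x + y = fv g m ?t (Defs.ext g m r ?t u + Defs.ext g m s ?t w)"
    unfolding fv_lin * by (simp add: fv_def emb_ext)
  then show "x + y \<in> Vm g m"
    using fv_Vm[OF Tn_add[OF ext_Tn[OF *(1), of ?t] ext_Tn[OF *(3), of ?t]]]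
    by simp
next
  fix c x
  assume "x \<in> Vm g m"
  then obtain r u where *: "u \<in> Tn r" "x = fv g m r u"
    by (rule Vm_E)
  then show "sc c x \<in> Vm g m"
    using fv_Vm[OF Tn_scale[OF *(1)], of g m c] by (simp only: fv_lin)
qed

lemma Eh_Vm: "x \<in> Vm g m \<Longrightarrow> Eh g m i x \<in> Vm g m"
  by (elim Vm_E) (simp add: Eh_fv Eop_Tn fv_Vm)

lemma tF_Tn: "u \<in> Tn r \<Longrightarrow> tF g m i r u \<in> Tn (Suc r)"
  using fock_op_F[of g m i] by (auto simp: fock_op_def)

lemma tK_Tn: "u \<in> Tn r \<Longrightarrow> tK g m h r u \<in> Tn r"
  using fock_op_K[of g m h] by (auto simp: fock_op_def)

lemma Fh_Vm: "x \<in> Vm g m \<Longrightarrow> Fh g m i x \<in> Vm g m"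
  by (elim Vm_E) (simp add: Fh_fv tF_Tn fv_Vm)

lemmas Eh_lin = lin_simps[OF lin_Eh]
lemmas Fh_lin = lin_simps[OF lin_Fh]
lemmas Kh_lin = lin_simps[OF lin_Kh]
lemmas Cm_lin = lin_simps[OF lin_Cm]

lemma pair_ece: "okb c \<Longrightarrow> eco i c \<noteq> 0 \<Longrightarrow> pair h (wtb (ece i c)) = pair h (wtb c) + pair h (alpha i)"
  by (cases i; erule okb_cases) (auto simp: pair_def wtb_def algebra_simps)

lemma pair_fce: "okb c \<Longrightarrow> fco i c \<noteq> 0 \<Longrightarrow> pair h (wtb (fce i c)) = pair h (wtb c) - pair h (alpha i)"
  by (cases i; erule okb_cases) (auto simp: pair_def wtb_def algebra_simps)

lemma pair_hcor_alpha: "pair (hcor i) (alpha j) = pair (hcor j) (alpha i)"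
  by (cases i; cases j) (simp_all add: pair_def)

lemma K_E_wv:
  "okl l \<Longrightarrow> Kh g m h (Eh g m i (wv g m l)) = sc (qp (pair h (alpha i))) (Eh g m i (Kh g m h (wv g m l)))"
proof (induction l arbitrary: m)
  case Nil
  show ?case
    unfolding K_vac Eh_lin E_vac Kh_lin vs.scale_zero_right ..
next
  case (Cons c l)
  let ?x = "wv g (m + 1) l"
  have ok: "okb c" "okl l" and x: "?x \<in> Vm g (m + 1)"
    using Cons.prems by (auto intro: wv_Vm)
  have "sc (eco i c) (Kh g m h (Cm g m (ece i c) ?x)) =
      sc (qp (pair h (alpha i)) * qp (pair h (wtb c)) * eco i c) (Cm g m (ece i c) (Kh g (m + 1) h ?x))"
    using K_Cm[OF ece_ok[OF ok(1)] x, of i h] pair_ece[OF ok(1), of i h]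
    by (cases "eco i c = 0") (simp_all add: vs.scale_scale qp_add mult_ac)
  then have "Kh g m h (Eh g m i (Cm g m c ?x)) = sc (qp (pair h (alpha i)) * qp (wtw g m (c # l) h))
      (Eh g m i (Cm g m c ?x))"
    unfolding E_Cm[OF ok(1) x] Kh_lin K_Cm[OF ok(1) Eh_Vm[OF x]] Cons.IH[OF ok(2)] K_wv[OF ok(2)]
    by (simp add: Eh_lin Cm_lin vs.scale_scale vs.scale_right_distrib wtw_Cons qp_add mult_ac)
  then show ?case
    unfolding K_wv[OF Cons.prems] Eh_lin vs.scale_scale unfolding wv_Cons[OF ok(1)] .
qed

lemma K_F_wv:
  "okl l \<Longrightarrow> Kh g m h (Fh g m i (wv g m l)) = sc (qp (- pair h (alpha i))) (Fh g m i (Kh g m h (wv g m l)))"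
proof (induction l arbitrary: m)
  case Nil
  let ?b = "gs g m" and ?x = "wv g (m + 1) []"
  have x: "?x \<in> Vm g (m + 1)"
    by (rule wv_Vm) simp
  show ?case
    unfolding K_vac Fh_lin F_vac Kh_lin
    using K_Cm[OF fce_ok[OF okb_gs[of g m], of i] x, of h] pair_fce[OF okb_gs[of g m], of i h]
    by (cases "fco i ?b = 0")
      (simp_all add: K_vac Cm_lin vs.scale_scale kap_rec[of g m] qp_diff qp_minus divide_inverse mult_ac)
next
  case (Cons c l)
  let ?x = "wv g (m + 1) l"
  have ok: "okb c" "okl l" and x: "?x \<in> Vm g (m + 1)"
    using Cons.prems by (auto intro: wv_Vm)
  have "sc (fco i c) (Kh g m h (Cm g m (fce i c) ?x)) =
      sc (qp (- pair h (alpha i)) * qp (pair h (wtb c)) * fco i c) (Cm g m (fce i c) (Kh g (m + 1) h ?x))"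
    using K_Cm[OF fce_ok[OF ok(1)] x, of i h] pair_fce[OF ok(1), of i h]
    by (cases "fco i c = 0") (simp_all add: vs.scale_scale qp_diff qp_minus divide_inverse mult_ac)
  note fK = this
  have "Kh g m h (Fh g m i (Cm g m c ?x)) = sc (qp (- pair h (alpha i)) * qp (wtw g m (c # l) h))
      (Fh g m i (Cm g m c ?x))"
    unfolding F_Cm[OF ok(1) x] Kh_lin K_Cm[OF ok(1) Fh_Vm[OF x]] Cons.IH[OF ok(2)] K_wv[OF ok(2)]
      Cm_lin vs.scale_left_commute[of "fco i c"] fK
    by (simp add: Fh_lin Cm_lin vs.scale_scale vs.scale_right_distrib wtw_Cons qp_add mult_ac)
  then show ?case
    unfolding K_wv[OF Cons.prems] Fh_lin vs.scale_scale unfolding wv_Cons[OF ok(1)] .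
qed

lemma K_E: "x \<in> Vm g m \<Longrightarrow> Kh g m h (Eh g m i x) = sc (qp (pair h (alpha i))) (Eh g m i (Kh g m h x))"
  by (erule Vm_eqI[OF _ lin_comp[OF lin_Kh lin_Eh] lin_scale[OF lin_comp[OF lin_Eh lin_Kh]]])
    (rule K_E_wv)

lemma K_F: "x \<in> Vm g m \<Longrightarrow> Kh g m h (Fh g m i x) = sc (qp (- pair h (alpha i))) (Fh g m i (Kh g m h x))"
  by (erule Vm_eqI[OF _ lin_comp[OF lin_Kh lin_Fh] lin_scale[OF lin_comp[OF lin_Fh lin_Kh]]])
    (rule K_F_wv)

lemma wtw_cadd: "wtw g m l (cadd h h') = wtw g m l h + wtw g m l h'"
  by (simp add: wtw_def hw_cadd pair_cadd)

lemma wtw_cneg: "wtw g m l (cneg h) = - wtw g m l h"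
  by (simp add: wtw_def hw_cneg pair_cneg)

lemma K_K: "x \<in> Vm g m \<Longrightarrow> Kh g m h (Kh g m h' x) = Kh g m (cadd h h') x"
  by (erule Vm_eqI[OF _ lin_comp[OF lin_Kh lin_Kh] lin_Kh])
    (simp add: K_wv Kh_lin vs.scale_scale wtw_cadd qp_add mult.commute)

lemma wtw_0: "wtw g m l (0, 0, 0) = 0"
  by (induction l arbitrary: m) (simp_all add: wtw_Cons pair_def, simp add: wtw_def pair_def)

lemma K_0: "x \<in> Vm g m \<Longrightarrow> Kh g m (0, 0, 0) x = x"
  using Vm_eqI[of x g m "Kh g m (0, 0, 0)" "\<lambda>x. x"] lin_Kh
  by (simp add: K_wv wtw_0 linI)

lemma eco_fco_commute:
  assumes "okb c" "i \<noteq> j"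
  shows "fco j c * eco i (fce j c) = eco i c * fco j (ece i c)"
    "fco j c * eco i (fce j c) \<noteq> 0 \<Longrightarrow> ece i (fce j c) = fce j (ece i c)"
  using assms by (cases i; cases j; elim okb_cases; simp add: numeral_2_eq_2[symmetric])+

lemma eco_fco_diagonal:
  assumes "okb c"
  shows "fco i c * eco i (fce i c) - eco i c * fco i (ece i c) = qi (pair (hcor i) (wtb c))"
    "fco i c * eco i (fce i c) \<noteq> 0 \<Longrightarrow> ece i (fce i c) = c"
    "eco i c * fco i (ece i c) \<noteq> 0 \<Longrightarrow> fce i (ece i c) = c"
  using assms
  by (cases i; elim okb_cases;
      simp add: pair_def wtb_def qi_2 qi_minus numeral_2_eq_2[symmetric] numeral_3_eq_3[symmetric])+

text \<open>The commutator on V_aff itself. \<open>G\<close> is an arbitrary map on basis elements,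
  so the result applies to c \<and> x, and junk values occur only with coefficient 0.\<close>

lemma E_F_site:
  assumes "okb c"
  shows "sc (fco j c * eco i (fce j c)) (G (ece i (fce j c))) -
    sc (eco i c * fco j (ece i c)) (G (fce j (ece i c))) =
    (if i = j then sc (qi (pair (hcor i) (wtb c))) (G c) else (0 :: seqf))"
proof (cases "i = j")
  case True
  have "sc (fco i c * eco i (fce i c)) (G (ece i (fce i c))) = sc (fco i c * eco i (fce i c)) (G c)"
    using eco_fco_diagonal(2)[OF assms, of i] by (cases "fco i c * eco i (fce i c) = 0") auto
  moreover have "sc (eco i c * fco i (ece i c)) (G (fce i (ece i c))) = sc (eco i c * fco i (ece i c)) (G c)"
    using eco_fco_diagonal(3)[OF assms, of i] by (cases "eco i c * fco i (ece i c) = 0") auto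
  ultimately show ?thesis
    using True by (simp only: vs.scale_left_diff_distrib[symmetric] eco_fco_diagonal(1)[OF assms] simp_thms if_True)
next
  case False
  have "sc (fco j c * eco i (fce j c)) (G (ece i (fce j c))) =
      sc (eco i c * fco j (ece i c)) (G (fce j (ece i c)))"
    using eco_fco_commute[OF assms False] by (cases "fco j c * eco i (fce j c) = 0") auto
  then show ?thesis
    using False by (simp only: diff_self if_False)
qed

lemma qi_add: "qp k * qi w + qp (- w) * qi k = qi (w + k)"
  by (simp add: qi_def qp_add qp_minus qp_diff divide_inverse algebra_simps)

lemma wv_bad:
  assumes "okb c" "0 < rho g m c"
  shows "Cm g m c (wv g (m + 1) []) = 0"
  unfolding wv_Cons[OF assms(1), symmetric] unfolding wv_def fv_def Pz(2) using Zb_bad1[OF assms] by simp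

text \<open>\<open>e_i\<close> annihilates the vacuum, so only \<open>e_i f_j\<close> counts. For i
  \<noteq> j its coefficient vanishes or the resulting vector has positive rank; for i = j the
  choice of \<open>gam\<close> yields the quantum integer of the weight.\<close>

lemma E_F_vac:
  "Eh g m i (Fh g m j (wv g m [])) - Fh g m j (Eh g m i (wv g m [])) =
    (if i = j then sc (qi (pair (hcor i) (lam g m))) (wv g m []) else 0)"
proof -
  let ?b = "gs g m" and ?x = "wv g (m + 1) []"
  have x: "?x \<in> Vm g (m + 1)"
    by (rule wv_Vm) simp
  have "Eh g m i (Fh g m j (wv g m [])) =
      sc (gam g * fco j ?b * eco i (fce j ?b)) (Cm g m (ece i (fce j ?b)) ?x)"
    using E_Cm[OF fce_ok[OF okb_gs[of g m], of j] x, of i]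
    by (cases "fco j ?b = 0") (simp_all add: F_vac Eh_lin E_vac Cm_lin vs.scale_scale)
  also have "\<dots> = (if i = j then sc (qi (pair (hcor i) (lam g m))) (Cm g m ?b ?x) else 0)"
    using wv_bad[of "ece i (fce j ?b)" g m]
    by (cases g; cases i; cases j; cases "even m")
      (simp_all add: gam_def pair_def qi_2 numeral_2_eq_2[symmetric])
  finally show ?thesis
    by (simp only: E_vac Fh_lin diff_zero wv_vac[symmetric])
qed

lemma E_F_wv:
  "okl l \<Longrightarrow> Eh g m i (Fh g m j (wv g m l)) - Fh g m j (Eh g m i (wv g m l)) =
    (if i = j then sc (qi (wtw g m l (hcor i))) (wv g m l) else 0)"
proof (induction l arbitrary: m)
  case Nil
  show ?case
    unfolding E_F_vac by (simp add: wtw_def)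
next
  case (Cons c l)
  let ?x = "wv g (m + 1) l"
  define k where "k = qp (wtw g (m + 1) l (hcor j))"
  define p where "p = qp (- pair (hcor i) (wtb c))"
  define s where "s = qp (pair (hcor i) (alpha j))"
  let ?E = "Eh g (m + 1) i ?x" and ?F = "Fh g (m + 1) j ?x" and ?A = "Cm g m"
  have ok: "okb c" "okl l" and x: "?x \<in> Vm g (m + 1)"
    using Cons.prems by (auto intro: wv_Vm)
  have Kx: "Kh g (m + 1) (hcor j) ?x = sc k ?x"
    unfolding k_def by (rule K_wv[OF ok(2)])
  have KE: "Kh g (m + 1) (hcor j) ?E = sc (s * k) ?E"
    unfolding K_E[OF x] Kx Eh_lin s_def by (simp add: vs.scale_scale pair_hcor_alpha)
  have 1: "sc (fco j c) (Eh g m i (?A (fce j c) ?x)) =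
      sc (fco j c * eco i (fce j c)) (?A (ece i (fce j c)) ?x) + sc (fco j c * p * s) (?A (fce j c) ?E)"
    using E_Cm[OF fce_ok[OF ok(1)] x, of j i] pair_fce[OF ok(1), of j "hcor i"]
    by (cases "fco j c = 0")
      (simp_all add: vs.scale_scale vs.scale_right_distrib p_def s_def qp_diff qp_minus divide_inverse mult_ac)
  have 2: "sc (eco i c) (Fh g m j (?A (ece i c) ?x)) =
      sc (eco i c * fco j (ece i c)) (?A (fce j (ece i c)) (sc k ?x)) + sc (eco i c) (?A (ece i c) ?F)"
    using F_Cm[OF ece_ok[OF ok(1)] x, of i j] Kx
    by (cases "eco i c = 0") (simp_all add: vs.scale_scale vs.scale_right_distrib)
  have EF: "Eh g m i (Fh g m j (?A c ?x)) =
      sc k (sc (fco j c * eco i (fce j c)) (?A (ece i (fce j c)) ?x) + sc (fco j c * p * s) (?A (fce j c) ?E)) +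
      (sc (eco i c) (?A (ece i c) ?F) + sc p (?A c (Eh g (m + 1) i ?F)))"
    unfolding F_Cm[OF ok(1) x] Kx Cm_lin Eh_lin E_Cm[OF ok(1) Fh_Vm[OF x]] p_def[symmetric]
      vs.scale_left_commute[of "fco j c" k] 1 ..
  have FE: "Fh g m j (Eh g m i (?A c ?x)) =
      sc (eco i c * fco j (ece i c)) (?A (fce j (ece i c)) (sc k ?x)) + sc (eco i c) (?A (ece i c) ?F) +
      sc p (sc (fco j c) (?A (fce j c) (sc (s * k) ?E)) + ?A c (Fh g (m + 1) j ?E))"
    unfolding E_Cm[OF ok(1) x] Fh_lin F_Cm[OF ok(1) Eh_Vm[OF x]] KE 2 p_def ..
  \<comment> \<open>The mixed terms cancel: moving t_j past \<open>e_i\<close> and t_i^-1 past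
    \<open>f_j\<close> gives the same factor \<open>s\<close>.\<close>
  have "Eh g m i (Fh g m j (?A c ?x)) - Fh g m j (Eh g m i (?A c ?x)) =
      sc k (sc (fco j c * eco i (fce j c)) (?A (ece i (fce j c)) ?x) -
        sc (eco i c * fco j (ece i c)) (?A (fce j (ece i c)) ?x)) +
      sc p (?A c (Eh g (m + 1) i ?F - Fh g (m + 1) j ?E))"
    unfolding EF FE Cm_lin by (simp add: fun_eq_iff algebra_simps)
  also have "\<dots> = (if i = j then sc (qi (wtw g m (c # l) (hcor i))) (?A c ?x) else 0)"
    unfolding E_F_site[OF ok(1), of j i "\<lambda>c. ?A c ?x"] Cons.IH[OF ok(2)]
    by (cases "i = j")
      (simp_all add: Cm_lin vs.scale_scale vs.scale_left_distrib[symmetric] k_def p_def qi_add wtw_Cons)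
  finally show ?case
    by (simp only: wv_Cons[OF ok(1)])
qed

lemma E_F:
  assumes "x \<in> Vm g m"
  shows "Eh g m i (Fh g m j x) - Fh g m j (Eh g m i x) =
    (if i = j then sc (inverse (qq - inverse qq)) (Kh g m (hcor i) x - Kh g m (cneg (hcor i)) x) else 0)"
proof -
  have lin: "lin (\<lambda>x. Eh g m i (Fh g m j x) - Fh g m j (Eh g m i x))"
    by (intro lin_diff lin_comp[OF lin_Eh lin_Fh] lin_comp[OF lin_Fh lin_Eh])
  show ?thesis
  proof (cases "i = j")
    case True
    have "Eh g m i (Fh g m j x) - Fh g m j (Eh g m i x) =
        sc (inverse (qq - inverse qq)) (Kh g m (hcor i) x - Kh g m (cneg (hcor i)) x)"
      using assms lin lin_scale[OF lin_diff[OF lin_Kh lin_Kh]]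
    proof (rule Vm_eqI)
      fix l
      assume "okl l"
      then show "Eh g m i (Fh g m j (wv g m l)) - Fh g m j (Eh g m i (wv g m l)) =
          sc (inverse (qq - inverse qq)) (Kh g m (hcor i) (wv g m l) - Kh g m (cneg (hcor i)) (wv g m l))"
        by (simp add: E_F_wv K_wv True wtw_cneg qi_def vs.scale_left_diff_distrib[symmetric]
            vs.scale_scale divide_inverse mult.commute)
    qed
    with True show ?thesis
      by simp
  next
    case False
    have "Eh g m i (Fh g m j x) - Fh g m j (Eh g m i x) \<in> {0}"
      using assms lin vs.subspace_single_0 by (rule Vm_into) (simp add: E_F_wv False)
    with False show ?thesis
      by simp
  qed
qed

section \<open>Local nilpotency\<close>

text \<open>Each application of \<open>D\<close> lowers either the degree \<open>p\<close> of the
  first factor or the nilpotency index of the rest, so n + p c applications suffice.\<close>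

lemma nilpotent_Cm:
  fixes D D' :: "seqf \<Rightarrow> seqf" and C :: "bas \<Rightarrow> seqf \<Rightarrow> seqf" and p :: "bas \<Rightarrow> nat"
  assumes lin: "lin D" "lin D'" "\<And>c. lin (C c)"
    and D: "\<And>c x. okb c \<Longrightarrow> Q x \<Longrightarrow> \<exists>a b. D (C c x) = sc a (C (t c) x) + sc b (C c (D' x)) \<and>
      (a \<noteq> 0 \<longrightarrow> okb (t c) \<and> p (t c) < p c)"
    and Q: "\<And>x. Q x \<Longrightarrow> Q (D' x)"
  shows "okb c \<Longrightarrow> Q x \<Longrightarrow> (D' ^^ n) x = 0 \<Longrightarrow> (D ^^ (n + p c)) (C c x) = 0"
proof (induction "n + p c" arbitrary: n c x rule: less_induct)
  case less
  note linD = funpow_lin[OF lin(1)]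
  have mono: "(D ^^ j) y = 0" if "(D ^^ i) y = 0" "i \<le> j" for i j y
  proof -
    have "(D ^^ j) y = (D ^^ (j - i)) ((D ^^ i) y)"
      using that(2) funpow_add[of "j - i" i D] by simp
    then show ?thesis
      unfolding that(1) by (simp only: vsp.linear_0[OF linD])
  qed
  show ?case
  proof (cases n)
    case 0
    then have "x = 0"
      using less.prems(3) by (simp only: funpow_0)
    then show ?thesis
      by (simp only: vsp.linear_0[OF lin(3)] vsp.linear_0[OF linD])
  next
    case (Suc n')
    obtain a b where ab: "D (C c x) = sc a (C (t c) x) + sc b (C c (D' x))"
      "a \<noteq> 0 \<longrightarrow> okb (t c) \<and> p (t c) < p c"
      using D[OF less.prems(1,2)] by blast
    have 1: "sc a ((D ^^ (n' + p c)) (C (t c) x)) = 0"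
    proof (cases "a = 0")
      case False
      then have t: "okb (t c)" "p (t c) < p c"
        using ab(2) by auto
      then have "(D ^^ (n + p (t c))) (C (t c) x) = 0"
        using less.hyps[of n "t c" x] less.prems by simp
      then have "(D ^^ (n' + p c)) (C (t c) x) = 0"
        by (rule mono) (use t Suc in simp)
      then show ?thesis
        by (simp only: vs.scale_zero_right)
    qed simp
    have "(D' ^^ n') (D' x) = 0"
      using less.prems(3) Suc by (simp only: funpow_Suc_right o_apply)
    then have 2: "(D ^^ (n' + p c)) (C c (D' x)) = 0"
      by (intro less.hyps) (use less.prems Q Suc in simp_all)
    have "(D ^^ (n + p c)) (C c x) = (D ^^ (n' + p c)) (D (C c x))"
      by (simp only: Suc add_Suc funpow_Suc_right o_apply)
    also have "\<dots> = sc a ((D ^^ (n' + p c)) (C (t c) x)) + sc b ((D ^^ (n' + p c)) (C c (D' x)))"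
      by (simp only: ab(1) vsp.linear_add[OF linD] vsp.linear_scale[OF linD])
    also have "\<dots> = 0"
      by (simp only: 1 2 vs.scale_zero_right add_0_left)
    finally show ?thesis .
  qed
qed

fun edeg :: "I \<Rightarrow> bas \<Rightarrow> nat" where
  "edeg i1 (a, j) = j + 1"
| "edeg i0 (a, j) = 3 - j"

fun fdeg :: "I \<Rightarrow> bas \<Rightarrow> nat" where
  "fdeg i1 (a, j) = 3 - j"
| "fdeg i0 (a, j) = j + 1"

lemma edeg_ece: "okb c \<Longrightarrow> eco i c \<noteq> 0 \<Longrightarrow> edeg i (ece i c) < edeg i c"
  by (cases i; erule okb_cases) auto

lemma fdeg_fce: "okb c \<Longrightarrow> fco i c \<noteq> 0 \<Longrightarrow> fdeg i (fce i c) < fdeg i c"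
  by (cases i; erule okb_cases) auto

lemma Eh_nil_Cm:
  assumes "okb c" "x \<in> Vm g (m + 1)" "(Eh g (m + 1) i ^^ n) x = 0"
  shows "(Eh g m i ^^ (n + edeg i c)) (Cm g m c x) = 0"
proof (rule nilpotent_Cm[where Q = "\<lambda>x. x \<in> Vm g (m + 1)" and t = "ece i", OF lin_Eh lin_Eh lin_Cm])
  fix c x
  assume "okb c" "x \<in> Vm g (m + 1)"
  then show "\<exists>a b. Eh g m i (Cm g m c x) = sc a (Cm g m (ece i c) x) + sc b (Cm g m c (Eh g (m + 1) i x)) \<and>
      (a \<noteq> 0 \<longrightarrow> okb (ece i c) \<and> edeg i (ece i c) < edeg i c)"
    using E_Cm ece_ok edeg_ece by blast
qed (use assms Eh_Vm in auto)

text \<open>\<open>x\<close> has to be an eigenvector of t_i, because the coproduct of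
  \<open>f_i\<close> applies t_i to the factors on the right.\<close>

lemma Fh_nil_Cm:
  assumes "okb c" "x \<in> Vm g (m + 1)" "\<exists>k. Kh g (m + 1) (hcor i) x = sc k x" "(Fh g (m + 1) i ^^ n) x = 0"
  shows "(Fh g m i ^^ (n + fdeg i c)) (Cm g m c x) = 0"
proof (rule nilpotent_Cm[where Q = "\<lambda>x. x \<in> Vm g (m + 1) \<and> (\<exists>k. Kh g (m + 1) (hcor i) x = sc k x)"
      and t = "fce i", OF lin_Fh lin_Fh lin_Cm])
  fix c x
  assume c: "okb c" and x: "x \<in> Vm g (m + 1) \<and> (\<exists>k. Kh g (m + 1) (hcor i) x = sc k x)"
  then obtain k where k: "Kh g (m + 1) (hcor i) x = sc k x"
    by blast
  have "Fh g m i (Cm g m c x) = sc (fco i c * k) (Cm g m (fce i c) x) + sc 1 (Cm g m c (Fh g (m + 1) i x))"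
    using F_Cm[OF c, of x g m i] x by (simp add: k Cm_lin vs.scale_scale)
  then show "\<exists>a b. Fh g m i (Cm g m c x) = sc a (Cm g m (fce i c) x) + sc b (Cm g m c (Fh g (m + 1) i x)) \<and>
      (a \<noteq> 0 \<longrightarrow> okb (fce i c) \<and> fdeg i (fce i c) < fdeg i c)"
    using fce_ok[OF c] fdeg_fce[OF c] by (metis mult_zero_left)
next
  fix x
  assume x: "x \<in> Vm g (m + 1) \<and> (\<exists>k. Kh g (m + 1) (hcor i) x = sc k x)"
  then obtain k where k: "Kh g (m + 1) (hcor i) x = sc k x"
    by blast
  have "Kh g (m + 1) (hcor i) (Fh g (m + 1) i x) =
      sc (qp (- pair (hcor i) (alpha i)) * k) (Fh g (m + 1) i x)"
    using K_F[of x g "m + 1" "hcor i" i] x by (simp only: k Fh_lin vs.scale_scale)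
  then show "Fh g (m + 1) i x \<in> Vm g (m + 1) \<and>
      (\<exists>k. Kh g (m + 1) (hcor i) (Fh g (m + 1) i x) = sc k (Fh g (m + 1) i x))"
    using x Fh_Vm by blast
qed (use assms in auto)

text \<open>In case (A) the next vacuum is killed by \<open>f_i\<close> whenever the first ground
  state vector is not, so \<open>Fh_nil_Cm\<close> applies. In case (B) that recursion would never
  end; instead \<open>f_i\<close> applied twice gives a multiple of d \<and> d, and d \<otimes> d
  lies in N.\<close>

lemma F_vac_nil: "\<exists>n. (Fh g m i ^^ n) (wv g m []) = 0"
proof (cases "g = GS_A")
  case True
  show ?thesis
  proof (cases "fco i (gs g m) = 0")
    case zero: True
    have "(Fh g m i ^^ 1) (wv g m []) = 0"
      by (simp add: F_vac zero)
    then show ?thesis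
      by blast
  next
    case False
    then have "fco i (gs g (m + 1)) = 0"
      using True by (cases i; cases "even m") auto
    then have "(Fh g (m + 1) i ^^ 1) (wv g (m + 1) []) = 0"
      by (simp add: F_vac)
    moreover have "\<exists>k. Kh g (m + 1) (hcor i) (wv g (m + 1) []) = sc k (wv g (m + 1) [])"
      using K_vac by blast
    moreover have "wv g (m + 1) [] \<in> Vm g (m + 1)"
      by (rule wv_Vm) simp
    ultimately show ?thesis
      unfolding wv_vac[of g m] using Fh_nil_Cm[OF okb_gs[of g m]] by blast
  qed
next
  case False
  then have g: "g = GS_B"
    by (cases g) auto
  define d where "d = fce i (0, 1)"
  have d: "okb d" "d = (0, 2) \<or> d = (- 1, 0)" "fco i d = 0"
    by (cases i; simp add: d_def numeral_2_eq_2)+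
  have b: "gs g m = (0, 1)" for m
    using g by simp
  have "dl [d, d] \<in> Nsp"
    using str_Nsp[OF d(1,1)] d(2) by auto
  then have dd: "Cm g m d (Cm g (m + 1) d (wv g (m + 2) [])) = 0"
  proof -
    assume "dl [d, d] \<in> Nsp"
    then have "emb g m (length [d, d]) (dl [d, d]) \<in> Zb g m"
      using Zb_Nn[OF Nsp_Nn] by (simp add: numeral_2_eq_2)
    then have "wv g m [d, d] = 0"
      unfolding wv_def fv_def Pz(2) .
    moreover have "m + 1 + 1 = m + 2"
      by simp
    ultimately show ?thesis
      by (simp only: wv_Cons[OF d(1)])
  qed
  have "Fh g m i (Fh g m i (wv g m [])) = 0"
    unfolding F_vac b d_def[symmetric] Fh_lin F_Cm[OF d(1) wv_Vm[of "[]", simplified]] d(3)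
    using dd by (simp add: Cm_lin add.assoc)
  then have "(Fh g m i ^^ 2) (wv g m []) = 0"
    by (simp add: numeral_2_eq_2)
  then show ?thesis
    by blast
qed

lemma nil_wv:
  "okl l \<Longrightarrow> \<exists>n. (Eh g m i ^^ n) (wv g m l) = 0"
  "okl l \<Longrightarrow> \<exists>n. (Fh g m i ^^ n) (wv g m l) = 0"
proof (induction l arbitrary: m)
  case Nil
  {
    case 1
    have "(Eh g m i ^^ 1) (wv g m []) = 0"
      by (simp add: E_vac)
    then show ?case
      by blast
  next
    case 2
    show ?case
      by (rule F_vac_nil)
  }
next
  case (Cons c l)
  {
    case 1
    then show ?case
      using Cons.IH(1)[of "m + 1"] Eh_nil_Cm[of c "wv g (m + 1) l"] wv_Vm[of l] wv_Cons[of c]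
      by (metis list.set_intros)
  next
    case 2
    then show ?case
      using Cons.IH(2)[of "m + 1"] Fh_nil_Cm[of c "wv g (m + 1) l"] wv_Vm[of l] wv_Cons[of c] K_wv[of l]
      by (metis list.set_intros)
  }
qed

lemma nil_subspace:
  fixes D :: "seqf \<Rightarrow> seqf"
  assumes "lin D"
  shows "vs.subspace {x. \<exists>n. (D ^^ n) x = (0 :: seqf)}"
proof (rule vs.subspaceI)
  have "(D ^^ 0) 0 = (0 :: seqf)"
    by (rule funpow_0)
  then show "0 \<in> {x. \<exists>n. (D ^^ n) x = 0}"
    by blast
next
  fix x y
  assume "x \<in> {x. \<exists>n. (D ^^ n) x = 0}" "y \<in> {x. \<exists>n. (D ^^ n) x = 0}"
  then obtain n p where np: "(D ^^ n) x = 0" "(D ^^ p) y = 0"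
    by blast
  have "(D ^^ (n + p)) (x + y) = (D ^^ (p + n)) x + (D ^^ (n + p)) y"
    by (simp only: vsp.linear_add[OF funpow_lin[OF assms]] add.commute)
  also have "\<dots> = 0"
    by (simp only: funpow_add o_apply np vsp.linear_0[OF funpow_lin[OF assms]] add_0_left)
  finally show "x + y \<in> {x. \<exists>n. (D ^^ n) x = 0}"
    by blast
next
  fix c x
  assume "x \<in> {x. \<exists>n. (D ^^ n) x = 0}"
  then obtain n where "(D ^^ n) x = 0"
    by blast
  then have "(D ^^ n) (sc c x) = 0"
    by (simp only: vsp.linear_scale[OF funpow_lin[OF assms]] vs.scale_zero_right)
  then show "sc c x \<in> {x. \<exists>n. (D ^^ n) x = 0}"
    by blast
qed

lemma nil_Vm:
  assumes "x \<in> Vm g m"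
  shows "\<exists>n. (Eh g m i ^^ n) x = 0" "\<exists>n. (Fh g m i ^^ n) x = 0"
proof -
  have "lin (\<lambda>x :: seqf. x)"
    by (rule linI) (rule refl)+
  from Vm_into[OF assms this nil_subspace[OF lin_Eh]] Vm_into[OF assms this nil_subspace[OF lin_Fh]]
  show "\<exists>n. (Eh g m i ^^ n) x = 0" "\<exists>n. (Fh g m i ^^ n) x = 0"
    using nil_wv by blast+
qed

definition Wk :: "gsch \<Rightarrow> int \<Rightarrow> I \<Rightarrow> int \<Rightarrow> seqf set" where
  "Wk g m i k = {x \<in> Vm g m. Kh g m (hcor i) x = sc (qp k) x}"

lemma Wk_wv: "okl l \<Longrightarrow> wv g m l \<in> Wk g m i (wtw g m l (hcor i))"
  by (simp add: Wk_def wv_Vm K_wv)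

lemma Wk_Eh: "x \<in> Wk g m i k \<Longrightarrow> Eh g m j x \<in> Wk g m i (k + pair (hcor i) (alpha j))"
  by (auto simp: Wk_def Eh_Vm K_E Eh_lin vs.scale_scale qp_add mult.commute)

lemma Wk_Fh: "x \<in> Wk g m i k \<Longrightarrow> Fh g m j x \<in> Wk g m i (k - pair (hcor i) (alpha j))"
  by (auto simp: Wk_def Fh_Vm K_F Fh_lin vs.scale_scale qp_minus qp_diff divide_inverse mult.commute)

lemma Wk_subspace: "vs.subspace (Wk g m i k)"
proof -
  have "vs.subspace {x. Kh g m (hcor i) x - sc (qp k) x = 0}"
    using vsp.linear_subspace_kernel[of "\<lambda>x. Kh g m (hcor i) x - sc (qp k) x"]
      lin_diff[OF lin_Kh lin_scale[of "\<lambda>x. x" "qp k"]] by (simp add: linI)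
  from vs.subspace_inter[OF Vm_subspace this, of g m] show ?thesis
    by (simp add: Wk_def Int_def)
qed

lemma Kh_cneg_Wk:
  assumes "x \<in> Wk g m i k"
  shows "Kh g m (cneg (hcor i)) x = sc (qp (- k)) x"
proof -
  have x: "x \<in> Vm g m" "Kh g m (hcor i) x = sc (qp k) x"
    using assms by (auto simp: Wk_def)
  have "cadd (cneg (hcor i)) (hcor i) = (0, 0, 0)"
    by (cases i) (simp_all add: cadd_def cneg_def)
  then have "sc (qp k) (Kh g m (cneg (hcor i)) x) = x"
    using K_K[OF x(1), of "cneg (hcor i)" "hcor i"] K_0[OF x(1)] by (simp only: x(2) Kh_lin)
  then have "sc (qp (- k)) x = sc (qp (- k)) (sc (qp k) (Kh g m (cneg (hcor i)) x))"
    by (simp only:)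
  then show ?thesis
    by (simp add: vs.scale_scale qp_minus)
qed

lemma sl2_Vm: "sl2 (Eh g m i) (Fh g m i) (Wk g m i)"
proof -
  have a: "pair (hcor i) (alpha i) = 2"
    by (cases i) (simp_all add: pair_def)
  have "Eh g m i (Fh g m i x) = Fh g m i (Eh g m i x) + sc (qi k) x" if "x \<in> Wk g m i k" for x k
  proof -
    have x: "x \<in> Vm g m" "Kh g m (hcor i) x = sc (qp k) x"
      using that by (auto simp: Wk_def)
    have "Eh g m i (Fh g m i x) - Fh g m i (Eh g m i x) = sc (qi k) x"
      using E_F[OF x(1), of i i] x(2) Kh_cneg_Wk[OF that]
      by (simp add: vs.scale_left_diff_distrib[symmetric] vs.scale_scale qi_def divide_inverse mult.commute)
    then show ?thesis
      by (simp only: diff_eq_eq add.commute)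
  qed
  note comm = this
  have V: "x \<in> Vm g m" if "x \<in> Wk g m i k" for x k
    using that by (simp add: Wk_def)
  show ?thesis
    unfolding sl2_def
  proof (intro conjI allI ballI)
    fix k x
    assume x: "x \<in> Wk g m i k"
    show "Eh g m i x \<in> Wk g m i (k + 2)" "Fh g m i x \<in> Wk g m i (k - 2)"
      using Wk_Eh[OF x, of i] Wk_Fh[OF x, of i] unfolding a .
    show "\<exists>n. (Eh g m i ^^ n) x = 0" "\<exists>n. (Fh g m i ^^ n) x = 0"
      by (rule nil_Vm[OF V[OF x]])+
  qed (rule lin_Eh lin_Fh Wk_subspace comm, assumption?)+
qed

text \<open>\<open>e_j\<close> commutes with \<open>f_i\<close> and lowers the weight for
  \<open>h_i\<close> by 2, so it can play the part of \<open>y\<close> in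
  \<open>sl2_serre\<close>.\<close>

lemma serre_E:
  assumes "x \<in> Vm g m" "i \<noteq> j"
  shows "serre (Eh g m i) (Eh g m j) x = 0"
proof -
  have a: "k + pair (hcor i) (alpha j) = k - 2" for k
    using assms(2) by (cases i; cases j) (simp_all add: pair_def)
  have *: "Eh g m j y \<in> Wk g m i (k - 2)" "Fh g m i (Eh g m j y) = Eh g m j (Fh g m i y)"
    if "y \<in> Wk g m i k" for y k
    using Wk_Eh[OF that, of j] E_F[of y g m j i] assms(2) that by (simp_all add: a Wk_def)
  have "serre (Eh g m i) (Eh g m j) x \<in> {0}"
    using assms(1) lin_serre[OF lin_Eh lin_Eh] vs.subspace_single_0
    by (rule Vm_into) (simp only: singleton_iff sl2_serre[OF sl2_Vm lin_Eh * Wk_wv])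
  then show ?thesis
    by (simp only: singleton_iff)
qed

lemma serre_F:
  assumes "x \<in> Vm g m" "i \<noteq> j"
  shows "serre (Fh g m i) (Fh g m j) x = 0"
proof -
  have a: "- k - pair (hcor i) (alpha j) = - (k - 2)" for k
    using assms(2) by (cases i; cases j) (simp_all add: pair_def)
  have *: "Fh g m j y \<in> Wk g m i (- (k - 2))" "Eh g m i (Fh g m j y) = Fh g m j (Eh g m i y)"
    if "y \<in> Wk g m i (- k)" for y k
    using Wk_Fh[OF that, of j] E_F[of y g m i j] assms(2) that by (simp_all add: a Wk_def)
  have wv: "wv g m l \<in> Wk g m i (- (- wtw g m l (hcor i)))" if "okl l" for l
    using Wk_wv[OF that] by simp
  have "serre (Fh g m i) (Fh g m j) x \<in> {0}"
    using assms(1) lin_serre[OF lin_Fh lin_Fh] vs.subspace_single_0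
    by (rule Vm_into) (simp only: singleton_iff sl2_serre[OF sl2_dual[OF sl2_Vm] lin_Fh * wv])
  then show ?thesis
    by (simp only: singleton_iff)
qed

section \<open>The module structure\<close>

definition vr :: "gsch \<Rightarrow> int \<Rightarrow> rep \<Rightarrow> seqf" where
  "vr g m a = fv g m (fst a) (snd a)"

lemma validrep_0: "validrep (0, \<lambda>l. 0)"
  using Tn_0[ of 0] by (simp add: validrep_def zero_fun_def)

lemma validrep_radd: "validrep a \<Longrightarrow> validrep b \<Longrightarrow> validrep (radd g m a b)"
  using Tn_add[OF ext_Tn[of "snd a" "fst a" "max (fst a) (fst b)" g m]
      ext_Tn[of "snd b" "fst b" "max (fst a) (fst b)" g m]]
  by (simp add: validrep_def radd_def plus_fun_def)

lemma validrep_rsmult: "validrep a \<Longrightarrow> validrep (rsmult c a)"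
  using Tn_scale[ of "snd a" "fst a" c]
  by (simp add: validrep_def rsmult_def sc_def)

lemma validrep_lc: "(\<And>c a. (c, a) \<in> set xs \<Longrightarrow> validrep a) \<Longrightarrow> validrep (lc g m xs)"
  by (induction g m xs rule: lc.induct) (auto intro!: validrep_0 validrep_radd validrep_rsmult)

text \<open>No projection is applied here, because convergence is a statement modulo q^n L and not
  modulo Z.\<close>

definition er :: "gsch \<Rightarrow> int \<Rightarrow> rep \<Rightarrow> seqf" where
  "er g m a = emb g m (fst a) (snd a)"

lemma er_radd: "er g m (radd g m a b) = er g m a + er g m b"
proof -
  have *: "snd (radd g m a b) = Defs.ext g m (fst a) (max (fst a) (fst b)) (snd a) +
      Defs.ext g m (fst b) (max (fst a) (fst b)) (snd b)"
    by (simp add: radd_def plus_fun_def)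
  show ?thesis
    unfolding er_def * by (simp add: radd_def emb_lin emb_ext)
qed

lemma er_rsmult: "er g m (rsmult c a) = sc c (er g m a)"
proof -
  have *: "snd (rsmult c a) = sc c (snd a)"
    by (simp add: rsmult_def sc_def)
  show ?thesis
    unfolding er_def * by (simp add: rsmult_def emb_lin)
qed

lemma er_0: "er g m (0, \<lambda>l. 0) = 0"
  unfolding er_def by (simp add: emb_lin(3)[unfolded zero_fun_def[where 'a = "bas list"]])

lemma er_lc: "er g m (lc g m xs) = (\<Sum>(c, a)\<leftarrow>xs. sc c (er g m a))"
proof (induction xs)
  case Nil
  show ?case
    by (simp only: lc.simps er_0 list.map sum_list.Nil)
next
  case (Cons p xs)
  obtain c a where p: "p = (c, a)"
    by (cases p)
  show ?case
    by (simp only: p lc.simps er_radd er_rsmult Cons list.map sum_list.Cons prod.case)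
qed

lemma vr_er: "vr g m a = Pz g m (er g m a)"
  by (simp add: vr_def er_def fv_def)

lemma vr_radd: "vr g m (radd g m a b) = vr g m a + vr g m b"
  by (simp only: vr_er er_radd Pz_lin)

lemma vr_rsmult: "vr g m (rsmult c a) = sc c (vr g m a)"
  by (simp only: vr_er er_rsmult Pz_lin)

lemma vr_0: "vr g m (0, \<lambda>l. 0) = 0"
  by (simp only: vr_er er_0 Pz_lin)

lemma vr_lc: "vr g m (lc g m xs) = (\<Sum>(c, a)\<leftarrow>xs. sc c (vr g m a))"
  unfolding vr_er er_lc
  by (induction xs) (simp_all only: list.map sum_list.Nil sum_list.Cons Pz_lin case_prod_unfold)

lemma fnull_vr: "validrep a \<Longrightarrow> fnull g m a \<longleftrightarrow> vr g m a = 0"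
  using fnull_iff[of "snd a" "fst a" g m] by (simp only: validrep_def vr_def fv_def Pz(2) prod.collapse)

lemma feq_vr:
  assumes "validrep a" "validrep b"
  shows "feq g m a b \<longleftrightarrow> vr g m a = vr g m b"
proof -
  have "validrep (lc g m [(1, a), (- 1, b)])"
    using assms by (intro validrep_lc) auto
  then have "feq g m a b \<longleftrightarrow> vr g m (lc g m [(1, a), (- 1, b)]) = 0"
    unfolding feq_def by (rule fnull_vr)
  also have "vr g m (lc g m [(1, a), (- 1, b)]) = vr g m a - vr g m b"
    unfolding vr_lc by simp
  finally show ?thesis
    by (simp only: right_minus_eq)
qed

lemma vr_Vm: "validrep a \<Longrightarrow> vr g m a \<in> Vm g m"
  by (simp add: vr_def validrep_def fv_Vm)

definition opE :: "gsch \<Rightarrow> int \<Rightarrow> I \<Rightarrow> rep \<Rightarrow> rep" where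
  "opE g m i a = (fst a, Eop i (snd a))"

definition opF :: "gsch \<Rightarrow> int \<Rightarrow> I \<Rightarrow> rep \<Rightarrow> rep" where
  "opF g m i a = (Suc (fst a), tF g m i (fst a) (snd a))"

definition opK :: "gsch \<Rightarrow> int \<Rightarrow> cowt \<Rightarrow> rep \<Rightarrow> rep" where
  "opK g m h a = (fst a, tK g m h (fst a) (snd a))"

lemma valid_ops:
  assumes "validrep a"
  shows "validrep (opE g m i a)" "validrep (opF g m i a)" "validrep (opK g m h a)"
  using assms by (simp_all add: validrep_def opE_def opF_def opK_def Eop_Tn tF_Tn tK_Tn)

lemma vr_ops:
  assumes "validrep a"
  shows "vr g m (opE g m i a) = Eh g m i (vr g m a)"
    "vr g m (opF g m i a) = Fh g m i (vr g m a)"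
    "vr g m (opK g m h a) = Kh g m h (vr g m a)"
  using assms by (simp_all add: validrep_def vr_def opE_def opF_def opK_def Eh_fv Fh_fv Kh_fv)

lemma well_defined_linearI:
  assumes T: "\<And>a. validrep a \<Longrightarrow> validrep (T a)" "\<And>a. validrep a \<Longrightarrow> vr g m (T a) = L (vr g m a)" "lin L"
  shows "well_defined_linear g m T"
  unfolding well_defined_linear_def
  by (simp add: feq_vr T validrep_radd validrep_rsmult vr_radd vr_rsmult
      vsp.linear_add[OF T(3)] vsp.linear_scale[OF T(3)])

lemma fnull_serre:
  assumes T: "\<And>k a. validrep a \<Longrightarrow> validrep (T k a)" "\<And>k a. validrep a \<Longrightarrow> vr g m (T k a) = L k (vr g m a)"
    and a: "validrep a" "serre (L i) (L j) (vr g m a) = 0"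
  shows "fnull g m (lc g m [(1, T i (T i (T i (T j a)))), (- qint 3, T i (T i (T j (T i a)))),
    (qint 3, T i (T j (T i (T i a)))), (- 1, T j (T i (T i (T i a))))])" (is "fnull g m ?l")
proof -
  have "validrep ?l"
    by (intro validrep_lc) (auto simp: T a)
  moreover have "vr g m ?l = serre (L i) (L j) (vr g m a)"
    by (simp add: vr_lc T a(1) serre_def algebra_simps del: qint_simps lc.simps)
  ultimately show ?thesis
    by (simp only: fnull_vr a(2))
qed

lemma Uq_module_ops: "Uq_module g m (opE g m) (opF g m) (opK g m)"
  unfolding Uq_module_def
proof (intro conjI allI impI)
  show "well_defined_linear g m (opE g m i)" for i
    using valid_ops(1) vr_ops(1) lin_Eh by (rule well_defined_linearI)
  show "well_defined_linear g m (opF g m i)" for i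
    using valid_ops(2) vr_ops(2) lin_Fh by (rule well_defined_linearI)
  show "well_defined_linear g m (opK g m h)" for h
    using valid_ops(3) vr_ops(3) lin_Kh by (rule well_defined_linearI)
next
  fix a
  assume a: "validrep a"
  have V: "vr g m a \<in> Vm g m"
    by (rule vr_Vm[OF a])
  note simps = feq_vr fnull_vr vr_ops valid_ops validrep_rsmult vr_rsmult a
  show "feq g m (opK g m (0, 0, 0) a) a"
    by (simp add: simps K_0[OF V])
  show "feq g m (opK g m h (opK g m h' a)) (opK g m (cadd h h') a)" for h h'
    by (simp add: simps K_K[OF V])
  show "feq g m (opK g m h (opE g m i a)) (rsmult (qp (pair h (alpha i))) (opE g m i (opK g m h a)))" for h i
    by (simp only: simps K_E[OF V])
  show "feq g m (opK g m h (opF g m i a)) (rsmult (qp (- pair h (alpha i))) (opF g m i (opK g m h a)))" for h i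
    by (simp only: simps K_F[OF V])
  show "feq g m (lc g m [(1, opE g m i (opF g m j a)), (- 1, opF g m j (opE g m i a))])
      (if i = j then lc g m [(inverse (qq - inverse qq), opK g m (hcor i) a),
        (- inverse (qq - inverse qq), opK g m (cneg (hcor i)) a)] else (0, \<lambda>l. 0))" for i j
  proof -
    have "validrep (lc g m [(1, opE g m i (opF g m j a)), (- 1, opF g m j (opE g m i a))])"
      "validrep (lc g m [(inverse (qq - inverse qq), opK g m (hcor i) a),
        (- inverse (qq - inverse qq), opK g m (cneg (hcor i)) a)])"
      by (intro validrep_lc; auto simp: simps)+
    moreover have "vr g m (lc g m [(1, opE g m i (opF g m j a)), (- 1, opF g m j (opE g m i a))]) =
        Eh g m i (Fh g m j (vr g m a)) - Fh g m j (Eh g m i (vr g m a))"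
      by (simp add: vr_lc simps del: lc.simps)
    moreover have "vr g m (lc g m [(inverse (qq - inverse qq), opK g m (hcor i) a),
        (- inverse (qq - inverse qq), opK g m (cneg (hcor i)) a)]) =
        sc (inverse (qq - inverse qq)) (Kh g m (hcor i) (vr g m a) - Kh g m (cneg (hcor i)) (vr g m a))"
      by (simp add: vr_lc simps vs.scale_right_diff_distrib del: lc.simps)
    ultimately show ?thesis
      using E_F[OF V, of i j] by (simp only: feq_vr validrep_0 vr_0 split: if_split) simp
  qed
  fix i j :: I
  assume ij: "i \<noteq> j"
  show "fnull g m (lc g m [(1, opE g m i (opE g m i (opE g m i (opE g m j a)))),
      (- qint 3, opE g m i (opE g m i (opE g m j (opE g m i a)))),
      (qint 3, opE g m i (opE g m j (opE g m i (opE g m i a)))),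
      (- 1, opE g m j (opE g m i (opE g m i (opE g m i a))))])"
    by (rule fnull_serre[OF valid_ops(1) vr_ops(1) a serre_E[OF V ij]])
  show "fnull g m (lc g m [(1, opF g m i (opF g m i (opF g m i (opF g m j a)))),
      (- qint 3, opF g m i (opF g m i (opF g m j (opF g m i a)))),
      (qint 3, opF g m i (opF g m j (opF g m i (opF g m i a)))),
      (- 1, opF g m j (opF g m i (opF g m i (opF g m i a))))])"
    by (rule fnull_serre[OF valid_ops(2) vr_ops(2) a serre_F[OF V ij]])
qed

lemma pair_add: "pair h (x + y) = pair h x + pair h y"
  by (simp add: pair_def distrib_left)

lemma pair_hw_exists: "\<exists>\<mu>. \<forall>h. pair h \<mu> = hw h l"
proof (induction l)
  case Nil
  have "pair h (0, 0, 0) = hw h []" for h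
    by (simp add: pair_def)
  then show ?case
    by blast
next
  case (Cons c l)
  then obtain \<mu> where \<mu>: "\<forall>h. pair h \<mu> = hw h l"
    by blast
  have "pair h (wtb c + \<mu>) = hw h (c # l)" for h
    using spec[OF \<mu>, of h] by (simp only: hw_Cons pair_add)
  then show ?case
    by blast
qed

lemma pair_wtw_exists: "\<exists>\<mu>. \<forall>h. pair h \<mu> = wtw g m l h"
proof -
  obtain \<mu> where \<mu>: "\<forall>h. pair h \<mu> = hw h l"
    using pair_hw_exists by blast
  have "pair h (lam g (m + int (length l)) + \<mu>) = wtw g m l h" for h
    using spec[OF \<mu>, of h] by (simp only: wtw_def pair_add)
  then show ?thesis
    by blast
qed

lemma validrep_opE_pow: "validrep a \<Longrightarrow> validrep ((opE g m i ^^ n) a)"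
  by (induction n) (simp_all add: valid_ops)

lemma validrep_opF_pow: "validrep a \<Longrightarrow> validrep ((opF g m i ^^ n) a)"
  by (induction n) (simp_all add: valid_ops)

lemma vr_opE_pow:
  assumes "validrep a"
  shows "vr g m ((opE g m i ^^ n) a) = (Eh g m i ^^ n) (vr g m a)"
proof (induction n)
  case (Suc n)
  show ?case
    by (simp only: funpow.simps o_apply vr_ops(1)[OF validrep_opE_pow[OF assms]] Suc)
qed simp

lemma vr_opF_pow:
  assumes "validrep a"
  shows "vr g m ((opF g m i ^^ n) a) = (Fh g m i ^^ n) (vr g m a)"
proof (induction n)
  case (Suc n)
  show ?case
    by (simp only: funpow.simps o_apply vr_ops(2)[OF validrep_opF_pow[OF assms]] Suc)
qed simp

lemma integrable_ops: "integrable g m (opE g m) (opF g m) (opK g m)"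
  unfolding integrable_def
proof (intro allI impI conjI)
  fix a
  assume a: "validrep a"
  obtain r u where ru: "a = (r, u)" "u \<in> Tn r"
    using a by (cases a) (simp add: validrep_def)
  obtain ls where ls: "set ls = {l. u l \<noteq> 0}" "distinct ls"
    using ru(2) finite_distinct_list[of "{l. u l \<noteq> 0}"] by (auto simp: Tn_def)
  have l: "length l = r" "okl l" if "l \<in> set ls" for l
    using that ls Tn_support[OF ru(2)] by auto
  obtain wt where wt: "\<And>l h. pair h (wt l) = wtw g m l h"
    using pair_wtw_exists[of g m] by metis
  define xs where "xs = map (\<lambda>l. (wt l, (r, sc (u l) (dl l)))) ls"
  have valid: "validrep (r, sc (u l) (dl l))" if "l \<in> set ls" for l
    using l[OF that] by (simp add: validrep_def Tn_scale dl_Tn)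
  have vr: "vr g m (r, sc (u l) (dl l)) = sc (u l) (wv g m l)" if "l \<in> set ls" for l
    using l[OF that] by (simp add: vr_def wv_def fv_lin)
  have "vr g m (lc g m (map (\<lambda>p. (1, snd p)) xs)) = (\<Sum>l\<leftarrow>ls. vr g m (r, sc (u l) (dl l)))"
    unfolding vr_lc xs_def by (simp add: o_def)
  also have "\<dots> = (\<Sum>l\<in>set ls. sc (u l) (wv g m l))"
    unfolding sum_list_distinct_conv_sum_set[OF ls(2)] by (intro sum.cong refl vr)
  also have "\<dots> = vr g m a"
    using fv_expand[OF ru(2), of g m] by (simp only: ls(1) vr_def ru(1) fst_conv snd_conv)
  finally have "feq g m a (lc g m (map (\<lambda>p. (1, snd p)) xs))"
    using a valid by (subst feq_vr) (auto simp: xs_def intro!: validrep_lc)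
  moreover have "validrep (snd p) \<and> (\<forall>h. feq g m (opK g m h (snd p)) (rsmult (qp (pair h (fst p))) (snd p)))"
    if p: "p \<in> set xs" for p
  proof -
    obtain l0 where l0: "l0 \<in> set ls" "p = (wt l0, (r, sc (u l0) (dl l0)))"
      using p unfolding xs_def set_map by blast
    have v: "validrep (snd p)"
      using valid[OF l0(1)] l0(2) by simp
    have "Kh g m h (vr g m (snd p)) = sc (qp (pair h (fst p))) (vr g m (snd p))" for h
      unfolding l0(2) snd_conv fst_conv vr[OF l0(1)] Kh_lin K_wv[OF l(2)[OF l0(1)]] wt
      by (rule vs.scale_left_commute)
    with v show ?thesis
      by (simp only: feq_vr valid_ops validrep_rsmult vr_ops vr_rsmult simp_thms)
  qed
  ultimately show "\<exists>xs. feq g m a (lc g m (map (\<lambda>p. (1, snd p)) xs)) \<and>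
      (\<forall>p\<in>set xs. validrep (snd p) \<and>
        (\<forall>h. feq g m (opK g m h (snd p)) (rsmult (qp (pair h (fst p))) (snd p))))"
    by blast
  show "\<exists>n. fnull g m ((opE g m i ^^ n) a)" for i
    using nil_Vm(1)[OF vr_Vm[OF a]] by (simp only: fnull_vr validrep_opE_pow[OF a] vr_opE_pow[OF a])
  show "\<exists>n. fnull g m ((opF g m i ^^ n) a)" for i
    using nil_Vm(2)[OF vr_Vm[OF a]] by (simp only: fnull_vr validrep_opF_pow[OF a] vr_opF_pow[OF a])
qed

lemma vac_weight: "feq g m (opK g m h vac) (rsmult (qp (pair h (lam g m))) vac)"
proof -
  have vac: "vac = (0, dl [])"
    by (simp add: vac_def dl_def)
  have v: "validrep vac"
    by (simp add: vac validrep_def dl_Tn)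
  have "vr g m vac = wv g m []"
    by (simp add: vac vr_def wv_def)
  then show ?thesis
    using v K_vac[of g m h] by (simp only: feq_vr valid_ops validrep_rsmult vr_ops vr_rsmult kap_def)
qed

section \<open>Convergence of the coproduct\<close>

text \<open>\<open>eps\<close> lies in qA, so its p-th power supplies p factors q. N of them cover
  the poles of the coefficients of \<open>w\<close>, and N is independent of n.\<close>

lemma Tn_eps_LN:
  assumes "w \<in> Tn t"
  shows "\<exists>N. \<forall>n p. n + N \<le> p \<longrightarrow> sc (eps g ^ p) (emb g m t w) \<in> LN g m n"
proof -
  have "finite {l. w l \<noteq> 0}"
    using assms by (simp add: Tn_def)
  then obtain N where N: "\<And>l. l \<in> {l. w l \<noteq> 0} \<Longrightarrow> qq ^ N * w l \<in> Areg"
    using Areg_common_denominator[of "{l. w l \<noteq> 0}" w] by metis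
  obtain k where k: "k \<in> Areg" "eps g = qq * k"
  proof (cases g)
    case GS_A
    then show ?thesis
      using that[of 0] by (simp add: eps_def)
  next
    case GS_B
    then show ?thesis
      using that[of "- qq"] by (simp add: eps_def power2_eq_square)
  qed
  have "sc (qq ^ N) w \<in> Lat t"
    unfolding Lat_def
  proof (intro CollectI conjI allI)
    show "sc (qq ^ N) w \<in> Tn t"
      by (rule Tn_scale[OF assms])
    show "sc (qq ^ N) w l \<in> Areg" for l
      using N[of l] by (cases "w l = 0") simp_all
  qed
  then have L: "emb g m t (sc (qq ^ N) w) \<in> LN g m 0"
    by (rule LN_Lat)
  have "sc (eps g ^ p) (emb g m t w) \<in> LN g m n" if "n + N \<le> p" for n p
  proof -
    have p: "p = n + (p - n - N) + N"
      using that by simp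
    have "eps g ^ p = k ^ p * qq ^ (p - n - N) * qq ^ n * qq ^ N"
      unfolding k(2) power_mult_distrib by (subst (1) p) (simp only: power_add mult_ac)
    then have "sc (eps g ^ p) (emb g m t w) =
        sc (k ^ p * qq ^ (p - n - N)) (sc (qq ^ n) (emb g m t (sc (qq ^ N) w)))"
      by (simp add: emb_lin vs.scale_scale mult.assoc)
    moreover have "sc (k ^ p * qq ^ (p - n - N)) (sc (qq ^ n) (emb g m t (sc (qq ^ N) w))) \<in> LN g m (0 + n)"
      by (intro LN_Ascale LN_qscale_power[OF L] Areg_mult Areg_power k(1) Areg_qq)
    ultimately show ?thesis
      by (simp only: add_0)
  qed
  then show ?thesis
    by blast
qed

text \<open>Moving \<open>f_i\<close> of the vacuum past p ground state vectors costs
  \<open>eps\<close>^p. This controls the tail that the truncated coproduct omits.\<close>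

lemma phi_shift_pow:
  "Lm p (dl (grd g m p)) (emb g (m + int p) 1 (phi g (m + int p) i)) -
    sc (eps g ^ p) (emb g m 1 (phi g m i)) \<in> Zb g m"
proof (induction p arbitrary: m)
  case 0
  have "Lm 0 (dl []) X = X" for X
    by (simp add: fun_eq_iff Lm_def dl_def)
  then have *: "Lm 0 (dl (grd g m 0)) (emb g (m + int 0) 1 (phi g (m + int 0) i)) -
      sc (eps g ^ 0) (emb g m 1 (phi g m i)) = 0"
    by simp
  show ?case
    unfolding * by (rule Zb_0)
next
  case (Suc p)
  let ?X = "emb g (m + int (Suc p)) 1 (phi g (m + int (Suc p)) i)"
  let ?Y = "emb g (m + 1) 1 (phi g (m + 1) i)" and ?b = "gs g m"
  have m: "m + 1 + int p = m + int (Suc p)"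
    by simp
  have "Lm p (dl (grd g (m + 1) p)) ?X - sc (eps g ^ p) ?Y \<in> Zb g (m + int 1)"
    using Suc[of "m + 1"] by (simp only: m of_nat_1)
  then have "Lm 1 (dl [?b]) (Lm p (dl (grd g (m + 1) p)) ?X - sc (eps g ^ p) ?Y) \<in> Zb g m"
    by (rule Zb_Lm_dl) auto
  then have 1: "Lm (Suc p) (dl (grd g m (Suc p))) ?X - sc (eps g ^ p) (Lm 1 (dl [?b]) ?Y) \<in> Zb g m"
    unfolding Lm_lin Lm_Lm
    by (simp add: tp_dl grd_Suc)
  have "sc (eps g ^ p) (Lm 1 (dl [?b]) ?Y - sc (eps g) (emb g m 1 (phi g m i))) \<in> Zb g m"
    by (intro Zb_scale phi_shift)
  then have 2: "sc (eps g ^ p) (Lm 1 (dl [?b]) ?Y) - sc (eps g ^ Suc p) (emb g m 1 (phi g m i)) \<in> Zb g m"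
    by (simp add: vs.scale_right_diff_distrib vs.scale_scale mult.commute)
  show ?case
    using Zb_trans[OF 1 2] .
qed

lemma coproduct_limit_ops: "coproduct_limit g m (opE g m) (opF g m)"
  unfolding coproduct_limit_def
proof (intro allI impI conjI)
  fix r u i n
  assume u: "u \<in> Tn r"
  have inqL: "inqL g m n (lc g m [(1, a), (- 1, b)])" if "validrep a" "validrep b"
    "er g m a - er g m b \<in> LN g m n" for a b
  proof -
    have "validrep (lc g m [(1, a), (- 1, b)])"
      using that by (intro validrep_lc) auto
    moreover have "er g m (lc g m [(1, a), (- 1, b)]) = er g m a - er g m b"
      unfolding er_lc by simp
    ultimately show ?thesis
      using that(3) inqL_iff[of "snd (lc g m [(1, a), (- 1, b)])" "fst (lc g m [(1, a), (- 1, b)])" g m n]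
      unfolding validrep_def er_def by (simp only: prod.collapse)
  qed
  \<comment> \<open>For \<open>e_i\<close> the approximation is exact modulo Z from level r on,
    since \<open>e_i\<close> annihilates the remaining vacuum.\<close>
  have "inqL g m n (lc g m [(1, opE g m i (r, u)), (- 1, (s, Eop i (Defs.ext g m r s u)))])"
    if "r \<le> s" for s
  proof (rule inqL)
    show "validrep (opE g m i (r, u))"
      by (rule valid_ops) (simp add: validrep_def u)
    show "validrep (s, Eop i (Defs.ext g m r s u))"
      by (simp add: validrep_def Eop_Tn ext_Tn u that)
    have "er g m (opE g m i (r, u)) - er g m (s, Eop i (Defs.ext g m r s u)) \<in> Zb g m"
      using fock_op_ext[OF fock_op_E u that, of g m i] unfolding fv_def er_def opE_def
      by (simp add: Pz_eq_iff[symmetric])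
    then show "er g m (opE g m i (r, u)) - er g m (s, Eop i (Defs.ext g m r s u)) \<in> LN g m n"
      by (rule Zb_LN)
  qed
  then show "\<exists>S\<ge>r. \<forall>s\<ge>S. inqL g m n (lc g m [(1, opE g m i (r, u)), (- 1, (s, Eop i (Defs.ext g m r s u)))])"
    by blast
  obtain N where N: "\<forall>n p. n + N \<le> p \<longrightarrow>
      sc (eps g ^ p) (emb g m (r + 1) (tp r u (phi g (m + int r) i))) \<in> LN g m n"
    using Tn_eps_LN[OF tp_Tn[OF u phi_Tn]] by blast
  have "inqL g m n (lc g m [(1, opF g m i (r, u)),
      (- 1, (s, \<lambda>l. qp (pair (hcor i) (lam g (m + int s))) * Fop i (Defs.ext g m r s u) l))])"
    if s: "r + (n + N) \<le> s" for s
  proof (rule inqL)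
    let ?k = "kap g (m + int s) (hcor i)" and ?p = "s - r"
    have rs: "r \<le> s" "n + N \<le> ?p" "m + int r + int ?p = m + int s"
      using s by auto
    have eq: "(\<lambda>l. qp (pair (hcor i) (lam g (m + int s))) * Fop i (Defs.ext g m r s u) l) =
        sc ?k (Fop i (Defs.ext g m r s u))"
      by (simp add: kap_def sc_def)
    show "validrep (opF g m i (r, u))"
      by (rule valid_ops) (simp add: validrep_def u)
    show "validrep (s, \<lambda>l. qp (pair (hcor i) (lam g (m + int s))) * Fop i (Defs.ext g m r s u) l)"
      unfolding eq by (simp add: validrep_def Tn_scale Fop_Tn ext_Tn u rs)
    let ?T = "emb g m (Suc s) (tF g m i s (Defs.ext g m r s u))"
    let ?X = "emb g (m + int s) 1 (phi g (m + int s) i)"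
    let ?Y = "emb g (m + int r) 1 (phi g (m + int r) i)"
    let ?G = "grd g (m + int r) ?p"
    have 1: "emb g m (Suc r) (tF g m i r u) - ?T \<in> Zb g m"
      using fock_op_ext[OF fock_op_F u rs(1), of g m i] unfolding fv_def
      by (simp add: Pz_eq_iff[symmetric])
    have "Lm s (Defs.ext g m r s u) ?X = Lm r u (Lm ?p (dl ?G) ?X)"
      using rs(1) by (simp add: ext_tp Lm_Lm)
    also have "\<dots> = Lm r u (Lm ?p (dl ?G) ?X - sc (eps g ^ ?p) ?Y) + sc (eps g ^ ?p) (Lm r u ?Y)"
      unfolding Lm_lin by simp
    also have "\<dots> \<in> LN g m n"
    proof (rule LN_add)
      show "Lm r u (Lm ?p (dl ?G) ?X - sc (eps g ^ ?p) ?Y) \<in> LN g m n"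
        using phi_shift_pow[of ?p g "m + int r" i] unfolding rs(3) by (intro Zb_LN Zb_Lm u)
      show "sc (eps g ^ ?p) (Lm r u ?Y) \<in> LN g m n"
        using N rs(2) emb_tp1[of g m r u "phi g (m + int r) i"] by simp
    qed
    finally have 2: "Lm s (Defs.ext g m r s u) ?X \<in> LN g m n" .
    \<comment> \<open>Modulo Z, truncation at level s omits exactly the term in which
      \<open>f_i\<close> acts on the vacuum at m + s.\<close>
    have "er g m (opF g m i (r, u)) -
        er g m (s, \<lambda>l. qp (pair (hcor i) (lam g (m + int s))) * Fop i (Defs.ext g m r s u) l) =
      (emb g m (Suc r) (tF g m i r u) - ?T) + Lm s (Defs.ext g m r s u) ?X"
      unfolding eq er_def opF_def fst_conv snd_conv emb_lin emb_tF[of g m s] by simp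
    then show "er g m (opF g m i (r, u)) -
        er g m (s, \<lambda>l. qp (pair (hcor i) (lam g (m + int s))) * Fop i (Defs.ext g m r s u) l) \<in> LN g m n"
      using LN_add[OF Zb_LN[OF 1] 2] by (simp only:)
  qed
  then show "\<exists>S\<ge>r. \<forall>s\<ge>S. inqL g m n (lc g m [(1, opF g m i (r, u)),
      (- 1, (s, \<lambda>l. qp (pair (hcor i) (lam g (m + int s))) * Fop i (Defs.ext g m r s u) l))])"
    by (intro exI[of _ "r + (n + N)"]) auto
qed

section \<open>Linearity of the wedge map\<close>

lemma rwedge_tp: "rwedge r u w = (r + fst w, tp r u (snd w))"
  by (simp add: rwedge_def tp_def[abs_def])

lemma validrep_rwedge: "u \<in> Tn r \<Longrightarrow> validrep w \<Longrightarrow> validrep (rwedge r u w)"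
  by (simp add: rwedge_tp validrep_def tp_Tn)

lemma vr_rwedge: "u \<in> Tn r \<Longrightarrow> vr g m (rwedge r u w) = Pz g m (Lm r u (vr g (m + int r) w))"
  by (simp add: rwedge_tp vr_def Lm_fv)

lemma tK_tp: "tK g m h (r + s) (tp r u w) = tp r (Kop h u) (tK g (m + int r) h s w)"
  by (simp add: tK_def Kop_tp tp_lin add.assoc)

lemma tF_tp:
  "tF g m i (r + s) (tp r u w) =
    tp (r + s) (tp r (Fop i u) (tK g (m + int r) (hcor i) s w)) (dl [gs g (m + int (r + s))]) +
    tp r u (tF g (m + int r) i s w)"
  unfolding tF_def tK_def Fop_tp tp_lin
  by (simp add: tp_assoc vs.scale_right_distrib add_ac)

lemma wedge_linear_ops: "wedge_linear g (opE g, opF g, opK g)"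
  unfolding wedge_linear_def prod.case
proof (intro allI impI conjI)
  fix m r u w
  assume u: "u \<in> Tn r" and w: "validrep w"
  have ws: "snd w \<in> Tn (fst w)"
    using w by (simp add: validrep_def)
  have Ku: "Kop h u \<in> Tn r" "Eop i u \<in> Tn r" "Fop i u \<in> Tn r" for h i
    using u by (auto intro: Kop_Tn Eop_Tn Fop_Tn)
  note valid = validrep_rwedge validrep_radd valid_ops u w Ku
  show "feq g m (rwedge r u w) (rwedge r u' w)" if u': "u' \<in> Tn r" "(\<lambda>l. u l - u' l) \<in> Nn r" for u'
  proof -
    have "u - u' \<in> Nn r"
      using u'(2) by (simp add: fun_diff_def)
    then have "emb g m (r + fst w) (tp r (u - u') (snd w)) \<in> Zb g m"
      by (intro Zb_Nn Nn_tp_right ws)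
    then have "vr g m (rwedge r u w) = vr g m (rwedge r u' w)"
      unfolding rwedge_tp vr_def fv_def fst_conv snd_conv Pz_eq_iff tp_lin emb_lin .
    then show ?thesis
      using valid u' by (simp only: feq_vr)
  qed
  show "feq g m (rwedge r u w) (rwedge r u w')" if "validrep w'" "feq g (m + int r) w w'" for w'
    using that valid by (simp only: feq_vr vr_rwedge)
  show "feq g m (opE g m i (rwedge r u w))
      (radd g m (rwedge r (Eop i u) w) (rwedge r (Kop (cneg (hcor i)) u) (opE g (m + int r) i w)))" for i
  proof -
    have "vr g m (opE g m i (rwedge r u w)) = vr g m (rwedge r (Eop i u) w) +
        vr g m (rwedge r (Kop (cneg (hcor i)) u) (opE g (m + int r) i w))"
      unfolding vr_def opE_def rwedge_tp fst_conv snd_conv Eop_tp fv_lin ..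
    then show ?thesis
      using valid by (simp only: feq_vr vr_radd)
  qed
  show "feq g m (opF g m i (rwedge r u w))
      (radd g m (rwedge r (Fop i u) (opK g (m + int r) (hcor i) w)) (rwedge r u (opF g (m + int r) i w)))" for i
  proof -
    have "vr g m (opF g m i (rwedge r u w)) = vr g m (rwedge r (Fop i u) (opK g (m + int r) (hcor i) w)) +
        vr g m (rwedge r u (opF g (m + int r) i w))"
      unfolding vr_def opF_def opK_def rwedge_tp fst_conv snd_conv tF_tp fv_lin add_Suc_right
      \<comment> \<open>The ground state vector that pads the first summand of \<open>tF_tp\<close>
        is absorbed into the vacuum.\<close>
      by (simp only: fv_def emb_Suc)
    then show ?thesis
      using valid by (simp only: feq_vr vr_radd)
  qed
  show "feq g m (opK g m h (rwedge r u w)) (rwedge r (Kop h u) (opK g (m + int r) h w))" for h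
  proof -
    have "vr g m (opK g m h (rwedge r u w)) = vr g m (rwedge r (Kop h u) (opK g (m + int r) h w))"
      unfolding vr_def opK_def rwedge_tp fst_conv snd_conv tK_tp ..
    then show ?thesis
      using valid by (simp only: feq_vr)
  qed
qed

theorem mainTheorem8:
  fixes g :: gsch
  shows "\<exists>E F Kh.
           (\<forall>m. Uq_module g m (E m) (F m) (Kh m) \<and>
                integrable g m (E m) (F m) (Kh m) \<and>
                (\<forall>h. feq g m (Kh m h vac) (rsmult (qp (pair h (lam g m))) vac)) \<and>
                coproduct_limit g m (E m) (F m)) \<and>
           wedge_linear g (E, F, Kh)"
proof (intro exI conjI allI)
  fix m h
  show "Uq_module g m (opE g m) (opF g m) (opK g m)"
    by (rule Uq_module_ops)
  show "integrable g m (opE g m) (opF g m) (opK g m)"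
    by (rule integrable_ops)
  show "feq g m (opK g m h vac) (rsmult (qp (pair h (lam g m))) vac)"
    by (rule vac_weight)
  show "coproduct_limit g m (opE g m) (opF g m)"
    by (rule coproduct_limit_ops)
  show "wedge_linear g (opE g, opF g, opK g)"
    by (rule wedge_linear_ops)
qed

end
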